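(* Let $A$ be a regular multiplier Hopf algebra which is quasitriangular with generalized $R$-matrix $R\in M(A\otimes A)$, and let $u\in M(A)$ be the multiplier determined by $ua=\sum S(R^{(2)})R^{(1)}a$ for all $a\in A$ (it is an invertible two-sided multiplier). Put $g=uS(u)^{-1}\in M(A)$. Then $g$ is a grouplike multiplier, i.e. $\Delta(g)=g\otimes g$ in $M(A\otimes A)$, and for all $a\in A$ $$S^4(a)=g\,a\,g^{-1}.$$
   Context: Algebras are associative over $\mathbb{C}$, possibly without unit, with non-degenerate product; $M(A)$ is the multiplier algebra of $A$. A multiplier Hopf algebra $(A,\Delta)$ is such an algebra with a homomorphism $\Delta:A\to M(A\otimes A)$ such that $a\otimes b\mapsto\Delta(a)(1\otimes b)$ and $a\otimes b\mapsto(a\otimes 1)\Delta(b)$ are bijections of $A\otimes A$ onto itself and $\Delta$ is coassociative: $(a\otimes1\otimes1)(\Delta\otimes\iota)(\Delta(b)(1\otimes c))=(\iota\otimes\Delta)((a\otimes1)\Delta(b))(1\otimes1\otimes c)$. It has a unique counit $\varepsilon:A\to\mathbb{C}$ and antipode $S$; it is regular if $(A,\Delta^{cop})$ is also a multiplier Hopf algebra, equivalently $S:A\to A$ is a bijection (an anti-automorphism). Here $\sigma$ is the flip, $\Delta^{cop}=\sigma\circ\Delta$, $\iota$ is the identity map. Non-degenerate homomorphisms (such as $\Delta$, $\varepsilon$, $\Delta\otimes\iota$, $\iota\otimes\Delta$) and the anti-automorphism $S$ are extended uniquely to multiplier algebras, denoted by the same symbols. A regular multiplier Hopf algebra $A$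 is quasitriangular, with generalized $R$-matrix $R$, if $R\in M(A\otimes A)$ is invertible and (1) $R\Delta(a)=\Delta^{cop}(a)R$ for all $a\in A$; (2) $(\Delta\otimes\iota)(R)=R^{13}R^{23}$; (3) $(\iota\otimes\Delta)(R)=R^{13}R^{12}$ (leg notation in $M(A\otimes A\otimes A)$); and moreover $R(a\otimes1)$ and $(a\otimes1)R$ lie in $A\otimes M(A)$ for all $a\in A$. One writes $R(a\otimes 1)=\sum R^{(1)}a\otimes R^{(2)}$ in $A\otimes M(A)$. *)

theory Defs
  imports Complex_Main "HOL-Library.Poly_Mapping"
begin

section \<open>Complex vector spaces and algebras\<close>

class complex_vector = ab_group_add +
  fixes scaleC :: "complex \<Rightarrow> 'a \<Rightarrow> 'a"  (infixr "*\<^sub>C" 75)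
  assumes scaleC_add_right: "c *\<^sub>C (x + y) = c *\<^sub>C x + c *\<^sub>C y"
    and scaleC_add_left: "(c + d) *\<^sub>C x = c *\<^sub>C x + d *\<^sub>C x"
    and scaleC_scaleC: "c *\<^sub>C d *\<^sub>C x = (c * d) *\<^sub>C x"
    and scaleC_one: "1 *\<^sub>C x = x"

interpretation cvec: vector_space "scaleC :: complex \<Rightarrow> 'a \<Rightarrow> 'a::complex_vector"
  by unfold_locales
     (simp_all add: scaleC_add_right scaleC_add_left scaleC_scaleC scaleC_one)

abbreviation clinear :: "('a::complex_vector \<Rightarrow> 'b::complex_vector) \<Rightarrow> bool"
  where "clinear \<equiv> Vector_Spaces.linear scaleC scaleC"

lemma clinear_iff:
  "clinear f \<longleftrightarrow> (\<forall>x y. f (x + y) = f x + f y) \<and> (\<forall>c x. f (c *\<^sub>C x) = c *\<^sub>C f x)"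
  by (simp add: Vector_Spaces.linear_iff cvec.vector_space_axioms)

text \<open>Algebras are not assumed to be unital; \<open>ring\<close> is the class of rings without unit.\<close>

class complex_algebra = complex_vector + ring +
  assumes mult_scaleC_left: "(c *\<^sub>C x) * y = c *\<^sub>C (x * y)"
    and mult_scaleC_right: "x * (c *\<^sub>C y) = c *\<^sub>C (x * y)"

class nondegenerate_algebra = complex_algebra +
  assumes nondegenerate_left: "(\<And>b. a * b = 0) \<Longrightarrow> a = 0"
    and nondegenerate_right: "(\<And>b. b * a = 0) \<Longrightarrow> a = 0"


section \<open>The algebraic tensor product\<close>

text \<open>The free vector space on a type is the type of finitely supported complex functions.\<close>

definition free_scale :: "complex \<Rightarrow> ('k \<Rightarrow>\<^sub>0 complex) \<Rightarrow> ('k \<Rightarrow>\<^sub>0 complex)"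
  where "free_scale c p = Poly_Mapping.map ((*) c) p"

abbreviation free_gen :: "'k \<Rightarrow> ('k \<Rightarrow>\<^sub>0 complex)"
  where "free_gen k \<equiv> Poly_Mapping.single k 1"

definition free_lift :: "('k \<Rightarrow> 'v::complex_vector) \<Rightarrow> ('k \<Rightarrow>\<^sub>0 complex) \<Rightarrow> 'v"
  where "free_lift f p = (\<Sum>k\<in>Poly_Mapping.keys p. Poly_Mapping.lookup p k *\<^sub>C f k)"

lemma lookup_free_scale [simp]:
  "Poly_Mapping.lookup (free_scale c p) k = c * Poly_Mapping.lookup p k"
  by (simp add: free_scale_def Poly_Mapping.map.rep_eq when_def)

interpretation free: vector_space "free_scale :: complex \<Rightarrow> ('k \<Rightarrow>\<^sub>0 complex) \<Rightarrow> _"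
  by unfold_locales (auto intro!: poly_mapping_eqI simp: lookup_add algebra_simps)

lemma free_lift_superset:
  assumes "finite K" "Poly_Mapping.keys p \<subseteq> K"
  shows "free_lift f p = (\<Sum>k\<in>K. Poly_Mapping.lookup p k *\<^sub>C f k)"
  unfolding free_lift_def
  by (rule sum.mono_neutral_left) (use assms in \<open>auto simp: in_keys_iff\<close>)

lemma free_lift_add: "free_lift f (p + q) = free_lift f p + free_lift f q"
proof -
  let ?K = "Poly_Mapping.keys p \<union> Poly_Mapping.keys q"
  have "free_lift f (p + q) = (\<Sum>k\<in>?K. Poly_Mapping.lookup (p + q) k *\<^sub>C f k)"
    by (rule free_lift_superset) (auto simp: Poly_Mapping.keys_add)
  also have "\<dots> = (\<Sum>k\<in>?K. Poly_Mapping.lookup p k *\<^sub>C f k)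
                 + (\<Sum>k\<in>?K. Poly_Mapping.lookup q k *\<^sub>C f k)"
    by (simp add: lookup_add scaleC_add_left sum.distrib)
  also have "\<dots> = free_lift f p + free_lift f q"
    by (simp add: free_lift_superset[of ?K])
  finally show ?thesis .
qed

lemma free_lift_scale: "free_lift f (free_scale c p) = c *\<^sub>C free_lift f p"
proof -
  have "Poly_Mapping.keys (free_scale c p) \<subseteq> Poly_Mapping.keys p"
    by (auto simp: in_keys_iff)
  then have "free_lift f (free_scale c p)
      = (\<Sum>k\<in>Poly_Mapping.keys p. Poly_Mapping.lookup (free_scale c p) k *\<^sub>C f k)"
    by (intro free_lift_superset) auto
  then show ?thesis
    by (simp add: free_lift_def cvec.scale_sum_right)
qed

lemma free_lift_gen [simp]: "free_lift f (free_gen k) = f k"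
  by (simp add: free_lift_def)

lemma linear_free_lift: "Vector_Spaces.linear free_scale scaleC (free_lift f)"
  by (simp add: Vector_Spaces.linear_iff free.vector_space_axioms cvec.vector_space_axioms
      free_lift_add free_lift_scale)

lemma free_span_gen: "p \<in> free.span (range free_gen)"
proof -
  have "p = (\<Sum>k\<in>Poly_Mapping.keys p. free_scale (Poly_Mapping.lookup p k) (free_gen k))"
    by (rule poly_mapping_eqI)
       (auto simp: lookup_sum lookup_single when_def in_keys_iff if_distrib cong: if_cong)
  then show ?thesis
    by (metis (no_types, lifting) free.span_base free.span_scale free.span_sum rangeI)
qed

definition tensor_null :: "(('a::complex_vector \<times> 'b::complex_vector) \<Rightarrow>\<^sub>0 complex) set"
  where "tensor_null = module.span free_scale
    ({free_gen (a + a', b) - free_gen (a, b) - free_gen (a', b) | a a' b. True} \<union>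
     {free_gen (a, b + b') - free_gen (a, b) - free_gen (a, b') | a b b'. True} \<union>
     {free_gen (c *\<^sub>C a, b) - free_scale c (free_gen (a, b)) | c a b. True} \<union>
     {free_gen (a, c *\<^sub>C b) - free_scale c (free_gen (a, b)) | c a b. True})"

definition tensor_rel :: "(('a::complex_vector \<times> 'b::complex_vector) \<Rightarrow>\<^sub>0 complex) \<Rightarrow> _ \<Rightarrow> bool"
  where "tensor_rel p q \<longleftrightarrow> p - q \<in> tensor_null"

lemma tensor_null_add: "p \<in> tensor_null \<Longrightarrow> q \<in> tensor_null \<Longrightarrow> p + q \<in> tensor_null"
  unfolding tensor_null_def by (rule free.span_add)

lemma tensor_null_uminus: "p \<in> tensor_null \<Longrightarrow> - p \<in> tensor_null"
  unfolding tensor_null_def by (rule free.span_neg)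

lemma tensor_null_scale: "p \<in> tensor_null \<Longrightarrow> free_scale c p \<in> tensor_null"
  unfolding tensor_null_def by (rule free.span_scale)

quotient_type (overloaded) ('a, 'b) tensor (infixl "\<otimes>" 75) =
  "('a::complex_vector \<times> 'b::complex_vector) \<Rightarrow>\<^sub>0 complex" / tensor_rel
proof (rule equivpI)
  show "reflp tensor_rel"
    by (auto simp: reflp_def tensor_rel_def tensor_null_def free.span_zero)
  show "symp tensor_rel"
    unfolding symp_def tensor_rel_def
    using tensor_null_uminus by fastforce
  show "transp tensor_rel"
    unfolding transp_def tensor_rel_def
    using tensor_null_add by fastforce
qed

instantiation tensor :: (complex_vector, complex_vector) complex_vector
begin

lift_definition zero_tensor :: "'a \<otimes> 'b" is 0 .

lift_definition plus_tensor :: "'a \<otimes> 'b \<Rightarrow> 'a \<otimes> 'b \<Rightarrow> 'a \<otimes> 'b" is "(+)"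
  unfolding tensor_rel_def by (simp add: add_diff_add tensor_null_add)

lift_definition uminus_tensor :: "'a \<otimes> 'b \<Rightarrow> 'a \<otimes> 'b" is uminus
  unfolding tensor_rel_def by (simp only: minus_diff_minus tensor_null_uminus)

definition minus_tensor :: "'a \<otimes> 'b \<Rightarrow> 'a \<otimes> 'b \<Rightarrow> 'a \<otimes> 'b"
  where "minus_tensor x y = x + - y"

lift_definition scaleC_tensor :: "complex \<Rightarrow> 'a \<otimes> 'b \<Rightarrow> 'a \<otimes> 'b" is free_scale
  unfolding tensor_rel_def by (simp flip: free.scale_right_diff_distrib add: tensor_null_scale)

lemma tensor_rel_refl: "tensor_rel p p"
  by (rule equivp_reflp[OF tensor_equivp])

instance
proof
  fix x y z :: "'a \<otimes> 'b" and c d :: complex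
  show "x + y + z = x + (y + z)"
    by transfer (simp add: add.assoc tensor_rel_refl)
  show "x + y = y + x"
    by transfer (simp add: add.commute tensor_rel_refl)
  show "0 + x = x"
    by transfer (simp add: tensor_rel_refl)
  show "- x + x = 0"
    by transfer (simp add: tensor_rel_refl)
  show "x - y = x + - y"
    by (rule minus_tensor_def)
  show "c *\<^sub>C (x + y) = c *\<^sub>C x + c *\<^sub>C y"
    by transfer (simp add: free.scale_right_distrib tensor_rel_refl)
  show "(c + d) *\<^sub>C x = c *\<^sub>C x + d *\<^sub>C x"
    by transfer (simp add: free.scale_left_distrib tensor_rel_refl)
  show "c *\<^sub>C d *\<^sub>C x = (c * d) *\<^sub>C x"
    by transfer (simp add: tensor_rel_refl)
  show "1 *\<^sub>C x = x"
    by transfer (simp add: tensor_rel_refl)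
qed

end

lift_definition tensor :: "'a::complex_vector \<Rightarrow> 'b::complex_vector \<Rightarrow> 'a \<otimes> 'b"
  (infixl "\<otimes>" 75) is "\<lambda>a b. free_gen (a, b)" .

lemma tensor_null_base:
  "free_gen (a + a', b) - free_gen (a, b) - free_gen (a', b) \<in> tensor_null"
  "free_gen (a, b + b') - free_gen (a, b) - free_gen (a, b') \<in> tensor_null"
  "free_gen (c *\<^sub>C a, b) - free_scale c (free_gen (a, b)) \<in> tensor_null"
  "free_gen (a, c *\<^sub>C b) - free_scale c (free_gen (a, b)) \<in> tensor_null"
  unfolding tensor_null_def by (rule free.span_base, blast)+

lemma tensor_add_left: "(a + a') \<otimes> b = a \<otimes> b + a' \<otimes> b"
  by transfer (use tensor_null_base(1) in \<open>simp add: tensor_rel_def diff_diff_add\<close>)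

lemma tensor_add_right: "a \<otimes> (b + b') = a \<otimes> b + a \<otimes> b'"
  by transfer (use tensor_null_base(2) in \<open>simp add: tensor_rel_def diff_diff_add\<close>)

lemma tensor_scaleC_left: "(c *\<^sub>C a) \<otimes> b = c *\<^sub>C (a \<otimes> b)"
  by transfer (use tensor_null_base(3) in \<open>simp add: tensor_rel_def\<close>)

lemma tensor_scaleC_right: "a \<otimes> (c *\<^sub>C b) = c *\<^sub>C (a \<otimes> b)"
  by transfer (use tensor_null_base(4) in \<open>simp add: tensor_rel_def\<close>)

lemma tensor_induct [case_names tensor add scaleC]:
  assumes gen: "\<And>a b. P (a \<otimes> b)"
    and add: "\<And>x y. P x \<Longrightarrow> P y \<Longrightarrow> P (x + y)"
    and scale: "\<And>c x. P x \<Longrightarrow> P (c *\<^sub>C x)"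
  shows "P (x :: 'a::complex_vector \<otimes> 'b::complex_vector)"
proof -
  have zero: "P 0"
    using scale[of "0 \<otimes> 0" 0] gen by simp
  obtain p where x: "x = abs_tensor p"
    by (metis Quotient_tensor Quotient_abs_rep)
  have "P (abs_tensor p)"
    using free_span_gen[of p]
  proof (induction rule: free.span_induct_alt)
    case base
    then show ?case using zero by (simp add: zero_tensor_def)
  next
    case (step c y z)
    then obtain a b where "y = free_gen (a, b)" by auto
    then have "abs_tensor (free_scale c y + z) = c *\<^sub>C (a \<otimes> b) + abs_tensor z"
      by (simp add: plus_tensor.abs_eq scaleC_tensor.abs_eq tensor.abs_eq)
    then show ?case
      using step gen add scale by metis
  qed
  then show ?thesis using x by simp
qed

definition bilin :: "('a::complex_vector \<Rightarrow> 'b::complex_vector \<Rightarrow> 'c::complex_vector) \<Rightarrow> bool"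
  where "bilin f \<longleftrightarrow> (\<forall>b. clinear (\<lambda>a. f a b)) \<and> (\<forall>a. clinear (f a))"

text \<open>The linear map on the tensor product induced by a bilinear map (see
  \<open>tensor_lift_tensor\<close>); the value is meaningless for maps that are not bilinear.\<close>

definition tensor_lift ::
    "('a::complex_vector \<Rightarrow> 'b::complex_vector \<Rightarrow> 'c::complex_vector) \<Rightarrow> 'a \<otimes> 'b \<Rightarrow> 'c"
  where "tensor_lift f x = free_lift (\<lambda>(a, b). f a b) (rep_tensor x)"

lemma free_lift_null:
  assumes "bilin f" "p \<in> tensor_null"
  shows "free_lift (\<lambda>(a, b). f a b) p = 0"
proof -
  let ?F = "free_lift (\<lambda>(a, b). f a b)"
  interpret F: Vector_Spaces.linear free_scale scaleC ?F
    by (rule linear_free_lift)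
  have eq: "?F (free_gen (a, b)) = f a b" for a b
    by simp
  show ?thesis
    using assms(2) unfolding tensor_null_def
  proof (induction rule: free.span_induct_alt)
    case base
    show ?case by (rule F.zero)
  next
    case (step c y z)
    have "?F y = 0"
      using step(1) assms(1)
      by (auto simp: F.diff F.scale bilin_def clinear_iff simp del: free_lift_gen simp: eq)
    then show ?case using step by (simp add: F.add F.scale)
  qed
qed

lemma tensor_lift_abs:
  assumes "bilin f"
  shows "tensor_lift f (abs_tensor p) = free_lift (\<lambda>(a, b). f a b) p"
proof -
  interpret F: Vector_Spaces.linear free_scale scaleC "free_lift (\<lambda>(a, b). f a b)"
    by (rule linear_free_lift)
  have "tensor_rel (rep_tensor (abs_tensor p)) p"
    using Quotient_rep_abs[OF Quotient_tensor] tensor_rel_refl by blast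
  then show ?thesis
    using free_lift_null[OF assms] unfolding tensor_rel_def tensor_lift_def
    by (metis F.diff eq_iff_diff_eq_0)
qed

lemma tensor_lift_tensor: "bilin f \<Longrightarrow> tensor_lift f (a \<otimes> b) = f a b"
  by (simp add: tensor.abs_eq tensor_lift_abs)

lemma clinear_tensor_lift: "bilin f \<Longrightarrow> clinear (tensor_lift f)"
  unfolding clinear_iff
proof (intro conjI allI)
  fix x y :: "'a \<otimes> 'b" and c
  assume f: "bilin f"
  obtain p q where "x = abs_tensor p" "y = abs_tensor q"
    by (metis Quotient_tensor Quotient_abs_rep)
  then show "tensor_lift f (x + y) = tensor_lift f x + tensor_lift f y"
    and "tensor_lift f (c *\<^sub>C x) = c *\<^sub>C tensor_lift f x"
    by (simp_all add: plus_tensor.abs_eq scaleC_tensor.abs_eq tensor_lift_abs[OF f]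
        free_lift_add free_lift_scale)
qed

lemmas tensor_lift_add = clinear_tensor_lift[unfolded clinear_iff, THEN conjunct1, rule_format]
lemmas tensor_lift_scaleC = clinear_tensor_lift[unfolded clinear_iff, THEN conjunct2, rule_format]

definition tensor_map :: "('a::complex_vector \<Rightarrow> 'c::complex_vector) \<Rightarrow>
    ('b::complex_vector \<Rightarrow> 'd::complex_vector) \<Rightarrow> 'a \<otimes> 'b \<Rightarrow> 'c \<otimes> 'd"
  where "tensor_map f g = tensor_lift (\<lambda>a b. f a \<otimes> g b)"

lemma bilin_tensor_map: "clinear f \<Longrightarrow> clinear g \<Longrightarrow> bilin (\<lambda>a b. f a \<otimes> g b)"
  by (simp add: bilin_def clinear_iff tensor_add_left tensor_add_right
      tensor_scaleC_left tensor_scaleC_right)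

lemma tensor_map_tensor:
  "clinear f \<Longrightarrow> clinear g \<Longrightarrow> tensor_map f g (a \<otimes> b) = f a \<otimes> g b"
  by (simp add: tensor_map_def tensor_lift_tensor bilin_tensor_map)

lemma clinear_tensor_map: "clinear f \<Longrightarrow> clinear g \<Longrightarrow> clinear (tensor_map f g)"
  by (simp add: tensor_map_def clinear_tensor_lift bilin_tensor_map)

lemma clinear_mult_left: "clinear (\<lambda>x. (a::'a::complex_algebra) * x)"
  by (simp add: clinear_iff distrib_left mult_scaleC_right)

lemma clinear_mult_right: "clinear (\<lambda>x. x * (a::'a::complex_algebra))"
  by (simp add: clinear_iff distrib_right mult_scaleC_left)

instantiation tensor :: (complex_algebra, complex_algebra) complex_algebra
begin

definition times_tensor :: "'a \<otimes> 'b \<Rightarrow> 'a \<otimes> 'b \<Rightarrow> 'a \<otimes> 'b"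
  where "times_tensor x y = tensor_lift (\<lambda>a b. tensor_map ((*) a) ((*) b) y) x"

lemma bilin_times_tensor: "bilin (\<lambda>a b. tensor_map ((*) a) ((*) b) (y :: 'a \<otimes> 'b))"
  unfolding bilin_def clinear_iff
proof (intro conjI allI)
  note lin = clinear_tensor_map[OF clinear_mult_left clinear_mult_left, unfolded clinear_iff]
  note gen = tensor_map_tensor[OF clinear_mult_left clinear_mult_left]
  fix a a' :: 'a and b b' :: 'b and c
  show "tensor_map ((*) (a + a')) ((*) b) y = tensor_map ((*) a) ((*) b) y + tensor_map ((*) a') ((*) b) y"
    by (induction y rule: tensor_induct)
       (simp_all add: lin gen scaleC_add_right add.assoc add.left_commute,
        simp_all add: distrib_right tensor_add_left)
  show "tensor_map ((*) a) ((*) (b + b')) y = tensor_map ((*) a) ((*) b) y + tensor_map ((*) a) ((*) b') y"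
    by (induction y rule: tensor_induct)
       (simp_all add: lin gen scaleC_add_right add.assoc add.left_commute,
        simp_all add: distrib_right tensor_add_right)
  show "tensor_map ((*) (c *\<^sub>C a)) ((*) b) y = c *\<^sub>C tensor_map ((*) a) ((*) b) y"
    by (induction y rule: tensor_induct)
       (simp_all add: lin gen scaleC_add_right mult.commute,
        simp_all add: mult_scaleC_left tensor_scaleC_left)
  show "tensor_map ((*) a) ((*) (c *\<^sub>C b)) y = c *\<^sub>C tensor_map ((*) a) ((*) b) y"
    by (induction y rule: tensor_induct)
       (simp_all add: lin gen scaleC_add_right mult.commute,
        simp_all add: mult_scaleC_left tensor_scaleC_right)
qed

lemma times_tensor_add_left: "(x + y) * z = x * z + y * (z :: 'a \<otimes> 'b)"
  by (simp add: times_tensor_def tensor_lift_add bilin_times_tensor)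

lemma times_tensor_scaleC_left: "(c *\<^sub>C x) * z = c *\<^sub>C (x * (z :: 'a \<otimes> 'b))"
  by (simp add: times_tensor_def tensor_lift_scaleC bilin_times_tensor)

lemma times_tensor_left: "(a \<otimes> b) * y = tensor_map ((*) a) ((*) b) (y :: 'a \<otimes> 'b)"
  by (simp add: times_tensor_def tensor_lift_tensor bilin_times_tensor)

lemma times_tensor_tensor: "(a \<otimes> b) * (a' \<otimes> b') = ((a * a') \<otimes> (b * b') :: 'a \<otimes> 'b)"
  by (simp add: times_tensor_left tensor_map_tensor clinear_mult_left)

lemma times_tensor_add_right: "x * (y + z) = x * y + x * (z :: 'a \<otimes> 'b)"
  by (induction x rule: tensor_induct)
     (simp_all add: times_tensor_add_left times_tensor_scaleC_left times_tensor_left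
       clinear_tensor_map[OF clinear_mult_left clinear_mult_left, unfolded clinear_iff]
       scaleC_add_right)

lemma times_tensor_scaleC_right: "x * (c *\<^sub>C z) = c *\<^sub>C (x * (z :: 'a \<otimes> 'b))"
  by (induction x rule: tensor_induct)
     (simp_all add: times_tensor_add_left times_tensor_scaleC_left times_tensor_left
       clinear_tensor_map[OF clinear_mult_left clinear_mult_left, unfolded clinear_iff]
       scaleC_add_right mult.commute)

instance
proof
  note simps = times_tensor_add_left times_tensor_scaleC_left times_tensor_add_right
    times_tensor_scaleC_right
  fix x y z :: "'a \<otimes> 'b" and c :: complex
  have 1: "(a \<otimes> b) * (a' \<otimes> b') * z = (a \<otimes> b) * ((a' \<otimes> b') * z)" for a a' :: 'a and b b' :: 'b
    by (induction z rule: tensor_induct) (simp_all add: simps times_tensor_tensor mult.assoc)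
  have 2: "(a \<otimes> b) * y * z = (a \<otimes> b) * (y * z)" for a :: 'a and b :: 'b
    by (induction y rule: tensor_induct) (simp_all add: simps 1)
  show "x * y * z = x * (y * z)"
    by (induction x rule: tensor_induct) (simp_all add: simps 2)
qed (simp_all add: times_tensor_add_left times_tensor_scaleC_left times_tensor_add_right
    times_tensor_scaleC_right)

end


section \<open>The multiplier algebra\<close>

text \<open>A multiplier is a pair of a left multiplier \<open>b \<mapsto> m b\<close> and a right multiplier
  \<open>b \<mapsto> b m\<close> that are compatible via \<open>(a m) b = a (m b)\<close>.\<close>

definition is_multiplier :: "('a::complex_algebra \<Rightarrow> 'a) \<times> ('a \<Rightarrow> 'a) \<Rightarrow> bool"
  where "is_multiplier = (\<lambda>(l, r). clinear l \<and> clinear r \<and>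
    (\<forall>a b. l (a * b) = l a * b) \<and> (\<forall>a b. r (a * b) = a * r b) \<and> (\<forall>a b. r a * b = a * l b))"

typedef (overloaded) 'a multiplier = "{m :: ('a::complex_algebra \<Rightarrow> 'a) \<times> ('a \<Rightarrow> 'a). is_multiplier m}"
  by (rule exI[of _ "(id, id)"]) (simp add: is_multiplier_def clinear_iff)

setup_lifting type_definition_multiplier

lift_definition mleft :: "'a::complex_algebra multiplier \<Rightarrow> 'a \<Rightarrow> 'a" is fst .
lift_definition mright :: "'a::complex_algebra multiplier \<Rightarrow> 'a \<Rightarrow> 'a" is snd .

lemma multiplier_eqI:
  "(\<And>a. mleft m a = mleft n a) \<Longrightarrow> (\<And>a. mright m a = mright n a) \<Longrightarrow> m = n"
  by transfer (auto simp: prod_eq_iff fun_eq_iff)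

lemma is_multiplier_mleft_mright: "is_multiplier (mleft m, mright m)"
  by transfer simp

lemmas multiplier_props = is_multiplier_mleft_mright[unfolded is_multiplier_def prod.case]

instantiation multiplier :: (complex_algebra) complex_algebra
begin

lift_definition zero_multiplier :: "'a multiplier" is "(\<lambda>_. 0, \<lambda>_. 0)"
  by (simp add: is_multiplier_def clinear_iff)

lift_definition plus_multiplier :: "'a multiplier \<Rightarrow> 'a multiplier \<Rightarrow> 'a multiplier"
  is "\<lambda>(l, r) (l', r'). (\<lambda>a. l a + l' a, \<lambda>a. r a + r' a)"
  by (auto simp: is_multiplier_def clinear_iff algebra_simps scaleC_add_right)

lift_definition uminus_multiplier :: "'a multiplier \<Rightarrow> 'a multiplier"
  is "\<lambda>(l, r). (\<lambda>a. - l a, \<lambda>a. - r a)"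
  by (auto simp: is_multiplier_def clinear_iff)

definition minus_multiplier :: "'a multiplier \<Rightarrow> 'a multiplier \<Rightarrow> 'a multiplier"
  where "minus_multiplier m n = m + - n"

lift_definition scaleC_multiplier :: "complex \<Rightarrow> 'a multiplier \<Rightarrow> 'a multiplier"
  is "\<lambda>c (l, r). (\<lambda>a. c *\<^sub>C l a, \<lambda>a. c *\<^sub>C r a)"
  by (auto simp: is_multiplier_def clinear_iff scaleC_add_right mult_scaleC_left
      mult_scaleC_right mult.commute)

lift_definition times_multiplier :: "'a multiplier \<Rightarrow> 'a multiplier \<Rightarrow> 'a multiplier"
  is "\<lambda>(l, r) (l', r'). (\<lambda>a. l (l' a), \<lambda>a. r' (r a))"
  by (auto simp: is_multiplier_def clinear_iff)

instance
proof
  fix x y z :: "'a multiplier" and c d :: complex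
  show "x + y + z = x + (y + z)" by transfer (auto simp: add.assoc)
  show "x + y = y + x" by transfer (auto simp: add.commute)
  show "0 + x = x" by transfer auto
  show "- x + x = 0" by transfer auto
  show "x - y = x + - y" by (rule minus_multiplier_def)
  show "c *\<^sub>C (x + y) = c *\<^sub>C x + c *\<^sub>C y" by transfer (auto simp: scaleC_add_right)
  show "(c + d) *\<^sub>C x = c *\<^sub>C x + d *\<^sub>C x" by transfer (auto simp: scaleC_add_left)
  show "c *\<^sub>C d *\<^sub>C x = (c * d) *\<^sub>C x" by transfer auto
  show "1 *\<^sub>C x = x" by transfer auto
  show "x * y * z = x * (y * z)" by transfer auto
  show "(x + y) * z = x * z + y * z"
    by transfer (auto simp: is_multiplier_def clinear_iff)
  show "x * (y + z) = x * y + x * z"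
    by transfer (auto simp: is_multiplier_def clinear_iff)
  show "(c *\<^sub>C x) * y = c *\<^sub>C (x * y)"
    by transfer (auto simp: is_multiplier_def clinear_iff)
  show "x * (c *\<^sub>C y) = c *\<^sub>C (x * y)"
    by transfer (auto simp: is_multiplier_def clinear_iff)
qed

end

text \<open>\<open>ring_1\<close> is not available, since it excludes the zero algebra.\<close>

instantiation multiplier :: (complex_algebra) monoid_mult
begin

lift_definition one_multiplier :: "'a multiplier" is "(\<lambda>a. a, \<lambda>a. a)"
  by (simp add: is_multiplier_def clinear_iff)

instance by standard (transfer; auto)+

end

lift_definition mult_embed :: "'a::complex_algebra \<Rightarrow> 'a multiplier"
  is "\<lambda>a. (\<lambda>b. a * b, \<lambda>b. b * a)"
  by (simp add: is_multiplier_def clinear_mult_left clinear_mult_right mult.assoc)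

definition minvertible :: "'a::monoid_mult \<Rightarrow> bool"
  where "minvertible x \<longleftrightarrow> (\<exists>y. x * y = 1 \<and> y * x = 1)"

definition minverse :: "'a::monoid_mult \<Rightarrow> 'a"
  where "minverse x = (THE y. x * y = 1 \<and> y * x = 1)"

text \<open>The canonical map \<open>M(A) \<times> M(B) \<rightarrow> M(A \<otimes> B)\<close>.\<close>

lift_definition mtensor :: "'a::complex_algebra multiplier \<Rightarrow> 'b::complex_algebra multiplier \<Rightarrow>
    ('a \<otimes> 'b) multiplier"  (infixl "\<otimes>\<^sub>M" 75)
  is "\<lambda>(l, r) (l', r'). (tensor_map l l', tensor_map r r')"
proof clarsimp
  fix l r :: "'a \<Rightarrow> 'a" and l' r' :: "'b \<Rightarrow> 'b"
  assume m: "is_multiplier (l, r)" "is_multiplier (l', r')"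
  then have lin: "clinear l" "clinear r" "clinear l'" "clinear r'"
    by (auto simp: is_multiplier_def)
  have T: "clinear (tensor_map l l')" "clinear (tensor_map r r')"
    using lin by (simp_all add: clinear_tensor_map)
  note simps = T[unfolded clinear_iff] tensor_map_tensor[OF lin(1) lin(3)]
    tensor_map_tensor[OF lin(2) lin(4)] times_tensor_tensor times_tensor_add_left
    times_tensor_add_right times_tensor_scaleC_left times_tensor_scaleC_right
    m[unfolded is_multiplier_def prod.case]
  have "tensor_map l l' ((a \<otimes> b) * y) = tensor_map l l' (a \<otimes> b) * y" for a b y
    by (induction y rule: tensor_induct) (simp_all add: simps)
  then have L: "tensor_map l l' (x * y) = tensor_map l l' x * y" for x y
    by (induction x rule: tensor_induct) (simp_all add: simps)
  have "tensor_map r r' ((a \<otimes> b) * y) = (a \<otimes> b) * tensor_map r r' y" for a b y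
    by (induction y rule: tensor_induct) (simp_all add: simps)
  then have R: "tensor_map r r' (x * y) = x * tensor_map r r' y" for x y
    by (induction x rule: tensor_induct) (simp_all add: simps)
  have "tensor_map r r' (a \<otimes> b) * y = (a \<otimes> b) * tensor_map l l' y" for a b y
    by (induction y rule: tensor_induct) (simp_all add: simps)
  then have "tensor_map r r' x * y = x * tensor_map l l' y" for x y
    by (induction x rule: tensor_induct) (simp_all add: simps)
  with T L R show "is_multiplier (tensor_map l l', tensor_map r r')"
    by (simp add: is_multiplier_def)
qed

text \<open>The extension to \<open>M(A)\<close> of a (non-degenerate) homomorphism \<open>A \<rightarrow> M(B)\<close>, of an
  isomorphism \<open>A \<rightarrow> B\<close>, and of an anti-automorphism of \<open>A\<close>. In each of these situations the
  extension exists and is unique.\<close>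

definition mext :: "('a::complex_algebra \<Rightarrow> 'b::complex_algebra multiplier) \<Rightarrow>
    'a multiplier \<Rightarrow> 'b multiplier"
  where "mext f = (THE F. clinear F \<and> (\<forall>m n. F (m * n) = F m * F n) \<and> F 1 = 1 \<and>
    (\<forall>a. F (mult_embed a) = f a))"

definition mext_iso :: "('a::complex_algebra \<Rightarrow> 'b::complex_algebra) \<Rightarrow>
    'a multiplier \<Rightarrow> 'b multiplier"
  where "mext_iso f = mext (\<lambda>a. mult_embed (f a))"

definition mext_anti :: "('a::complex_algebra \<Rightarrow> 'a) \<Rightarrow> 'a multiplier \<Rightarrow> 'a multiplier"
  where "mext_anti S = (THE F. clinear F \<and> (\<forall>m n. F (m * n) = F n * F m) \<and> F 1 = 1 \<and>
    (\<forall>a. F (mult_embed a) = mult_embed (S a)))"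

text \<open>For \<open>f : A \<rightarrow> M(C)\<close> and \<open>g : B \<rightarrow> M(D)\<close>, the map \<open>f \<otimes> g : A \<otimes> B \<rightarrow> M(C \<otimes> D)\<close>.\<close>

definition hom_tensor :: "('a::complex_algebra \<Rightarrow> 'c::complex_algebra multiplier) \<Rightarrow>
    ('b::complex_algebra \<Rightarrow> 'd::complex_algebra multiplier) \<Rightarrow> 'a \<otimes> 'b \<Rightarrow> ('c \<otimes> 'd) multiplier"
  where "hom_tensor f g = tensor_lift (\<lambda>a b. f a \<otimes>\<^sub>M g b)"

definition flip :: "'a::complex_vector \<otimes> 'b::complex_vector \<Rightarrow> 'b \<otimes> 'a"
  where "flip = tensor_lift (\<lambda>a b. b \<otimes> a)"

text \<open>Threefold tensor products are bracketed to the left; \<open>reassoc\<close> is the canonical map into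
  this form.\<close>

definition reassoc :: "'a::complex_vector \<otimes> ('b::complex_vector \<otimes> 'c::complex_vector) \<Rightarrow> 'a \<otimes> 'b \<otimes> 'c"
  where "reassoc = tensor_lift (\<lambda>a. tensor_lift (\<lambda>b c. a \<otimes> b \<otimes> c))"

definition swap23 :: "'a::complex_vector \<otimes> 'b::complex_vector \<otimes> 'c::complex_vector \<Rightarrow> 'a \<otimes> 'c \<otimes> 'b"
  where "swap23 = tensor_lift (\<lambda>x c. tensor_lift (\<lambda>a b. a \<otimes> c \<otimes> b) x)"


section \<open>Multiplier Hopf algebras\<close>

text \<open>In the following definitions the elements \<open>\<Delta>(a)(1 \<otimes> b)\<close> and \<open>(a \<otimes> 1)\<Delta>(b)\<close> of
  \<open>A \<otimes> A\<close> are those \<open>x\<close> for which \<open>mult_embed x\<close> is the corresponding multiplier.\<close>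

definition multiplier_hopf_algebra ::
    "('a::nondegenerate_algebra \<Rightarrow> ('a \<otimes> 'a) multiplier) \<Rightarrow> bool"
  where "multiplier_hopf_algebra \<Delta> \<longleftrightarrow>
    clinear \<Delta> \<and> (\<forall>a b. \<Delta> (a * b) = \<Delta> a * \<Delta> b) \<and>
    bij_betw (tensor_lift (\<lambda>a b. \<Delta> a * (1 \<otimes>\<^sub>M mult_embed b))) UNIV (range mult_embed) \<and>
    bij_betw (tensor_lift (\<lambda>a b. (mult_embed a \<otimes>\<^sub>M 1) * \<Delta> b)) UNIV (range mult_embed) \<and>
    (\<forall>a b c x y. mult_embed x = \<Delta> b * (1 \<otimes>\<^sub>M mult_embed c) \<longrightarrow> mult_embed y = (mult_embed a \<otimes>\<^sub>M 1) * \<Delta> b \<longrightarrow>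
      (mult_embed a \<otimes>\<^sub>M 1 \<otimes>\<^sub>M 1) * hom_tensor \<Delta> mult_embed x =
      mext_iso reassoc (hom_tensor mult_embed \<Delta> y) * (1 \<otimes>\<^sub>M 1 \<otimes>\<^sub>M mult_embed c))"

definition cop :: "('a::nondegenerate_algebra \<Rightarrow> ('a \<otimes> 'a) multiplier) \<Rightarrow> 'a \<Rightarrow> ('a \<otimes> 'a) multiplier"
  where "cop \<Delta> a = mext_iso flip (\<Delta> a)"

definition regular_multiplier_hopf_algebra ::
    "('a::nondegenerate_algebra \<Rightarrow> ('a \<otimes> 'a) multiplier) \<Rightarrow> bool"
  where "regular_multiplier_hopf_algebra \<Delta> \<longleftrightarrow>
    multiplier_hopf_algebra \<Delta> \<and> multiplier_hopf_algebra (cop \<Delta>)"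

definition is_counit ::
    "('a::nondegenerate_algebra \<Rightarrow> ('a \<otimes> 'a) multiplier) \<Rightarrow> ('a \<Rightarrow> complex) \<Rightarrow> bool"
  where "is_counit \<Delta> \<epsilon> \<longleftrightarrow>
    Vector_Spaces.linear scaleC (*) \<epsilon> \<and> (\<forall>a b. \<epsilon> (a * b) = \<epsilon> a * \<epsilon> b) \<and>
    (\<forall>a b x. mult_embed x = \<Delta> a * (1 \<otimes>\<^sub>M mult_embed b) \<longrightarrow> tensor_lift (\<lambda>p q. \<epsilon> p *\<^sub>C q) x = a * b) \<and>
    (\<forall>a b x. mult_embed x = (mult_embed a \<otimes>\<^sub>M 1) * \<Delta> b \<longrightarrow> tensor_lift (\<lambda>p q. \<epsilon> q *\<^sub>C p) x = a * b)"

text \<open>In general the antipode takes values in \<open>M(A)\<close>; for regular multiplier Hopf algebras it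
  takes values in \<open>A\<close>, and only this case is needed.\<close>

definition is_antipode :: "('a::nondegenerate_algebra \<Rightarrow> ('a \<otimes> 'a) multiplier) \<Rightarrow>
    ('a \<Rightarrow> complex) \<Rightarrow> ('a \<Rightarrow> 'a) \<Rightarrow> bool"
  where "is_antipode \<Delta> \<epsilon> S \<longleftrightarrow>
    clinear S \<and> (\<forall>a b. S (a * b) = S b * S a) \<and>
    (\<forall>a b x. mult_embed x = \<Delta> a * (1 \<otimes>\<^sub>M mult_embed b) \<longrightarrow> tensor_lift (\<lambda>p q. S p * q) x = \<epsilon> a *\<^sub>C b) \<and>
    (\<forall>a b x. mult_embed x = (mult_embed a \<otimes>\<^sub>M 1) * \<Delta> b \<longrightarrow> tensor_lift (\<lambda>p q. p * S q) x = \<epsilon> b *\<^sub>C a)"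


section \<open>Quasitriangularity\<close>

text \<open>The canonical embedding \<open>A \<otimes> M(A) \<rightarrow> M(A \<otimes> A)\<close>.\<close>

definition half_embed :: "'a::complex_algebra \<otimes> 'a multiplier \<Rightarrow> ('a \<otimes> 'a) multiplier"
  where "half_embed = tensor_lift (\<lambda>a m. mult_embed a \<otimes>\<^sub>M m)"

definition leg12 :: "('a::complex_algebra \<otimes> 'a) multiplier \<Rightarrow> ('a \<otimes> 'a \<otimes> 'a) multiplier"
  where "leg12 R = R \<otimes>\<^sub>M 1"

definition leg13 :: "('a::complex_algebra \<otimes> 'a) multiplier \<Rightarrow> ('a \<otimes> 'a \<otimes> 'a) multiplier"
  where "leg13 R = mext_iso swap23 (R \<otimes>\<^sub>M 1)"

definition leg23 :: "('a::complex_algebra \<otimes> 'a) multiplier \<Rightarrow> ('a \<otimes> 'a \<otimes> 'a) multiplier"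
  where "leg23 R = mext_iso reassoc (1 \<otimes>\<^sub>M R)"

definition generalized_R_matrix ::
    "('a::nondegenerate_algebra \<Rightarrow> ('a \<otimes> 'a) multiplier) \<Rightarrow> ('a \<otimes> 'a) multiplier \<Rightarrow> bool"
  where "generalized_R_matrix \<Delta> R \<longleftrightarrow>
    minvertible R \<and>
    (\<forall>a. R * \<Delta> a = cop \<Delta> a * R) \<and>
    mext (hom_tensor \<Delta> mult_embed) R = leg13 R * leg23 R \<and>
    mext_iso reassoc (mext (hom_tensor mult_embed \<Delta>) R) = leg13 R * leg12 R \<and>
    (\<forall>a. R * (mult_embed a \<otimes>\<^sub>M 1) \<in> range half_embed \<and> (mult_embed a \<otimes>\<^sub>M 1) * R \<in> range half_embed)"

text \<open>The multiplier \<open>u\<close> with \<open>u a = \<Sum> S(R\<^sup>(\<^sup>2\<^sup>)) R\<^sup>(\<^sup>1\<^sup>) a\<close>, where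
  \<open>R (a \<otimes> 1) = \<Sum> R\<^sup>(\<^sup>1\<^sup>) a \<otimes> R\<^sup>(\<^sup>2\<^sup>)\<close> in \<open>A \<otimes> M(A)\<close>.\<close>

definition drinfeld_multiplier ::
    "('a::nondegenerate_algebra \<otimes> 'a) multiplier \<Rightarrow> ('a \<Rightarrow> 'a) \<Rightarrow> 'a multiplier \<Rightarrow> bool"
  where "drinfeld_multiplier R S u \<longleftrightarrow>
    (\<forall>a t. half_embed t = R * (mult_embed a \<otimes>\<^sub>M 1) \<longrightarrow>
      mleft u a = tensor_lift (\<lambda>x m. mleft (mext_anti S m) x) t)"

definition grouplike ::
    "('a::nondegenerate_algebra \<Rightarrow> ('a \<otimes> 'a) multiplier) \<Rightarrow> 'a multiplier \<Rightarrow> bool"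
  where "grouplike \<Delta> g \<longleftrightarrow> mext \<Delta> g = g \<otimes>\<^sub>M g"

end

theory Submission
  imports Defs
begin

text \<open>
  The second legs of \<open>R\<close> are multipliers \<open>m\<close> whose coproduct lies in \<open>M(A) \<otimes> M(A)\<close>, so on them
  the usual Hopf algebra computations make sense, with the first legs covered by elements of \<open>A\<close>.
  From \<open>R \<Delta>(x) = \<Delta>\<^sup>c\<^sup>o\<^sup>p(x) R\<close> one gets \<open>u x = S\<^sup>2(x) u\<close>, and hence the formula for \<open>S\<^sup>4\<close>, since
  applying \<open>S\<close> shows that \<open>S(u)\<^sup>-\<^sup>1\<close> implements \<open>S\<^sup>2\<close> as well. Writing \<open>q = R\<^sup>-\<^sup>1 (R\<^sup>2\<^sup>1)\<^sup>-\<^sup>1\<close>, the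
  formulas for \<open>(\<Delta> \<otimes> \<iota>)(R)\<close> and \<open>(\<iota> \<otimes> \<Delta>)(R)\<close> give \<open>\<Delta>(u) = (u \<otimes> u) q\<close>. The
  anti-automorphism \<open>\<sigma>(S \<otimes> S)\<close> fixes \<open>q\<close>, because \<open>(S \<otimes> S)(R) = R\<close>, so that
  \<open>\<Delta>(S(u)) = q (S(u) \<otimes> S(u))\<close>; as \<open>q\<close> commutes with \<open>\<Delta>(S(u))\<close>, it may be moved to the right,
  where it cancels in \<open>\<Delta>(u) \<Delta>(S(u))\<^sup>-\<^sup>1\<close>.
\<close>

text \<open>Without a unit the legs of \<Delta>(x) and of \<open>R\<close> are not elements of A, so
  each Sweedler computation is carried out on covered products such as \<Delta>(a)(1 \<otimes> b),
  and bijectivity of the canonical maps serves as an induction principle on A \<otimes> A. The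
  antipode comes only with its defining identities. Its bijectivity is derived from regularity,
  through the coverings \<Delta>(a)(b \<otimes> 1) and (1 \<otimes> b)\<Delta>(a), and its
  compatibility with \<Delta> from a convolution argument. The equation (S \<otimes> S)(R) = R comes
  from two expressions for R^-1: the formula for (\<Delta> \<otimes> \<iota>)(R) gives (S \<otimes>
  \<iota>)(R) = R^-1, and the formula for (\<iota> \<otimes> \<Delta>)(R) gives (\<iota> \<otimes>
  S^-1)(R) = R^-1. Both factors of q in \<Delta>(u) arise from the second expression together with
  S(m) u = u S^-1(m): the factor (R21)^-1 when the coproducts of second legs are split, the factor
  R^-1 after R13 R23 has been exchanged for R23 R13 by a Yang-Baxter relation.\<close>

section \<open>Bilinear lifts and slices on tensor products\<close>

lemma tensor_lift_fun_add:
  "tensor_lift (\<lambda>a b. f a b + g a b) x = tensor_lift f x + tensor_lift g x"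
  by (simp add: tensor_lift_def free_lift_def case_prod_unfold scaleC_add_right sum.distrib)

lemma tensor_lift_fun_scaleC: "tensor_lift (\<lambda>a b. c *\<^sub>C f a b) x = c *\<^sub>C tensor_lift f x"
  by (simp add: tensor_lift_def free_lift_def case_prod_unfold cvec.scale_sum_right mult.commute)

lemma clinear_add: "clinear f \<Longrightarrow> f (x + y) = f x + f y"
  and clinear_scaleC: "clinear f \<Longrightarrow> f (c *\<^sub>C x) = c *\<^sub>C f x"
  by (auto simp: clinear_iff)

lemma clinear_zero: "clinear f \<Longrightarrow> f 0 = 0"
  using clinear_scaleC[of f 0 0] by simp

lemma clinear_diff: "clinear f \<Longrightarrow> f (x - y) = f x - f y"
  by (metis clinear_add add_diff_cancel diff_add_cancel)

lemma clinear_injI: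
  assumes f: "clinear f" and "\<And>x. f x = 0 \<Longrightarrow> x = 0"
  shows "inj f"
proof (rule injI)
  fix x y assume "f x = f y"
  then have "x - y = 0" by (intro assms(2)) (simp add: clinear_diff[OF f])
  then show "x = y" by simp
qed

lemma clinear_sum: "clinear f \<Longrightarrow> f (\<Sum>i\<in>I. g i) = (\<Sum>i\<in>I. f (g i))"
  by (induction I rule: infinite_finite_induct) (simp_all add: clinear_zero clinear_add)

text \<open>\<open>tensor_lift f x\<close> is a finite sum over one chosen representative of
  \<open>x\<close>, so a linear map passes through it for an arbitrary \<open>f\<close>.\<close>

lemma clinear_lift: "clinear K \<Longrightarrow> K (tensor_lift f x) = tensor_lift (\<lambda>a b. K (f a b)) x"
  by (simp add: tensor_lift_def free_lift_def case_prod_unfold clinear_sum clinear_scaleC)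

text \<open>An interchange of two finite sums. It serves to reorder sums over the legs of two copies
  of \<open>R\<close>.\<close>

lemma tensor_lift_swap:
  "tensor_lift (\<lambda>a b. tensor_lift (\<lambda>c d. F a b c d) y) x
    = tensor_lift (\<lambda>c d. tensor_lift (\<lambda>a b. F a b c d) x) y"
  unfolding tensor_lift_def free_lift_def
  by (simp add: case_prod_unfold cvec.scale_sum_right mult.commute)
     (rule sum.swap)

lemma clinear_comp: "clinear f \<Longrightarrow> clinear g \<Longrightarrow> clinear (\<lambda>x. f (g x))"
  by (simp add: clinear_iff)

lemma clinear_id: "clinear (\<lambda>x. x)"
  by (simp add: clinear_iff)

lemma tensor_zero_left [simp]: "0 \<otimes> b = 0" and tensor_zero_right [simp]: "a \<otimes> 0 = 0"
  using tensor_scaleC_left[of 0 0 b] tensor_scaleC_right[of a 0 0] by simp_all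

lemma tensor_sum_right: "a \<otimes> (\<Sum>i\<in>I. g i) = (\<Sum>i\<in>I. a \<otimes> g i)"
  by (induction I rule: infinite_finite_induct) (simp_all add: tensor_add_right)

lemma tensor_linear_eqI:
  assumes "clinear f" "clinear g" "\<And>a b. f (a \<otimes> b) = g (a \<otimes> b)"
  shows "f x = g x"
  by (induction x rule: tensor_induct) (simp_all add: assms clinear_add clinear_scaleC)

lemma clinear_flip: "clinear flip"
  unfolding flip_def by (rule clinear_tensor_lift)
    (simp add: bilin_def clinear_iff tensor_add_left tensor_add_right tensor_scaleC_left tensor_scaleC_right)

lemma flip_tensor [simp]: "flip (a \<otimes> b) = b \<otimes> a"
  unfolding flip_def by (rule tensor_lift_tensor)
    (simp add: bilin_def clinear_iff tensor_add_left tensor_add_right tensor_scaleC_left tensor_scaleC_right)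

lemma flip_flip [simp]: "flip (flip x) = x"
  by (rule tensor_linear_eqI[of "\<lambda>x. flip (flip x)" "\<lambda>x. x"])
    (simp_all add: clinear_comp clinear_flip clinear_id)

lemma flip_add: "flip (x + y) = flip x + flip y" and flip_scaleC: "flip (c *\<^sub>C x) = c *\<^sub>C flip x"
  by (simp_all add: clinear_add clinear_scaleC clinear_flip)

abbreviation cfunctional :: "('a::complex_vector \<Rightarrow> complex) \<Rightarrow> bool"
  where "cfunctional \<equiv> Vector_Spaces.linear scaleC (*)"

lemma vector_space_complex: "vector_space ((*) :: complex \<Rightarrow> complex \<Rightarrow> complex)"
  by unfold_locales (simp_all add: algebra_simps)

lemma cfunctional_iff:
  "cfunctional f \<longleftrightarrow> (\<forall>x y. f (x + y) = f x + f y) \<and> (\<forall>c x. f (c *\<^sub>C x) = c * f x)"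
  by (simp add: Vector_Spaces.linear_iff cvec.vector_space_axioms vector_space_complex)

lemma bilin_slice_right: "cfunctional f \<Longrightarrow> bilin (\<lambda>a b. f b *\<^sub>C a)"
  and bilin_slice_left: "cfunctional f \<Longrightarrow> bilin (\<lambda>a b. f a *\<^sub>C b)"
  by (simp_all add: bilin_def cfunctional_iff clinear_iff scaleC_add_left scaleC_add_right
      scaleC_scaleC mult.commute)

text \<open>Expanding the second leg in a basis gives x as the sum of s(e) \<otimes> e, where s(e)
  is the slice of x by the coordinate functional of e. If all slices vanish, so does x.\<close>

lemma tensor_eq_zero_right:
  fixes x :: "'a::complex_vector \<otimes> 'b::complex_vector"
  assumes "\<And>f. cfunctional f \<Longrightarrow> tensor_lift (\<lambda>a b. f b *\<^sub>C a) x = 0"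
  shows "x = 0"
proof -
  define B where "B = cvec.extend_basis ({} :: 'b set)"
  have ind: "cvec.independent B" and span: "\<And>b. b \<in> cvec.span B"
    unfolding B_def by (simp_all add: cvec.independent_extend_basis cvec.independent_empty
        cvec.span_extend_basis)
  define co where "co e b = cvec.representation B b e" for e b
  have co: "cfunctional (co e)" for e
    unfolding cfunctional_iff co_def
    by (auto simp: cvec.representation_add cvec.representation_scale ind span)
  let ?s = "\<lambda>e. tensor_lift (\<lambda>a b. co e b *\<^sub>C a)"
  note bl = bilin_slice_right[OF co]
  \<comment> \<open>The expansion is claimed for every finite set containing F, so that two summands
    can be expanded over a common set.\<close>
  have "\<exists>F. finite F \<and> (\<forall>G. finite G \<longrightarrow> F \<subseteq> G \<longrightarrow> y = (\<Sum>e\<in>G. ?s e y \<otimes> e))"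
    for y :: "'a \<otimes> 'b"
  proof (induction y rule: tensor_induct)
    case (tensor a b)
    let ?F = "{e. cvec.representation B b e \<noteq> 0}"
    have fin: "finite ?F" by (rule cvec.finite_representation)
    have "a \<otimes> b = (\<Sum>e\<in>G. ?s e (a \<otimes> b) \<otimes> e)" if G: "finite G" "?F \<subseteq> G" for G
    proof -
      have "(\<Sum>e\<in>G. co e b *\<^sub>C e) = (\<Sum>e\<in>?F. co e b *\<^sub>C e)"
        by (rule sum.mono_neutral_right) (use G in \<open>auto simp: co_def\<close>)
      also have "\<dots> = b"
        unfolding co_def by (rule cvec.sum_nonzero_representation_eq[OF ind span])
      finally have *: "(\<Sum>e\<in>G. co e b *\<^sub>C e) = b" .
      have "(\<Sum>e\<in>G. ?s e (a \<otimes> b) \<otimes> e) = a \<otimes> (\<Sum>e\<in>G. co e b *\<^sub>C e)"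
        by (simp add: tensor_lift_tensor bl tensor_scaleC_left tensor_scaleC_right tensor_sum_right)
      then show ?thesis using * by simp
    qed
    then show ?case using fin by blast
  next
    case (add x y)
    then obtain F G where "finite F" "\<forall>H. finite H \<longrightarrow> F \<subseteq> H \<longrightarrow> x = (\<Sum>e\<in>H. ?s e x \<otimes> e)"
      "finite G" "\<forall>H. finite H \<longrightarrow> G \<subseteq> H \<longrightarrow> y = (\<Sum>e\<in>H. ?s e y \<otimes> e)" by blast
    then have "\<forall>H. finite H \<longrightarrow> F \<union> G \<subseteq> H \<longrightarrow> x + y = (\<Sum>e\<in>H. ?s e (x + y) \<otimes> e)"
      by (simp add: tensor_lift_add bl tensor_add_left sum.distrib)
    then show ?case using \<open>finite F\<close> \<open>finite G\<close> by blast
  next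
    case (scaleC c x)
    then obtain F where "finite F" "\<forall>H. finite H \<longrightarrow> F \<subseteq> H \<longrightarrow> x = (\<Sum>e\<in>H. ?s e x \<otimes> e)"
      by blast
    then have "\<forall>H. finite H \<longrightarrow> F \<subseteq> H \<longrightarrow> c *\<^sub>C x = (\<Sum>e\<in>H. ?s e (c *\<^sub>C x) \<otimes> e)"
      by (simp add: tensor_lift_scaleC bl tensor_scaleC_left flip: cvec.scale_sum_right)
    then show ?case using \<open>finite F\<close> by blast
  qed
  from this[of x] show ?thesis
    using assms[OF co] by auto
qed

lemma tensor_eq_zero_left:
  fixes x :: "'a::complex_vector \<otimes> 'b::complex_vector"
  assumes "\<And>f. cfunctional f \<Longrightarrow> tensor_lift (\<lambda>a b. f a *\<^sub>C b) x = 0"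
  shows "x = 0"
proof -
  have "flip x = 0"
  proof (rule tensor_eq_zero_right)
    fix f :: "'a \<Rightarrow> complex" assume f: "cfunctional f"
    have "tensor_lift (\<lambda>a b. f b *\<^sub>C a) (flip y) = tensor_lift (\<lambda>a b. f a *\<^sub>C b) y"
      for y :: "'a \<otimes> 'b"
      by (rule tensor_linear_eqI[of "\<lambda>y. tensor_lift (\<lambda>a b. f b *\<^sub>C a) (flip y)"])
        (simp_all add: clinear_comp clinear_tensor_lift clinear_flip f
          bilin_slice_right bilin_slice_left tensor_lift_tensor)
    then show "tensor_lift (\<lambda>a b. f b *\<^sub>C a) (flip x) = 0" using assms[OF f] by simp
  qed
  then show ?thesis by (metis flip_flip clinear_zero[OF clinear_flip])
qed

text \<open>Slicing one leg at a time reduces the claim to joint injectivity on each factor. This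
  yields non-degeneracy of A \<otimes> A and injectivity of A \<otimes> M(A) \<rightarrow> M(A
  \<otimes> A).\<close>

lemma tensor_joint_inj:
  fixes \<phi> :: "'i \<Rightarrow> 'a::complex_vector \<Rightarrow> 'c::complex_vector"
    and \<psi> :: "'j \<Rightarrow> 'b::complex_vector \<Rightarrow> 'd::complex_vector"
  assumes \<phi>: "\<And>i. clinear (\<phi> i)" "\<And>y. (\<And>i. \<phi> i y = 0) \<Longrightarrow> y = 0"
    and \<psi>: "\<And>j. clinear (\<psi> j)" "\<And>y. (\<And>j. \<psi> j y = 0) \<Longrightarrow> y = 0"
    and x: "\<And>i j. tensor_map (\<phi> i) (\<psi> j) x = 0"
  shows "x = 0"
proof (rule tensor_eq_zero_left)
  fix f :: "'a \<Rightarrow> complex" assume f: "cfunctional f"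
  note bl = bilin_slice_right bilin_slice_left
  have z: "tensor_map (\<lambda>a. a) (\<psi> j) x = 0" for j
  proof (rule tensor_eq_zero_right)
    fix g :: "'d \<Rightarrow> complex" assume g: "cfunctional g"
    have "\<phi> i (tensor_lift (\<lambda>a b. g b *\<^sub>C a) (tensor_map (\<lambda>a. a) (\<psi> j) y))
        = tensor_lift (\<lambda>a b. g b *\<^sub>C a) (tensor_map (\<phi> i) (\<psi> j) y)" for i y
      by (rule tensor_linear_eqI[of "\<lambda>y. \<phi> i (tensor_lift (\<lambda>a b. g b *\<^sub>C a) (tensor_map (\<lambda>a. a) (\<psi> j) y))"])
        (auto intro!: clinear_comp[OF \<phi>(1)] clinear_comp[OF clinear_tensor_lift]
            clinear_tensor_map bl g \<phi> \<psi> clinear_id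
          simp: tensor_map_tensor \<phi> \<psi> clinear_id tensor_lift_tensor bl g clinear_scaleC)
    then show "tensor_lift (\<lambda>a b. g b *\<^sub>C a) (tensor_map (\<lambda>a. a) (\<psi> j) x) = 0"
      using \<phi>(2) x clinear_zero[OF clinear_tensor_lift[OF bl(1)[OF g]]] by metis
  qed
  have "\<psi> j (tensor_lift (\<lambda>a b. f a *\<^sub>C b) y)
      = tensor_lift (\<lambda>a b. f a *\<^sub>C b) (tensor_map (\<lambda>a. a) (\<psi> j) y)" for j y
    by (rule tensor_linear_eqI[of "\<lambda>y. \<psi> j (tensor_lift (\<lambda>a b. f a *\<^sub>C b) y)"])
      (auto intro!: clinear_comp[OF \<psi>(1)] clinear_comp[OF clinear_tensor_lift] clinear_tensor_lift
            clinear_tensor_map bl f \<psi> clinear_id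
          simp: tensor_map_tensor \<psi> clinear_id tensor_lift_tensor bl f clinear_scaleC)
  then show "tensor_lift (\<lambda>a b. f a *\<^sub>C b) x = 0"
    using \<psi>(2) z clinear_zero[OF clinear_tensor_lift[OF bl(2)[OF f]]] by metis
qed

lemma tensor_eqI_right:
  fixes \<psi> :: "'j \<Rightarrow> 'b::complex_vector \<Rightarrow> 'd::complex_vector"
  assumes \<psi>: "\<And>j. clinear (\<psi> j)" "\<And>y. (\<And>j. \<psi> j y = 0) \<Longrightarrow> y = 0"
    and x: "\<And>j. tensor_map (\<lambda>a. a) (\<psi> j) x = tensor_map (\<lambda>a. a) (\<psi> j) y"
  shows "x = y"
proof -
  have "x - y = 0"
    by (rule tensor_joint_inj[where \<phi>="\<lambda>_::unit. \<lambda>a. a", OF _ _ \<psi>])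
      (simp_all add: clinear_id clinear_diff[OF clinear_tensor_map] \<psi> x)
  then show ?thesis by simp
qed

lemma nondegenerate_eqI_left: "(\<And>b. a * b = a' * b) \<Longrightarrow> a = (a'::'a::nondegenerate_algebra)"
  using nondegenerate_left[of "a - a'"] by (simp add: left_diff_distrib)

lemma nondegenerate_eqI_right: "(\<And>b. b * a = b * a') \<Longrightarrow> a = (a'::'a::nondegenerate_algebra)"
  using nondegenerate_right[of "a - a'"] by (simp add: right_diff_distrib)

lemma times_tensor_right:
  "x * (a \<otimes> b) = tensor_map (\<lambda>c. c * a) (\<lambda>d. d * b) (x :: 'a::complex_algebra \<otimes> 'b::complex_algebra)"
  by (rule tensor_linear_eqI[of "\<lambda>x. x * (a \<otimes> b)"])
    (simp_all add: clinear_mult_right clinear_tensor_map times_tensor_tensor tensor_map_tensor)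

instance tensor :: (nondegenerate_algebra, nondegenerate_algebra) nondegenerate_algebra
proof
  fix x :: "'a \<otimes> 'b"
  show "x = 0" if "\<And>y. x * y = 0"
    by (rule tensor_joint_inj[where \<phi>="\<lambda>a c. c * a" and \<psi>="\<lambda>b d. d * b"])
      (auto intro: nondegenerate_left simp: clinear_mult_right that simp flip: times_tensor_right)
  show "x = 0" if "\<And>y. y * x = 0"
    by (rule tensor_joint_inj[where \<phi>="\<lambda>a c. a * c" and \<psi>="\<lambda>b d. b * d"])
      (auto intro: nondegenerate_right simp: clinear_mult_left that simp flip: times_tensor_left)
qed

section \<open>Multipliers of non-degenerate algebras\<close>

lemma mleft_plus [simp]: "mleft (m + n) x = mleft m x + mleft n x"
  and mleft_scaleC [simp]: "mleft (c *\<^sub>C m) x = c *\<^sub>C mleft m x"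
  and mleft_zero [simp]: "mleft 0 x = 0"
  and mright_plus [simp]: "mright (m + n) x = mright m x + mright n x"
  and mright_scaleC [simp]: "mright (c *\<^sub>C m) x = c *\<^sub>C mright m x"
  and mright_zero [simp]: "mright 0 x = 0"
  by (transfer; auto)+

lemma clinear_mleft: "clinear (mleft m)" and clinear_mright: "clinear (mright m)"
  using multiplier_props[of m] by blast+

lemmas mleft_lin [simp] = clinear_add[OF clinear_mleft] clinear_scaleC[OF clinear_mleft]
  clinear_zero[OF clinear_mleft]
  and mright_lin [simp] = clinear_add[OF clinear_mright] clinear_scaleC[OF clinear_mright]
  clinear_zero[OF clinear_mright]

lemma mleft_times [simp]: "mleft (m * n) x = mleft m (mleft n x)"
  and mright_times [simp]: "mright (m * n) x = mright n (mright m x)"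
  by (transfer; auto)+

lemma mleft_one [simp]: "mleft 1 x = x" and mright_one [simp]: "mright 1 x = x"
  by (transfer; auto)+

lemma mleft_mult: "mleft m (a * b) = mleft m a * b"
  and mright_mult: "mright m (a * b) = a * mright m b"
  and mright_mleft: "mright m a * b = a * mleft m b"
  using multiplier_props[of m] by simp_all

lemma mleft_embed [simp]: "mleft (mult_embed a) b = a * b"
  and mright_embed [simp]: "mright (mult_embed a) b = b * a"
  by (transfer; auto)+

text \<open>The compatibility (a m) b = a (m b) determines a m after multiplication by any b, and
  non-degeneracy removes b.\<close>

lemma multiplier_eqI_left:
  assumes "\<And>a. mleft m a = mleft n (a::'a::nondegenerate_algebra)"
  shows "m = n"
  by (rule multiplier_eqI[OF assms], rule nondegenerate_eqI_left) (simp add: mright_mleft assms)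

lemma multiplier_eqI_right:
  assumes "\<And>a. mright m a = mright n (a::'a::nondegenerate_algebra)"
  shows "m = n"
  by (rule multiplier_eqI[OF _ assms], rule nondegenerate_eqI_right) (simp add: assms flip: mright_mleft)

lemma embed_times: "mult_embed (a * b) = mult_embed a * mult_embed b"
  and embed_add: "mult_embed (a + b) = mult_embed a + mult_embed b"
  and embed_scaleC: "mult_embed (c *\<^sub>C a) = c *\<^sub>C mult_embed a"
  and times_embed: "m * mult_embed a = mult_embed (mleft m a)"
  and embed_times_mult: "mult_embed a * m = mult_embed (mright m a)"
  by (rule multiplier_eqI; simp add: mult.assoc distrib_left distrib_right mult_scaleC_left
      mult_scaleC_right mleft_mult mright_mult mright_mleft)+

lemma clinear_embed: "clinear mult_embed"
  by (simp add: clinear_iff embed_add embed_scaleC)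

lemma embed_inject [simp]: "mult_embed a = mult_embed b \<longleftrightarrow> a = (b::'a::nondegenerate_algebra)"
  by (metis mleft_embed nondegenerate_eqI_left)

lemma mleft_mtensor: "mleft (m \<otimes>\<^sub>M n) = tensor_map (mleft m) (mleft n)"
  and mright_mtensor: "mright (m \<otimes>\<^sub>M n) = tensor_map (mright m) (mright n)"
  by (transfer; auto)+

lemma mleft_mtensor_tensor [simp]: "mleft (m \<otimes>\<^sub>M n) (a \<otimes> b) = mleft m a \<otimes> mleft n b"
  and mright_mtensor_tensor [simp]: "mright (m \<otimes>\<^sub>M n) (a \<otimes> b) = mright m a \<otimes> mright n b"
  by (simp_all add: mleft_mtensor mright_mtensor tensor_map_tensor clinear_mleft clinear_mright)

lemmas tensor_lin = tensor_add_left tensor_add_right tensor_scaleC_left tensor_scaleC_right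
  scaleC_add_right distrib_left distrib_right mult_scaleC_left mult_scaleC_right

lemma multiplier_tensor_eqI:
  assumes "\<And>a b. mleft m (a \<otimes> b) = mleft n (a \<otimes> b)" "\<And>a b. mright m (a \<otimes> b) = mright n (a \<otimes> b)"
  shows "m = n"
  by (rule multiplier_eqI) (rule tensor_linear_eqI, simp_all add: assms clinear_mleft clinear_mright)+

lemma mtensor_times: "(m \<otimes>\<^sub>M n) * (m' \<otimes>\<^sub>M n') = (m * m') \<otimes>\<^sub>M (n * n')"
  and mtensor_one: "1 \<otimes>\<^sub>M 1 = 1"
  and mtensor_add_left: "(m + m'') \<otimes>\<^sub>M n = m \<otimes>\<^sub>M n + m'' \<otimes>\<^sub>M n"
  and mtensor_add_right: "m \<otimes>\<^sub>M (n + n'') = m \<otimes>\<^sub>M n + m \<otimes>\<^sub>M n''"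
  and mtensor_scaleC_left: "(c *\<^sub>C m) \<otimes>\<^sub>M n = c *\<^sub>C (m \<otimes>\<^sub>M n)"
  and mtensor_scaleC_right: "m \<otimes>\<^sub>M (c *\<^sub>C n) = c *\<^sub>C (m \<otimes>\<^sub>M n)"
  and embed_tensor: "mult_embed (a \<otimes> b) = mult_embed a \<otimes>\<^sub>M mult_embed b"
  by (rule multiplier_tensor_eqI; simp add: tensor_lin times_tensor_tensor)+

lemmas mtensor_lin = mtensor_add_left mtensor_add_right mtensor_scaleC_left mtensor_scaleC_right
  tensor_lin

lemma bilin_mtensor: "clinear f \<Longrightarrow> clinear g \<Longrightarrow> bilin (\<lambda>a b. f a \<otimes>\<^sub>M g b)"
  by (simp add: bilin_def clinear_iff mtensor_lin)

lemma hom_tensor_tensor: "clinear f \<Longrightarrow> clinear g \<Longrightarrow> hom_tensor f g (a \<otimes> b) = f a \<otimes>\<^sub>M g b"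
  by (simp add: hom_tensor_def tensor_lift_tensor bilin_mtensor)

lemma clinear_hom_tensor: "clinear f \<Longrightarrow> clinear g \<Longrightarrow> clinear (hom_tensor f g)"
  by (simp add: hom_tensor_def clinear_tensor_lift bilin_mtensor)


section \<open>Extension of non-degenerate homomorphisms\<close>

definition nondeg_hom :: "('a::complex_algebra \<Rightarrow> 'b::complex_algebra multiplier) \<Rightarrow> bool"
  where "nondeg_hom f \<longleftrightarrow> clinear f \<and> (\<forall>a b. f (a * b) = f a * f b) \<and>
    (\<forall>y. y \<in> cvec.span {mleft (f a) b | a b. True}) \<and>
    (\<forall>y. y \<in> cvec.span {mright (f a) b | a b. True})"

lemma nondeg_hom_clinear: "nondeg_hom f \<Longrightarrow> clinear f"
  and nondeg_hom_times: "nondeg_hom f \<Longrightarrow> f (a * b) = f a * f b"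
  by (auto simp: nondeg_hom_def)

lemma span_gen_induct [consumes 1, case_names gen add scaleC]:
  assumes "y \<in> cvec.span {F a b | a b. True}"
    and gen: "\<And>a b. P (F a b)"
    and add: "\<And>x y. P x \<Longrightarrow> P y \<Longrightarrow> P (x + y)"
    and scale: "\<And>c x. P x \<Longrightarrow> P (c *\<^sub>C x)"
  shows "P y"
  using assms(1)
proof (induction rule: cvec.span_induct_alt)
  case base
  show ?case using scale[OF gen, of 0] by simp
next
  case (step c x y)
  then show ?case using gen add scale by blast
qed

lemma nondeg_hom_left_induct [consumes 1, case_names gen add scaleC]:
  assumes "nondeg_hom f" "\<And>a b. P (mleft (f a) b)"
    "\<And>x y. P x \<Longrightarrow> P y \<Longrightarrow> P (x + y)" "\<And>c x. P x \<Longrightarrow> P (c *\<^sub>C x)"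
  shows "P y"
  by (rule span_gen_induct[where F="\<lambda>a. mleft (f a)"]) (use assms in \<open>auto simp: nondeg_hom_def\<close>)

lemma nondeg_hom_right_induct [consumes 1, case_names gen add scaleC]:
  assumes "nondeg_hom f" "\<And>a b. P (mright (f a) b)"
    "\<And>x y. P x \<Longrightarrow> P y \<Longrightarrow> P (x + y)" "\<And>c x. P x \<Longrightarrow> P (c *\<^sub>C x)"
  shows "P y"
  by (rule span_gen_induct[where F="\<lambda>a. mright (f a)"]) (use assms in \<open>auto simp: nondeg_hom_def\<close>)

lemma nondeg_hom_hom_tensor:
  assumes f: "nondeg_hom f" and g: "nondeg_hom g"
  shows "nondeg_hom (hom_tensor f g)"
proof -
  note lin = nondeg_hom_clinear[OF f] nondeg_hom_clinear[OF g]
  note H = hom_tensor_tensor[OF lin] clinear_hom_tensor[OF lin]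
  have "hom_tensor f g ((a \<otimes> b) * y) = hom_tensor f g (a \<otimes> b) * hom_tensor f g y" for a b y
    by (induction y rule: tensor_induct)
      (simp_all add: H times_tensor_tensor nondeg_hom_times[OF f] nondeg_hom_times[OF g]
        mtensor_times clinear_add[OF H(2)] clinear_scaleC[OF H(2)] tensor_lin)
  then have "hom_tensor f g (x * y) = hom_tensor f g x * hom_tensor f g y" for x y
    by (induction x rule: tensor_induct)
      (simp_all add: clinear_add[OF H(2)] clinear_scaleC[OF H(2)] tensor_lin)
  moreover have "y \<in> cvec.span {mleft (hom_tensor f g a) b | a b. True}" (is "y \<in> ?L") for y
  proof (induction y rule: tensor_induct)
    case (tensor c d)
    show ?case using f
    proof (induction c rule: nondeg_hom_left_induct)
      case (gen a b)
      show ?case using g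
      proof (induction d rule: nondeg_hom_left_induct)
        case (gen a' b')
        have "mleft (f a) b \<otimes> mleft (g a') b' = mleft (hom_tensor f g (a \<otimes> a')) (b \<otimes> b')"
          by (simp add: H)
        then show ?case by (blast intro: cvec.span_base)
      qed (simp_all add: tensor_lin cvec.span_add cvec.span_scale)
    qed (simp_all add: tensor_lin cvec.span_add cvec.span_scale)
  qed (simp_all add: cvec.span_add cvec.span_scale)
  moreover have "y \<in> cvec.span {mright (hom_tensor f g a) b | a b. True}" for y
  proof (induction y rule: tensor_induct)
    case (tensor c d)
    show ?case using f
    proof (induction c rule: nondeg_hom_right_induct)
      case (gen a b)
      show ?case using g
      proof (induction d rule: nondeg_hom_right_induct)
        case (gen a' b')
        have "mright (f a) b \<otimes> mright (g a') b' = mright (hom_tensor f g (a \<otimes> a')) (b \<otimes> b')"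
          by (simp add: H)
        then show ?case by (blast intro: cvec.span_base)
      qed (simp_all add: tensor_lin cvec.span_add cvec.span_scale)
    qed (simp_all add: tensor_lin cvec.span_add cvec.span_scale)
  qed (simp_all add: cvec.span_add cvec.span_scale)
  ultimately show ?thesis using H(2) by (simp add: nondeg_hom_def)
qed

lemma hom_tensor_embed: "hom_tensor mult_embed mult_embed = mult_embed"
  by (rule ext, rule tensor_linear_eqI[of "hom_tensor mult_embed mult_embed"])
    (simp_all add: clinear_hom_tensor hom_tensor_tensor clinear_embed embed_tensor)

text \<open>The vector F(m) y is pinned down by the equations f(a) F(m) y = f(a m) y. Setting F(m)
  f(a) b = f(m a) b instead would require independence of the way in which y is written as a sum of
  such terms; here that becomes uniqueness of z.\<close>

definition ext_left :: "('a::complex_algebra \<Rightarrow> 'b::complex_algebra multiplier) \<Rightarrow> 'a multiplier \<Rightarrow> 'b \<Rightarrow> 'b"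
  where "ext_left f m y = (THE z. \<forall>a. mleft (f a) z = mleft (f (mright m a)) y)"

definition ext_right :: "('a::complex_algebra \<Rightarrow> 'b::complex_algebra multiplier) \<Rightarrow> 'a multiplier \<Rightarrow> 'b \<Rightarrow> 'b"
  where "ext_right f m y = (THE z. \<forall>a. mright (f a) z = mright (f (mleft m a)) y)"

context
  fixes f :: "'a::complex_algebra \<Rightarrow> 'b::nondegenerate_algebra multiplier"
  assumes f: "nondeg_hom f"
begin

text \<open>Left factors f(a) are cancelled by the span condition for the right action: each b is a
  sum of terms b' f(a), so b z only depends on the f(a) z.\<close>

lemma nondeg_hom_cancel_left:
  assumes "\<And>a. mleft (f a) z = mleft (f a) z'"
  shows "z = z'"
proof (rule nondegenerate_eqI_right)
  fix b show "b * z = b * z'"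
    using f by (induction b rule: nondeg_hom_right_induct)
      (simp_all add: mright_mleft assms distrib_right mult_scaleC_left)
qed

lemma nondeg_hom_cancel_right:
  assumes "\<And>a. mright (f a) z = mright (f a) z'"
  shows "z = z'"
proof (rule nondegenerate_eqI_left)
  fix b show "z * b = z' * b"
    using f by (induction b rule: nondeg_hom_left_induct)
      (simp_all add: assms distrib_left mult_scaleC_right flip: mright_mleft)
qed

lemma nondeg_hom_times_cancel: "(\<And>a. X * f a = Y * f a) \<Longrightarrow> X = Y"
proof (rule multiplier_eqI_left)
  fix y assume *: "\<And>a. X * f a = Y * f a"
  show "mleft X y = mleft Y y"
    using f by (induction y rule: nondeg_hom_left_induct) (simp_all flip: mleft_times add: *)
qed

lemma nondeg_hom_mid: "mleft (f a) (mleft (f (mleft m b)) y) = mleft (f (mright m a)) (mleft (f b) y)"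
  and nondeg_hom_mid': "mright (f a) (mright (f (mright m b)) y) = mright (f (mleft m a)) (mright (f b) y)"
  by (simp_all flip: mleft_times mright_times nondeg_hom_times[OF f] add: mright_mleft)

lemma ext_left_ex1: "\<exists>!z. \<forall>a. mleft (f a) z = mleft (f (mright m a)) y"
proof (rule ex_ex1I)
  show "\<exists>z. \<forall>a. mleft (f a) z = mleft (f (mright m a)) y"
    using f
  proof (induction y rule: nondeg_hom_left_induct)
    case (gen a b)
    \<comment> \<open>The expected value of F(m) on f(a) b is f(m a) b.\<close>
    show ?case by (rule exI[of _ "mleft (f (mleft m a)) b"]) (simp add: nondeg_hom_mid)
  next
    case (add x y)
    then obtain z z' where "\<forall>a. mleft (f a) z = mleft (f (mright m a)) x"
      "\<forall>a. mleft (f a) z' = mleft (f (mright m a)) y" by blast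
    then show ?case by (intro exI[of _ "z + z'"]) simp
  next
    case (scaleC c x)
    then obtain z where "\<forall>a. mleft (f a) z = mleft (f (mright m a)) x" by blast
    then show ?case by (intro exI[of _ "c *\<^sub>C z"]) simp
  qed
qed (auto intro: nondeg_hom_cancel_left)

lemma ext_right_ex1: "\<exists>!z. \<forall>a. mright (f a) z = mright (f (mleft m a)) y"
proof (rule ex_ex1I)
  show "\<exists>z. \<forall>a. mright (f a) z = mright (f (mleft m a)) y"
    using f
  proof (induction y rule: nondeg_hom_right_induct)
    case (gen a b)
    show ?case by (rule exI[of _ "mright (f (mright m a)) b"]) (simp add: nondeg_hom_mid')
  next
    case (add x y)
    then obtain z z' where "\<forall>a. mright (f a) z = mright (f (mleft m a)) x"
      "\<forall>a. mright (f a) z' = mright (f (mleft m a)) y" by blast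
    then show ?case by (intro exI[of _ "z + z'"]) simp
  next
    case (scaleC c x)
    then obtain z where "\<forall>a. mright (f a) z = mright (f (mleft m a)) x" by blast
    then show ?case by (intro exI[of _ "c *\<^sub>C z"]) simp
  qed
qed (auto intro: nondeg_hom_cancel_right)

lemma ext_left: "mleft (f a) (ext_left f m y) = mleft (f (mright m a)) y"
  using theI'[OF ext_left_ex1[of m y]] by (simp add: ext_left_def)

lemma ext_right: "mright (f a) (ext_right f m y) = mright (f (mleft m a)) y"
  using theI'[OF ext_right_ex1[of m y]] by (simp add: ext_right_def)

lemma ext_left_gen: "ext_left f m (mleft (f a) b) = mleft (f (mleft m a)) b"
  by (rule nondeg_hom_cancel_left) (simp add: ext_left nondeg_hom_mid)

lemma is_multiplier_ext: "is_multiplier (ext_left f m, ext_right f m)"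
proof -
  have lin: "clinear (ext_left f m)" "clinear (ext_right f m)"
    unfolding clinear_iff
    by (intro conjI allI; (rule nondeg_hom_cancel_left, simp add: ext_left; fail | rule nondeg_hom_cancel_right, simp add: ext_right))+
  have "ext_right f m a * b = a * ext_left f m b" for a b
    using f
  proof (induction b rule: nondeg_hom_left_induct)
    case (gen a' b')
    show ?case
      by (simp add: ext_left_gen ext_right flip: mright_mleft)
  qed (simp_all add: lin clinear_add clinear_scaleC distrib_left mult_scaleC_right)
  moreover have "ext_left f m (a * b) = ext_left f m a * b" for a b
    by (rule nondeg_hom_cancel_left) (simp add: ext_left mleft_mult)
  moreover have "ext_right f m (a * b) = a * ext_right f m b" for a b
    by (rule nondeg_hom_cancel_right) (simp add: ext_right mright_mult)
  ultimately show ?thesis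
    by (simp add: is_multiplier_def lin)
qed

definition "extension m = Abs_multiplier (ext_left f m, ext_right f m)"

lemma mleft_extension: "mleft (extension m) = ext_left f m"
  by (simp add: extension_def mleft.rep_eq Abs_multiplier_inverse is_multiplier_ext)

lemma extension_times_gen: "extension m * f a = f (mleft m a)"
  by (rule multiplier_eqI_left) (simp add: mleft_extension ext_left_gen)

lemma extension_props:
  "clinear extension" "extension (m * n) = extension m * extension n" "extension 1 = 1"
  "extension (mult_embed a) = f a"
proof -
  note lin = nondeg_hom_clinear[OF f]
  show "clinear extension"
    unfolding clinear_iff
    by (intro conjI allI; rule nondeg_hom_times_cancel; simp add: extension_times_gen distrib_right
        mult_scaleC_left clinear_add[OF lin] clinear_scaleC[OF lin])
  show "extension (m * n) = extension m * extension n" "extension 1 = 1"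
    "extension (mult_embed a) = f a"
    by (rule nondeg_hom_times_cancel; simp add: extension_times_gen mult.assoc nondeg_hom_times[OF f])+
qed

text \<open>Uniqueness: any extension satisfies F(m) f(a) = F(m a) = f(m a), and the f(a) can be
  cancelled.\<close>

lemma mext_eq_extension: "mext f = extension"
  unfolding mext_def
proof (rule the_equality)
  show "clinear extension \<and> (\<forall>m n. extension (m * n) = extension m * extension n) \<and>
    extension 1 = 1 \<and> (\<forall>a. extension (mult_embed a) = f a)"
    by (simp add: extension_props)
next
  fix F assume F: "clinear F \<and> (\<forall>m n. F (m * n) = F m * F n) \<and> F 1 = 1 \<and> (\<forall>a. F (mult_embed a) = f a)"
  show "F = extension"
  proof
    fix m
    have "F m * f a = extension m * f a" for a
      by (metis F times_embed extension_times_gen)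
    then show "F m = extension m" by (rule nondeg_hom_times_cancel)
  qed
qed

lemmas clinear_mext = extension_props(1)[folded mext_eq_extension]
  and mext_times = extension_props(2)[folded mext_eq_extension]
  and mext_one = extension_props(3)[folded mext_eq_extension]
  and mext_embed = extension_props(4)[folded mext_eq_extension]
  and mext_times_gen = extension_times_gen[folded mext_eq_extension]

lemma mext_eqI: "(\<And>a. X * f a = f (mleft m a)) \<Longrightarrow> mext f m = X"
  by (rule nondeg_hom_times_cancel) (simp add: mext_times_gen)

lemma gen_times_mext: "f a * mext f m = f (mright m a)"
  by (metis embed_times_mult mext_embed mext_times)

end

lemma mext_hom_tensor:
  fixes f :: "'a::complex_algebra \<Rightarrow> 'b::nondegenerate_algebra multiplier"
    and g :: "'c::complex_algebra \<Rightarrow> 'd::nondegenerate_algebra multiplier"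
  assumes f: "nondeg_hom f" and g: "nondeg_hom g"
  shows "mext (hom_tensor f g) (m \<otimes>\<^sub>M n) = mext f m \<otimes>\<^sub>M mext g n"
proof (rule mext_eqI[OF nondeg_hom_hom_tensor[OF f g]])
  fix x
  note lin = nondeg_hom_clinear[OF f] nondeg_hom_clinear[OF g]
  note H = hom_tensor_tensor[OF lin] clinear_hom_tensor[OF lin]
  show "(mext f m \<otimes>\<^sub>M mext g n) * hom_tensor f g x = hom_tensor f g (mleft (m \<otimes>\<^sub>M n) x)"
    by (induction x rule: tensor_induct)
      (simp_all add: H mtensor_times mext_times_gen f g clinear_add[OF H(2)] clinear_scaleC[OF H(2)] tensor_lin)
qed

lemma mext_embed_id:
  assumes "nondeg_hom (mult_embed :: 'a::nondegenerate_algebra \<Rightarrow> _)"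
  shows "mext mult_embed m = (m :: 'a multiplier)"
  by (rule mext_eqI[OF assms]) (simp add: times_embed)

lemma nondeg_hom_iso:
  fixes f :: "'a::complex_algebra \<Rightarrow> 'b::nondegenerate_algebra"
  assumes E: "nondeg_hom (mult_embed :: 'b \<Rightarrow> _)"
    and f: "clinear f" "\<And>a b. f (a * b) = f a * f b" "surj f"
  shows "nondeg_hom (\<lambda>a. mult_embed (f a))"
proof -
  have eq: "{mleft (mult_embed (f a)) b | a b. True} = {mleft (mult_embed a) b | a b. True}"
    "{mright (mult_embed (f a)) b | a b. True} = {mright (mult_embed a) b | a b. True}"
    using f(3) by (auto simp: surj_def) metis+
  then show ?thesis
    using E f unfolding nondeg_hom_def eq by (auto simp: embed_times clinear_comp clinear_embed)
qed

lemma
  fixes f :: "'a::complex_algebra \<Rightarrow> 'b::nondegenerate_algebra"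
  assumes E: "nondeg_hom (mult_embed :: 'b \<Rightarrow> _)"
    and f: "clinear f" "\<And>a b. f (a * b) = f a * f b" "surj f"
  shows mleft_mext_iso: "mleft (mext_iso f m) (f a) = f (mleft m a)"
    and mright_mext_iso: "mright (mext_iso f m) (f a) = f (mright m a)"
    and mext_iso_times: "mext_iso f (m * n) = mext_iso f m * mext_iso f n"
    and mext_iso_one: "mext_iso f 1 = 1"
    and clinear_mext_iso: "clinear (mext_iso f)"
    and mext_iso_embed: "mext_iso f (mult_embed a) = mult_embed (f a)"
proof -
  note h = nondeg_hom_iso[OF E f]
  show "mleft (mext_iso f m) (f a) = f (mleft m a)"
    using mext_times_gen[OF h, of m a] by (simp add: times_embed mext_iso_def)
  show "mright (mext_iso f m) (f a) = f (mright m a)"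
    using gen_times_mext[OF h, of a m] by (simp add: embed_times_mult mext_iso_def)
qed (simp_all add: mext_iso_def mext_times mext_one clinear_mext mext_embed nondeg_hom_iso[OF E f])


section \<open>Extension of anti-automorphisms\<close>

locale anti_aut =
  fixes S :: "'a::nondegenerate_algebra \<Rightarrow> 'a"
  assumes clinear_S: "clinear S" and S_times: "S (a * b) = S b * S a" and bij_S: "bij S"
begin

lemma S_lin: "S (a + b) = S a + S b" "S (c *\<^sub>C a) = c *\<^sub>C S a" "S 0 = 0"
  using clinear_S by (auto simp: clinear_add clinear_scaleC clinear_zero)

lemma S_inject [simp]: "S a = S b \<longleftrightarrow> a = b"
  using bij_S by (simp add: bij_def inj_eq)

lemma S_inv [simp]: "S (inv S a) = a" and inv_S [simp]: "inv S (S a) = a"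
  using bij_S by (simp_all add: bij_def surj_f_inv_f inv_f_f)

lemma inv_eqI: "a = S b \<Longrightarrow> inv S a = b"
  by simp

lemma clinear_inv: "clinear (inv S)"
  unfolding clinear_iff by (intro conjI allI; rule inv_eqI; simp add: S_lin)

lemma inv_times: "inv S (a * b) = inv S b * inv S a"
  by (rule inv_eqI) (simp add: S_times)

text \<open>Anti-multiplicativity forces S(m) x = S(S^-1(x) m) and x S(m) = S(m S^-1(x)).\<close>

lift_definition manti :: "'a multiplier \<Rightarrow> 'a multiplier"
  is "\<lambda>(l, r). (\<lambda>x. S (r (inv S x)), \<lambda>x. S (l (inv S x)))"
proof clarsimp
  fix l r :: "'a \<Rightarrow> 'a" assume m: "is_multiplier (l, r)"
  then have lin: "clinear l" "clinear r" and props: "\<And>a b. l (a * b) = l a * b"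
    "\<And>a b. r (a * b) = a * r b" "\<And>a b. r a * b = a * l b"
    by (auto simp: is_multiplier_def)
  have "S (l (inv S a)) * b = a * S (r (inv S b))" for a b
    using arg_cong[OF props(3)[of "inv S b" "inv S a"], of S] by (simp add: S_times)
  then show "is_multiplier (\<lambda>x. S (r (inv S x)), \<lambda>x. S (l (inv S x)))"
    by (simp add: is_multiplier_def clinear_comp[OF clinear_S clinear_comp[OF _ clinear_inv]] lin
        inv_times S_times props)
qed

lemma mleft_manti [simp]: "mleft (manti m) x = S (mright m (inv S x))"
  and mright_manti [simp]: "mright (manti m) x = S (mleft m (inv S x))"
  by (transfer; auto)+

lemma manti_props: "clinear manti" "manti (m * n) = manti n * manti m" "manti 1 = 1"
  "manti (mult_embed a) = mult_embed (S a)"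
  unfolding clinear_iff by (intro conjI allI multiplier_eqI; simp add: S_lin S_times)+

lemma mext_anti_eq_manti: "mext_anti S = manti"
  unfolding mext_anti_def
proof (rule the_equality)
  fix F assume F: "clinear F \<and> (\<forall>m n. F (m * n) = F n * F m) \<and> F 1 = 1 \<and>
    (\<forall>a. F (mult_embed a) = mult_embed (S a))"
  show "F = manti"
  proof
    fix m show "F m = manti m"
    proof (rule multiplier_eqI_left)
      fix a
      have "mult_embed (mleft (F m) (S (inv S a))) = F (mult_embed (inv S a) * m)"
        using F by (metis times_embed)
      also have "\<dots> = mult_embed (S (mright m (inv S a)))"
        using F by (simp add: embed_times_mult)
      finally show "mleft (F m) a = mleft (manti m) a" by simp
    qed
  qed
qed (simp add: manti_props)

lemmas clinear_mS = manti_props(1)[folded mext_anti_eq_manti]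
  and mS_times = manti_props(2)[folded mext_anti_eq_manti]
  and mS_one = manti_props(3)[folded mext_anti_eq_manti]
  and mS_embed = manti_props(4)[folded mext_anti_eq_manti]
  and mleft_mS = mleft_manti[folded mext_anti_eq_manti]
  and mright_mS = mright_manti[folded mext_anti_eq_manti]

lemma mS_lin: "mext_anti S (m + n) = mext_anti S m + mext_anti S n"
  "mext_anti S (c *\<^sub>C m) = c *\<^sub>C mext_anti S m"
  by (simp_all add: clinear_mS clinear_add clinear_scaleC)

lemma anti_aut_inv: "anti_aut (inv S)"
  by (rule anti_aut.intro) (simp_all add: clinear_inv inv_times bij_S bij_imp_bij_inv)

lemma mS_inv [simp]: "mext_anti S (mext_anti (inv S) m) = m"
  and inv_mS [simp]: "mext_anti (inv S) (mext_anti S m) = m"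
  by (rule multiplier_eqI_left; simp add: mleft_mS mright_mS bij_S inv_inv_eq
      anti_aut.mleft_mS[OF anti_aut_inv] anti_aut.mright_mS[OF anti_aut_inv])+

end

section \<open>Leg isomorphisms\<close>

lemma tensor_times_hom:
  fixes f :: "'a::complex_algebra \<otimes> 'b::complex_algebra \<Rightarrow> 'c::complex_algebra"
  assumes f: "clinear f" and "\<And>a b c d. f ((a \<otimes> b) * (c \<otimes> d)) = f (a \<otimes> b) * f (c \<otimes> d)"
  shows "f (x * y) = f x * f y"
proof -
  have "f ((a \<otimes> b) * y) = f (a \<otimes> b) * f y" for a b
    by (induction y rule: tensor_induct)
      (simp_all add: assms(2) distrib_left mult_scaleC_right clinear_add[OF f] clinear_scaleC[OF f])
  then show ?thesis
    by (induction x rule: tensor_induct)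
      (simp_all add: distrib_right mult_scaleC_left clinear_add[OF f] clinear_scaleC[OF f])
qed

lemma flip_times: "flip (x * y) = flip x * flip (y :: 'a::complex_algebra \<otimes> 'b::complex_algebra)"
  by (rule tensor_times_hom[OF clinear_flip]) (simp add: times_tensor_tensor)

lemma surj_flip: "surj flip"
  by (metis flip_flip surjI)

lemma tensor_fun_lin: "(\<otimes>) (x + y) = (\<lambda>c. x \<otimes> c + y \<otimes> c)"
  "(\<otimes>) (k *\<^sub>C x) = (\<lambda>c. k *\<^sub>C (x \<otimes> c))"
  by (simp_all add: fun_eq_iff tensor_lin)

lemma bilin_triple: "bilin (\<lambda>b c. a \<otimes> b \<otimes> c)" "bilin (\<lambda>a b. a \<otimes> c \<otimes> b)"
  by (simp_all add: bilin_def clinear_iff tensor_add_left tensor_add_right tensor_scaleC_left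
      tensor_scaleC_right)

lemma bilin_reassoc: "bilin (\<lambda>a. tensor_lift (\<lambda>b c. a \<otimes> b \<otimes> c))"
  unfolding bilin_def
proof (intro conjI allI)
  show "clinear (\<lambda>a. tensor_lift (\<lambda>b c. a \<otimes> b \<otimes> c) y)" for y :: "'b \<otimes> 'c"
    by (simp add: tensor_fun_lin clinear_iff tensor_add_left tensor_scaleC_left tensor_lift_fun_add
        tensor_lift_fun_scaleC)
qed (rule clinear_tensor_lift, rule bilin_triple)

lemma clinear_reassoc: "clinear reassoc"
  unfolding reassoc_def by (rule clinear_tensor_lift) (rule bilin_reassoc)

lemma reassoc_tensor [simp]: "reassoc (a \<otimes> (b \<otimes> c)) = a \<otimes> b \<otimes> c"
  by (simp add: reassoc_def tensor_lift_tensor bilin_reassoc bilin_triple)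

lemmas reassoc_lin = clinear_add[OF clinear_reassoc] clinear_scaleC[OF clinear_reassoc]

lemma reassoc_times: "reassoc (x * y) = reassoc x * reassoc y"
proof (rule tensor_times_hom[OF clinear_reassoc])
  fix a c :: 'a and y z :: "'b \<otimes> 'c"
  have "reassoc ((a * c) \<otimes> ((p \<otimes> q) * z)) = reassoc (a \<otimes> (p \<otimes> q)) * reassoc (c \<otimes> z)" for p q
    by (induction z rule: tensor_induct) (simp_all add: times_tensor_tensor tensor_lin reassoc_lin)
  then have "reassoc ((a * c) \<otimes> (y * z)) = reassoc (a \<otimes> y) * reassoc (c \<otimes> z)"
    by (induction y rule: tensor_induct) (simp_all add: times_tensor_tensor tensor_lin reassoc_lin)
  then show "reassoc ((a \<otimes> y) * (c \<otimes> z)) = reassoc (a \<otimes> y) * reassoc (c \<otimes> z)"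
    by (simp add: times_tensor_tensor)
qed

lemma surj_reassoc: "surj reassoc"
proof -
  have "\<exists>y. z = reassoc y" for z :: "'a \<otimes> 'b \<otimes> 'c"
  proof (induction z rule: tensor_induct)
    case (tensor x c)
    show ?case
    proof (induction x rule: tensor_induct)
      case (tensor a b)
      show ?case by (rule exI[of _ "a \<otimes> (b \<otimes> c)"]) simp
    qed (metis reassoc_lin tensor_add_left tensor_scaleC_left)+
  qed (metis reassoc_lin)+
  then show ?thesis by (simp add: surj_def)
qed

lemma bilin_swap23: "bilin (\<lambda>x c. tensor_lift (\<lambda>a b. a \<otimes> c \<otimes> b) x)"
  unfolding bilin_def
proof (intro conjI allI)
  show "clinear (\<lambda>c. tensor_lift (\<lambda>a b. a \<otimes> c \<otimes> b) x)" for x :: "'a \<otimes> 'b"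
    by (simp add: tensor_fun_lin clinear_iff tensor_add_right tensor_scaleC_right tensor_lift_fun_add
        tensor_lift_fun_scaleC)
qed (rule clinear_tensor_lift, rule bilin_triple)

lemma clinear_swap23: "clinear swap23"
  unfolding swap23_def by (rule clinear_tensor_lift) (rule bilin_swap23)

lemma swap23_tensor [simp]: "swap23 (a \<otimes> b \<otimes> c) = a \<otimes> c \<otimes> b"
  by (simp add: swap23_def tensor_lift_tensor bilin_swap23 bilin_triple)

lemmas swap23_lin = clinear_add[OF clinear_swap23] clinear_scaleC[OF clinear_swap23]

lemma swap23_times:
  fixes x y :: "'a::complex_algebra \<otimes> 'b::complex_algebra \<otimes> 'c::complex_algebra"
  shows "swap23 (x * y) = swap23 x * swap23 y"
proof (rule tensor_times_hom[OF clinear_swap23])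
  fix c d :: 'c and y z :: "'a \<otimes> 'b"
  have "swap23 (((p \<otimes> q) * z) \<otimes> (c * d)) = swap23 ((p \<otimes> q) \<otimes> c) * swap23 (z \<otimes> d)" for p q
    by (induction z rule: tensor_induct) (simp_all add: times_tensor_tensor tensor_lin swap23_lin)
  then have "swap23 ((y * z) \<otimes> (c * d)) = swap23 (y \<otimes> c) * swap23 (z \<otimes> d)"
    by (induction y rule: tensor_induct) (simp_all add: times_tensor_tensor tensor_lin swap23_lin)
  then show "swap23 ((y \<otimes> c) * (z \<otimes> d)) = swap23 (y \<otimes> c) * swap23 (z \<otimes> d)"
    by (simp add: times_tensor_tensor)
qed

lemma swap23_swap23 [simp]: "swap23 (swap23 z) = z"
proof (induction z rule: tensor_induct)
  case (tensor x c)
  show ?case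
    by (induction x rule: tensor_induct) (simp_all add: swap23_lin tensor_lin)
qed (simp_all add: swap23_lin)

lemma surj_swap23: "surj swap23"
  by (metis swap23_swap23 surjI)


section \<open>Regular multiplier Hopf algebras\<close>

definition unembed :: "'a::nondegenerate_algebra multiplier \<Rightarrow> 'a"
  where "unembed = inv mult_embed"

lemma unembed_embed [simp]: "unembed (mult_embed a) = a"
  unfolding unembed_def by (rule inv_f_f) (simp add: inj_def)

lemma embed_unembed_lift:
  assumes "bij_betw (tensor_lift F) UNIV (range mult_embed)"
  shows "mult_embed (unembed (tensor_lift F z)) = tensor_lift F z"
  using bij_betwE[OF assms] by (metis UNIV_I rangeE unembed_embed)

lemma embed_unembed_cover:
  assumes F: "bilin F" "bij_betw (tensor_lift F) UNIV (range mult_embed)"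
  shows "mult_embed (unembed (F a b)) = F a b"
  using embed_unembed_lift[OF F(2), of "a \<otimes> b"] by (simp add: tensor_lift_tensor F(1))

lemma clinear_cover:
  assumes F: "bilin F" "bij_betw (tensor_lift F) UNIV (range mult_embed)"
  shows "clinear (\<lambda>z. unembed (tensor_lift F z))" "bij (\<lambda>z. unembed (tensor_lift F z))"
proof -
  note E = embed_unembed_lift[OF F(2)]
  show "clinear (\<lambda>z. unembed (tensor_lift F z))"
    unfolding clinear_iff
    by (intro conjI allI; rule embed_inject[THEN iffD1];
      simp only: E embed_add embed_scaleC; simp only: tensor_lift_add[OF F(1)] tensor_lift_scaleC[OF F(1)])
  show "bij (\<lambda>z. unembed (tensor_lift F z))"
  proof (rule bijI)
    show "inj (\<lambda>z. unembed (tensor_lift F z))"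
    proof (rule injI)
      fix z w assume "unembed (tensor_lift F z) = unembed (tensor_lift F w)"
      then have "tensor_lift F z = tensor_lift F w" by (metis E)
      then show "z = w" using F(2) by (metis UNIV_I bij_betw_inv_into_left)
    qed
    show "surj (\<lambda>z. unembed (tensor_lift F z))"
      unfolding surj_def using F(2) unfolding bij_betw_def
      by (metis (no_types, lifting) imageE rangeI unembed_embed)
  qed
qed

text \<open>Surjectivity of a canonical map in the form of an induction principle: a property closed
  under linear combinations needs to be checked on covered coproducts only.\<close>

lemma cover_surj_induct:
  fixes F :: "'b::complex_vector \<Rightarrow> 'c::complex_vector \<Rightarrow> 'a::nondegenerate_algebra multiplier"
  assumes F: "bilin F" "bij_betw (tensor_lift F) UNIV (range mult_embed)"
    and gen: "\<And>a b. P (unembed (F a b))"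
    and add: "\<And>x y. P x \<Longrightarrow> P y \<Longrightarrow> P (x + y)" and scale: "\<And>c x. P x \<Longrightarrow> P (c *\<^sub>C x)"
  shows "P x"
proof -
  let ?u = "\<lambda>z. unembed (tensor_lift F z)"
  note lin = clinear_cover(1)[OF F]
  have "P (?u z)" for z
    by (induction z rule: tensor_induct)
      (simp_all add: tensor_lift_tensor F(1) gen add scale clinear_add[OF lin] clinear_scaleC[OF lin])
  moreover obtain z where "x = ?u z"
    using clinear_cover(2)[OF F] by (rule bij_pointE)
  ultimately show ?thesis by simp
qed

locale regular_mha =
  fixes \<Delta> :: "'a::nondegenerate_algebra \<Rightarrow> ('a \<otimes> 'a) multiplier"
    and \<epsilon> :: "'a \<Rightarrow> complex" and S :: "'a \<Rightarrow> 'a"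
  assumes regular: "regular_multiplier_hopf_algebra \<Delta>"
    and counit: "is_counit \<Delta> \<epsilon>" and antipode: "is_antipode \<Delta> \<epsilon> S"
begin

abbreviation E :: "'b::complex_algebra \<Rightarrow> 'b multiplier" where "E \<equiv> mult_embed"

lemma mha: "multiplier_hopf_algebra \<Delta>" and mha_cop: "multiplier_hopf_algebra (cop \<Delta>)"
  using regular by (auto simp: regular_multiplier_hopf_algebra_def)

lemma clinear_\<Delta>: "clinear \<Delta>" and \<Delta>_times: "\<Delta> (a * b) = \<Delta> a * \<Delta> b"
  using mha by (auto simp: multiplier_hopf_algebra_def)

lemmas \<Delta>_lin = clinear_add[OF clinear_\<Delta>] clinear_scaleC[OF clinear_\<Delta>]

lemma \<epsilon>_lin [simp]: "\<epsilon> (a + b) = \<epsilon> a + \<epsilon> b" "\<epsilon> (c *\<^sub>C a) = c * \<epsilon> a" "\<epsilon> 0 = 0"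
  and \<epsilon>_times: "\<epsilon> (a * b) = \<epsilon> a * \<epsilon> b"
proof -
  have *: "cfunctional \<epsilon>" using counit by (simp add: is_counit_def)
  then show "\<epsilon> (a + b) = \<epsilon> a + \<epsilon> b" "\<epsilon> (c *\<^sub>C a) = c * \<epsilon> a" "\<epsilon> (a * b) = \<epsilon> a * \<epsilon> b"
    using counit by (auto simp: is_counit_def cfunctional_iff)
  show "\<epsilon> 0 = 0" using * unfolding cfunctional_iff by (metis cvec.scale_zero_left mult_zero_left)
qed

lemma clinear_S: "clinear S" and S_times: "S (a * b) = S b * S a"
  using antipode by (auto simp: is_antipode_def)

lemmas S_lin = clinear_add[OF clinear_S] clinear_scaleC[OF clinear_S] clinear_zero[OF clinear_S]

definition "c1 a b = unembed (\<Delta> a * (1 \<otimes>\<^sub>M E b))"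
definition "c2 a b = unembed ((E a \<otimes>\<^sub>M 1) * \<Delta> b)"

lemma bilin_c12: "bilin (\<lambda>a b. \<Delta> a * (1 \<otimes>\<^sub>M E b))" "bilin (\<lambda>a b. (E a \<otimes>\<^sub>M 1) * \<Delta> b)"
  by (simp_all add: bilin_def clinear_iff \<Delta>_lin embed_add embed_scaleC mtensor_lin)

lemma bij_c12: "bij_betw (tensor_lift (\<lambda>a b. \<Delta> a * (1 \<otimes>\<^sub>M E b))) UNIV (range E)"
  "bij_betw (tensor_lift (\<lambda>a b. (E a \<otimes>\<^sub>M 1) * \<Delta> b)) UNIV (range E)"
  using mha by (auto simp: multiplier_hopf_algebra_def)

lemmas c1_induct = cover_surj_induct[OF bilin_c12(1) bij_c12(1), folded c1_def, case_names gen add scaleC]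
  and c2_induct = cover_surj_induct[OF bilin_c12(2) bij_c12(2), folded c2_def, case_names gen add scaleC]

lemma E_c1: "E (c1 a b) = \<Delta> a * (1 \<otimes>\<^sub>M E b)"
  unfolding c1_def by (rule embed_unembed_cover[OF bilin_c12(1) bij_c12(1)])

lemma E_c2: "E (c2 a b) = (E a \<otimes>\<^sub>M 1) * \<Delta> b"
  unfolding c2_def by (rule embed_unembed_cover[OF bilin_c12(2) bij_c12(2)])

lemma counit_c1: "tensor_lift (\<lambda>p q. \<epsilon> p *\<^sub>C q) (c1 a b) = a * b"
  and counit_c2: "tensor_lift (\<lambda>p q. \<epsilon> q *\<^sub>C p) (c2 a b) = a * b"
  using counit E_c1 E_c2 unfolding is_counit_def by metis+

lemma antipode_c1: "tensor_lift (\<lambda>p q. S p * q) (c1 a b) = \<epsilon> a *\<^sub>C b"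
  and antipode_c2: "tensor_lift (\<lambda>p q. p * S q) (c2 a b) = \<epsilon> b *\<^sub>C a"
  using antipode E_c1 E_c2 unfolding is_antipode_def by metis+

lemma bilin_slices: "bilin (\<lambda>p q. \<epsilon> p *\<^sub>C (q::'a))" "bilin (\<lambda>p q. \<epsilon> q *\<^sub>C (p::'a))"
  "bilin (\<lambda>p q. S p * q)" "bilin (\<lambda>p q. p * S q)"
  by (simp_all add: bilin_def clinear_iff S_lin tensor_lin scaleC_add_left scaleC_scaleC mult.commute)

definition "\<epsilon>1 = tensor_lift (\<lambda>p q. \<epsilon> p *\<^sub>C (q::'a))"
definition "\<epsilon>2 = tensor_lift (\<lambda>p q. \<epsilon> q *\<^sub>C (p::'a))"
definition "S1 = tensor_lift (\<lambda>p q. S p * q)"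
definition "S2 = tensor_lift (\<lambda>p q. p * S q)"

lemmas slice_lin [simp] =
  tensor_lift_add[OF bilin_slices(1), folded \<epsilon>1_def] tensor_lift_scaleC[OF bilin_slices(1), folded \<epsilon>1_def]
  tensor_lift_add[OF bilin_slices(2), folded \<epsilon>2_def] tensor_lift_scaleC[OF bilin_slices(2), folded \<epsilon>2_def]
  tensor_lift_add[OF bilin_slices(3), folded S1_def] tensor_lift_scaleC[OF bilin_slices(3), folded S1_def]
  tensor_lift_add[OF bilin_slices(4), folded S2_def] tensor_lift_scaleC[OF bilin_slices(4), folded S2_def]

lemmas slice_tensor [simp] =
  tensor_lift_tensor[OF bilin_slices(1), folded \<epsilon>1_def] tensor_lift_tensor[OF bilin_slices(2), folded \<epsilon>2_def]
  tensor_lift_tensor[OF bilin_slices(3), folded S1_def] tensor_lift_tensor[OF bilin_slices(4), folded S2_def]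

lemmas slice_cover = counit_c1[folded \<epsilon>1_def] counit_c2[folded \<epsilon>2_def]
  antipode_c1[folded S1_def] antipode_c2[folded S2_def]

text \<open>If \<epsilon> = 0, the counit identity for \<Delta>(a)(1 \<otimes> b) makes every
  product a b vanish, and non-degeneracy leaves only the zero algebra, which the type class admits.
  Otherwise an element of nonzero counit is rescaled.\<close>

lemma trivial_or_counit: obtains "\<And>a b. a = (b::'a)" | e where "\<epsilon> e = 1"
proof (cases "\<forall>a. \<epsilon> a = 0")
  case True
  then have "\<epsilon>1 x = 0" for x
    by (simp add: \<epsilon>1_def tensor_lift_def free_lift_def case_prod_unfold)
  then have "a * b = 0" for a b :: 'a using slice_cover(1) by metis
  then have "a = b" for a b :: 'a by (metis nondegenerate_left)
  then show ?thesis using that by blast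
next
  case False
  then obtain a where "\<epsilon> a \<noteq> 0" by blast
  then have "\<epsilon> (inverse (\<epsilon> a) *\<^sub>C a) = 1" by simp
  then show ?thesis using that by blast
qed

text \<open>With \<epsilon>(e) = 1, the element x is a slice of e \<otimes> x. This tensor is a sum
  of terms \<Delta>(a)(1 \<otimes> b), whose slices are the products a b. The resulting equality A =
  A A often stands in for a unit.\<close>

lemma span_times: "(x::'a) \<in> cvec.span {a * b | a b. True}"
proof (rule trivial_or_counit)
  assume *: "\<And>a b. a = (b::'a)"
  show ?thesis by (subst *[of x 0]) (rule cvec.span_zero)
next
  fix e assume e: "\<epsilon> e = 1"
  have "\<epsilon>1 y \<in> cvec.span {a * b | a b. True}" for y
  proof (induction y rule: c1_induct)
    case (gen a b)
    show ?case by (auto simp: slice_cover intro: cvec.span_base)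
  qed (simp_all add: cvec.span_add cvec.span_scale)
  from this[of "e \<otimes> x"] show ?thesis by (simp add: e)
qed

lemma nondeg_E: "nondeg_hom (E :: 'a \<Rightarrow> _)"
proof -
  have "{b * a | a b. True} = {a * b | a b::'a. True}" by blast
  then show ?thesis using span_times by (auto simp: nondeg_hom_def clinear_embed embed_times)
qed

lemma nondeg_E2: "nondeg_hom (E :: 'a \<otimes> 'a \<Rightarrow> _)"
  using nondeg_hom_hom_tensor[OF nondeg_E nondeg_E] by (simp add: hom_tensor_embed)

lemma nondeg_E3: "nondeg_hom (E :: 'a \<otimes> 'a \<otimes> 'a \<Rightarrow> _)"
  using nondeg_hom_hom_tensor[OF nondeg_E2 nondeg_E] by (simp add: hom_tensor_embed)

lemmas times_induct = span_gen_induct[OF span_times, case_names gen add scaleC]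

lemma mleft_\<Delta>_c1: "mleft (\<Delta> a) (p \<otimes> q) = mright (E p \<otimes>\<^sub>M 1) (c1 a q)"
proof -
  have "E (mleft (\<Delta> a) (p \<otimes> q)) = \<Delta> a * ((1 \<otimes>\<^sub>M E q) * (E p \<otimes>\<^sub>M 1))"
    by (simp add: mtensor_times embed_tensor flip: times_embed)
  then show ?thesis by (simp add: E_c1 flip: mult.assoc embed_times_mult embed_inject)
qed

lemma mright_\<Delta>_c2: "mright (\<Delta> a) (p \<otimes> q) = mleft (1 \<otimes>\<^sub>M E q) (c2 p a)"
proof -
  have "E (mright (\<Delta> a) (p \<otimes> q)) = ((1 \<otimes>\<^sub>M E q) * (E p \<otimes>\<^sub>M 1)) * \<Delta> a"
    by (simp add: mtensor_times embed_tensor flip: embed_times_mult)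
  then show ?thesis by (simp add: E_c2 mult.assoc flip: times_embed embed_inject)
qed

text \<open>For c = a b one has c \<otimes> d = (a \<otimes> d)(b \<otimes> 1), and writing a
  \<otimes> d as a sum of \<Delta>(a')(1 \<otimes> b') turns this into a sum of \<Delta>(a')(b
  \<otimes> b'). The other side is symmetric.\<close>

lemma nondeg_\<Delta>: "nondeg_hom \<Delta>"
proof -
  have L: "y \<in> cvec.span {mleft (\<Delta> a) b | a b. True}" for y
  proof (induction y rule: tensor_induct)
    case (tensor c d)
    show ?case
    proof (induction c rule: times_induct)
      case (gen a b)
      have "mright (E b \<otimes>\<^sub>M 1) y \<in> cvec.span {mleft (\<Delta> a) b | a b. True}" for y
      proof (induction y rule: c1_induct)
        case (gen a' b')
        show ?case by (auto simp flip: mleft_\<Delta>_c1 intro: cvec.span_base)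
      qed (simp_all add: cvec.span_add cvec.span_scale)
      from this[of "a \<otimes> d"] show ?case by simp
    qed (simp_all add: tensor_lin cvec.span_add cvec.span_scale)
  qed (simp_all add: cvec.span_add cvec.span_scale)
  have "y \<in> cvec.span {mright (\<Delta> a) b | a b. True}" for y
  proof (induction y rule: tensor_induct)
    case (tensor c d)
    show ?case
    proof (induction d rule: times_induct)
      case (gen a b)
      have "mleft (1 \<otimes>\<^sub>M E a) y \<in> cvec.span {mright (\<Delta> a) b | a b. True}" for y
      proof (induction y rule: c2_induct)
        case (gen a' b')
        show ?case by (auto simp flip: mright_\<Delta>_c2 intro: cvec.span_base)
      qed (simp_all add: cvec.span_add cvec.span_scale)
      from this[of "c \<otimes> b"] show ?case by simp
    qed (simp_all add: tensor_lin cvec.span_add cvec.span_scale)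
  qed (simp_all add: cvec.span_add cvec.span_scale)
  with L show ?thesis by (simp add: nondeg_hom_def clinear_\<Delta> \<Delta>_times)
qed

lemmas \<Delta>_left_induct = nondeg_hom_left_induct[OF nondeg_\<Delta>, case_names gen add scaleC]
  and \<Delta>_right_induct = nondeg_hom_right_induct[OF nondeg_\<Delta>, case_names gen add scaleC]

lemma slice_mult:
  "\<epsilon>1 (mright (E p \<otimes>\<^sub>M 1) x) = \<epsilon> p *\<^sub>C \<epsilon>1 x" "\<epsilon>2 (mleft (1 \<otimes>\<^sub>M E p) x) = \<epsilon> p *\<^sub>C \<epsilon>2 x"
  "S1 (mright (E p \<otimes>\<^sub>M 1) x) = S p * S1 x" "S2 (mleft (1 \<otimes>\<^sub>M E p) x) = S2 x * S p"
  by (induction x rule: tensor_induct;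
      simp add: \<epsilon>_times S_times tensor_lin mult.assoc mult.commute[of "_::complex"])+

lemma \<epsilon>1_\<Delta>: "\<epsilon>1 (mleft (\<Delta> a) x) = a * \<epsilon>1 x"
  and S1_\<Delta>: "S1 (mleft (\<Delta> a) x) = \<epsilon> a *\<^sub>C S1 x"
  by (induction x rule: tensor_induct;
      simp add: mleft_\<Delta>_c1 slice_mult slice_cover tensor_lin mult.commute[of "_::complex"])+

lemma \<epsilon>2_\<Delta>: "\<epsilon>2 (mright (\<Delta> a) x) = \<epsilon>2 x * a"
  and S2_\<Delta>: "S2 (mright (\<Delta> a) x) = \<epsilon> a *\<^sub>C S2 x"
  by (induction x rule: tensor_induct;
      simp add: mright_\<Delta>_c2 slice_mult slice_cover tensor_lin mult.commute[of "_::complex"])+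

text \<open>The counit is multiplicative, so a slice that is known after multiplication from one side
  is known after multiplication from the other.\<close>

lemma \<epsilon>1_times: "\<epsilon>1 (x * y) = \<epsilon>1 x * \<epsilon>1 y" and \<epsilon>2_times: "\<epsilon>2 (x * y) = \<epsilon>2 x * \<epsilon>2 y"
  by (rule tensor_times_hom; simp add: clinear_iff times_tensor_tensor \<epsilon>_times tensor_lin)+

lemma \<epsilon>2_\<Delta>_left: "\<epsilon>2 (mleft (\<Delta> a) x) = a * \<epsilon>2 x"
  and \<epsilon>1_\<Delta>_right: "\<epsilon>1 (mright (\<Delta> a) x) = \<epsilon>1 x * a"
proof -
  have "\<epsilon>2 (mleft (\<Delta> a) x) = a * \<epsilon>2 x \<and> \<epsilon>1 (mright (\<Delta> a) x) = \<epsilon>1 x * a"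
  proof (rule trivial_or_counit)
    fix e assume e: "\<epsilon> e = 1"
    have "b * \<epsilon>2 (mleft (\<Delta> a) x) = b * (a * \<epsilon>2 x)" for b
      using \<epsilon>2_times[of "b \<otimes> e" "mleft (\<Delta> a) x"] \<epsilon>2_times[of "mright (\<Delta> a) (b \<otimes> e)" x]
      by (simp add: e \<epsilon>2_\<Delta> mult.assoc flip: mright_mleft)
    moreover have "\<epsilon>1 (mright (\<Delta> a) x) * b = (\<epsilon>1 x * a) * b" for b
      using \<epsilon>1_times[of "mright (\<Delta> a) x" "e \<otimes> b"] \<epsilon>1_times[of x "mleft (\<Delta> a) (e \<otimes> b)"]
      by (simp add: e \<epsilon>1_\<Delta> mult.assoc mright_mleft)
    ultimately show ?thesis
      using nondegenerate_eqI_left nondegenerate_eqI_right by metis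
  qed blast
  then show "\<epsilon>2 (mleft (\<Delta> a) x) = a * \<epsilon>2 x" "\<epsilon>1 (mright (\<Delta> a) x) = \<epsilon>1 x * a" by auto
qed


section \<open>The co-opposite comultiplication and the two remaining coverings\<close>

lemmas mext_flip = mleft_mext_iso[OF nondeg_E2 clinear_flip flip_times surj_flip]
    mright_mext_iso[OF nondeg_E2 clinear_flip flip_times surj_flip]
  and mext_flip_times = mext_iso_times[OF nondeg_E2 clinear_flip flip_times surj_flip]
  and mext_flip_embed = mext_iso_embed[OF nondeg_E2 clinear_flip flip_times surj_flip]
  and mext_flip_one = mext_iso_one[OF nondeg_E2 clinear_flip flip_times surj_flip]
  and clinear_mext_flip = clinear_mext_iso[OF nondeg_E2 clinear_flip flip_times surj_flip]

lemma mleft_mext_flip: "mleft (mext_iso flip m) x = flip (mleft m (flip (x::'a \<otimes> 'a)))"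
  and mright_mext_flip: "mright (mext_iso flip m) x = flip (mright m (flip x))"
  using mext_flip[of m "flip x"] by simp_all

lemma mext_flip_flip [simp]: "mext_iso flip (mext_iso flip m) = (m :: ('a \<otimes> 'a) multiplier)"
  by (rule multiplier_eqI_left) (simp add: mleft_mext_flip)

lemma mext_flip_mtensor: "mext_iso flip (m \<otimes>\<^sub>M n) = (n::'a multiplier) \<otimes>\<^sub>M (m::'a multiplier)"
  by (rule multiplier_tensor_eqI) (simp_all add: mleft_mext_flip mright_mext_flip)

lemma clinear_cop: "clinear (cop \<Delta>)"
  unfolding cop_def by (rule clinear_comp[OF clinear_mext_flip clinear_\<Delta>])

text \<open>Flipping a covering of the co-opposite comultiplication back gives \<Delta>(a)(b
  \<otimes> 1), and for \<open>c4\<close> it gives (1 \<otimes> b)\<Delta>(a). It is regularity that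
  places these products in A \<otimes> A.\<close>

definition "c3 a b = flip (unembed (cop \<Delta> a * (1 \<otimes>\<^sub>M E b)))"
definition "c4 b a = flip (unembed ((E b \<otimes>\<^sub>M 1) * cop \<Delta> a))"

lemma bilin_c34: "bilin (\<lambda>a b. cop \<Delta> a * (1 \<otimes>\<^sub>M E b))" "bilin (\<lambda>a b. (E a \<otimes>\<^sub>M 1) * cop \<Delta> b)"
  by (simp_all add: bilin_def clinear_iff clinear_add[OF clinear_cop] clinear_scaleC[OF clinear_cop]
      embed_add embed_scaleC mtensor_lin)

lemma bij_c34: "bij_betw (tensor_lift (\<lambda>a b. cop \<Delta> a * (1 \<otimes>\<^sub>M E b))) UNIV (range E)"
  "bij_betw (tensor_lift (\<lambda>a b. (E a \<otimes>\<^sub>M 1) * cop \<Delta> b)) UNIV (range E)"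
  using mha_cop by (auto simp: multiplier_hopf_algebra_def)

lemma E_c3: "E (c3 a b) = \<Delta> a * (E b \<otimes>\<^sub>M 1)"
  unfolding c3_def mext_flip_embed[symmetric] embed_unembed_cover[OF bilin_c34(1) bij_c34(1)]
  by (simp add: mext_flip_times cop_def mext_flip_mtensor)

lemma E_c4: "E (c4 b a) = (1 \<otimes>\<^sub>M E b) * \<Delta> a"
  unfolding c4_def mext_flip_embed[symmetric] embed_unembed_cover[OF bilin_c34(2) bij_c34(2)]
  by (simp add: mext_flip_times cop_def mext_flip_mtensor)

definition "T3 z = flip (unembed (tensor_lift (\<lambda>a b. cop \<Delta> a * (1 \<otimes>\<^sub>M E b)) z))"

lemma clinear_T3: "clinear T3" and bij_T3: "bij T3"
proof -
  show "clinear T3" unfolding T3_def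
    by (rule clinear_comp[OF clinear_flip clinear_cover(1)[OF bilin_c34(1) bij_c34(1)]])
  have "bij flip" by (metis bijI' flip_flip)
  then have "bij (flip \<circ> (\<lambda>z. unembed (tensor_lift (\<lambda>a b. cop \<Delta> a * (1 \<otimes>\<^sub>M E b)) z)))"
    using clinear_cover(2)[OF bilin_c34(1) bij_c34(1)] by (rule bij_comp[rotated])
  then show "bij T3" by (simp add: T3_def[abs_def] o_def)
qed

lemma T3_tensor: "T3 (a \<otimes> b) = c3 a b"
  by (simp add: T3_def c3_def tensor_lift_tensor bilin_c34)

lemma c3_induct [case_names gen add scaleC]:
  assumes "\<And>a b. P (c3 a b)" "\<And>x y. P x \<Longrightarrow> P y \<Longrightarrow> P (x + y)" "\<And>c x. P x \<Longrightarrow> P (c *\<^sub>C x)"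
  shows "P x"
proof -
  have "P (T3 z)" for z
    by (induction z rule: tensor_induct)
      (simp_all add: assms T3_tensor clinear_add[OF clinear_T3] clinear_scaleC[OF clinear_T3])
  then show ?thesis using bij_T3 by (metis bij_pointE)
qed

lemma bilin_c: "bilin c1" "bilin c2" "bilin c3" "bilin c4"
  unfolding bilin_def clinear_iff
  by (intro conjI allI; rule embed_inject[THEN iffD1]; simp only: E_c1 E_c2 E_c3 E_c4 embed_add
      embed_scaleC \<Delta>_lin mtensor_lin)+

lemma clinear_c: "clinear (c1 a)" "clinear (\<lambda>a. c1 a b)" "clinear (c3 a)" "clinear (\<lambda>a. c3 a b)"
   "clinear (c4 a)" "clinear (\<lambda>a. c4 a b)"
  using bilin_c by (simp_all add: bilin_def)

lemma mleft_\<Delta>_c3: "mleft (\<Delta> a) (p \<otimes> q) = mright (1 \<otimes>\<^sub>M E q) (c3 a p)"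
proof -
  have "E (mleft (\<Delta> a) (p \<otimes> q)) = \<Delta> a * ((E p \<otimes>\<^sub>M 1) * (1 \<otimes>\<^sub>M E q))"
    by (simp add: mtensor_times embed_tensor flip: times_embed)
  then show ?thesis by (simp add: E_c3 flip: mult.assoc embed_times_mult embed_inject)
qed

lemma mright_\<Delta>_c4: "mright (\<Delta> a) (p \<otimes> q) = mleft (E p \<otimes>\<^sub>M 1) (c4 q a)"
proof -
  have "E (mright (\<Delta> a) (p \<otimes> q)) = ((E p \<otimes>\<^sub>M 1) * (1 \<otimes>\<^sub>M E q)) * \<Delta> a"
    by (simp add: mtensor_times embed_tensor flip: embed_times_mult)
  then show ?thesis by (simp add: E_c4 mult.assoc flip: times_embed embed_inject)
qed

lemma slice_mult':
  "\<epsilon>1 (mleft (E p \<otimes>\<^sub>M 1) x) = \<epsilon> p *\<^sub>C \<epsilon>1 x" "\<epsilon>2 (mright (1 \<otimes>\<^sub>M E p) x) = \<epsilon> p *\<^sub>C \<epsilon>2 x"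
  "S1 (mright (1 \<otimes>\<^sub>M E p) x) = S1 x * p"
  by (induction x rule: tensor_induct;
      simp add: \<epsilon>_times S_times tensor_lin mult.assoc mult.commute[of "_::complex"])+

text \<open>The counit axioms speak of the coverings \<open>c1\<close> and \<open>c2\<close>. For
  these two, the leg that \<epsilon> acts on is covered by an e with \<epsilon>(e) = 1, which puts
  the slices into the form already computed in \<open>\<epsilon>1_\<Delta>_right\<close> and
  \<open>\<epsilon>2_\<Delta>_left\<close>.\<close>

lemma \<epsilon>1_c4: "\<epsilon>1 (c4 b a) = b * a" and \<epsilon>2_c3: "\<epsilon>2 (c3 a b) = a * b"
proof -
  have "\<epsilon>1 (c4 b a) = b * a \<and> \<epsilon>2 (c3 a b) = a * b"
  proof (rule trivial_or_counit)
    fix e assume e: "\<epsilon> e = 1"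
    have "\<epsilon>1 (mright (\<Delta> a) (e \<otimes> b)) = b * a" by (simp add: \<epsilon>1_\<Delta>_right e)
    moreover have "\<epsilon>2 (mleft (\<Delta> a) (b \<otimes> e)) = a * b" by (simp add: \<epsilon>2_\<Delta>_left e)
    ultimately show ?thesis by (simp add: mleft_\<Delta>_c3 mright_\<Delta>_c4 slice_mult' e)
  qed blast
  then show "\<epsilon>1 (c4 b a) = b * a" "\<epsilon>2 (c3 a b) = a * b" by auto
qed

text \<open>In Sweedler notation S(a1 b) a2 = S(b) S(a1) a2. The second leg is uncovered, so a
  factor is inserted on the right and removed again by non-degeneracy.\<close>

lemma S1_c3: "S1 (c3 a b) = \<epsilon> a *\<^sub>C S b"
  by (rule nondegenerate_eqI_left) (simp add: S1_\<Delta> mult_scaleC_left flip: slice_mult' mleft_\<Delta>_c3)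


section \<open>Coassociativity\<close>

definition D12 :: "('a \<otimes> 'a) multiplier \<Rightarrow> ('a \<otimes> 'a \<otimes> 'a) multiplier"
  where "D12 = mext (hom_tensor \<Delta> E)"

definition D23 :: "('a \<otimes> 'a) multiplier \<Rightarrow> ('a \<otimes> 'a \<otimes> 'a) multiplier"
  where "D23 m = mext_iso reassoc (mext (hom_tensor E \<Delta>) m)"

abbreviation ra :: "('a \<otimes> ('a \<otimes> 'a)) multiplier \<Rightarrow> ('a \<otimes> 'a \<otimes> 'a) multiplier"
  where "ra \<equiv> mext_iso reassoc"

lemmas mext_reassoc = mleft_mext_iso[OF nondeg_E3 clinear_reassoc reassoc_times surj_reassoc]
    mright_mext_iso[OF nondeg_E3 clinear_reassoc reassoc_times surj_reassoc]
  and ra_times = mext_iso_times[OF nondeg_E3 clinear_reassoc reassoc_times surj_reassoc]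
  and ra_embed = mext_iso_embed[OF nondeg_E3 clinear_reassoc reassoc_times surj_reassoc]
  and clinear_ra = clinear_mext_iso[OF nondeg_E3 clinear_reassoc reassoc_times surj_reassoc]

lemma ra_mtensor: "ra (m \<otimes>\<^sub>M (n \<otimes>\<^sub>M k)) = m \<otimes>\<^sub>M n \<otimes>\<^sub>M k"
proof (rule multiplier_eqI_left)
  fix z :: "'a \<otimes> 'a \<otimes> 'a"
  obtain y where z: "z = reassoc y" using surj_reassoc by blast
  have "mleft (ra (m \<otimes>\<^sub>M (n \<otimes>\<^sub>M k))) (reassoc y) = mleft (m \<otimes>\<^sub>M n \<otimes>\<^sub>M k) (reassoc y)"
    unfolding mext_reassoc
  proof (induction y rule: tensor_induct)
    case (tensor a x)
    then show ?case by (induction x rule: tensor_induct) (simp_all add: tensor_lin reassoc_lin)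
  qed (simp_all add: reassoc_lin)
  then show "mleft (ra (m \<otimes>\<^sub>M (n \<otimes>\<^sub>M k))) z = mleft (m \<otimes>\<^sub>M n \<otimes>\<^sub>M k) z" by (simp add: z)
qed

lemmas nondeg_D12 = nondeg_hom_hom_tensor[OF nondeg_\<Delta> nondeg_E]
  and nondeg_D23 = nondeg_hom_hom_tensor[OF nondeg_E nondeg_\<Delta>]

lemmas D12_times = mext_times[OF nondeg_D12, folded D12_def]
  and D12_embed = mext_embed[OF nondeg_D12, folded D12_def]
  and clinear_D12 = clinear_mext[OF nondeg_D12, folded D12_def]

lemma D23_times: "D23 (m * n) = D23 m * D23 n"
  and D23_embed: "D23 (E x) = ra (hom_tensor E \<Delta> x)"
  by (simp_all add: D23_def mext_times[OF nondeg_D23] ra_times mext_embed[OF nondeg_D23])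

lemma clinear_D23: "clinear D23"
  unfolding D23_def by (rule clinear_comp[OF clinear_ra clinear_mext[OF nondeg_D23]])

lemmas D_lin = clinear_add[OF clinear_D12] clinear_scaleC[OF clinear_D12]
  clinear_add[OF clinear_D23] clinear_scaleC[OF clinear_D23]

lemma D12_mtensor: "D12 (m \<otimes>\<^sub>M n) = mext \<Delta> m \<otimes>\<^sub>M n"
  by (simp add: D12_def mext_hom_tensor nondeg_\<Delta> nondeg_E mext_embed_id)

lemma D23_mtensor: "D23 (m \<otimes>\<^sub>M n) = ra (m \<otimes>\<^sub>M mext \<Delta> n)"
  by (simp add: D23_def mext_hom_tensor nondeg_\<Delta> nondeg_E mext_embed_id)

lemmas m\<Delta>_times = mext_times[OF nondeg_\<Delta>] and m\<Delta>_one = mext_one[OF nondeg_\<Delta>]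
  and m\<Delta>_embed = mext_embed[OF nondeg_\<Delta>]
  and clinear_m\<Delta> = clinear_mext[OF nondeg_\<Delta>]

lemma D23_left: "D23 (m \<otimes>\<^sub>M 1) = m \<otimes>\<^sub>M 1 \<otimes>\<^sub>M 1"
  by (simp add: D23_mtensor m\<Delta>_one flip: ra_mtensor mtensor_one)

lemma D12_right: "D12 (1 \<otimes>\<^sub>M m) = 1 \<otimes>\<^sub>M m"
  by (simp add: D12_mtensor m\<Delta>_one)

lemma cancel3_left:
  assumes "\<And>a. mleft (E a \<otimes>\<^sub>M 1 \<otimes>\<^sub>M 1) w = mleft (E a \<otimes>\<^sub>M 1 \<otimes>\<^sub>M 1) (w' :: 'a \<otimes> 'a \<otimes> 'a)"
  shows "w = w'"
proof (rule nondegenerate_eqI_right)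
  fix y
  have "(a \<otimes> b \<otimes> c) * w = (a \<otimes> b \<otimes> c) * w'" for a b c
  proof -
    have "E (a \<otimes> b \<otimes> c) = (1 \<otimes>\<^sub>M E b \<otimes>\<^sub>M E c) * (E a \<otimes>\<^sub>M 1 \<otimes>\<^sub>M 1)"
      by (simp add: embed_tensor mtensor_times)
    then have "mleft (E (a \<otimes> b \<otimes> c)) w = mleft (E (a \<otimes> b \<otimes> c)) w'"
      by (simp only: mleft_times assms)
    then show ?thesis by simp
  qed
  then have "(x \<otimes> c) * w = (x \<otimes> c) * w'" for x c
    by (induction x rule: tensor_induct) (simp_all add: tensor_lin)
  then show "y * w = y * w'"
    by (induction y rule: tensor_induct) (simp_all add: tensor_lin)
qed

text \<open>The coassociativity axiom covers the first leg from the left and the third from the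
  right. The left cover is removed by non-degeneracy of the triple tensor product, the right one by
  A = A A.\<close>

lemma cancel3:
  assumes "\<And>a c. (E a \<otimes>\<^sub>M 1 \<otimes>\<^sub>M 1) * X * (1 \<otimes>\<^sub>M 1 \<otimes>\<^sub>M E c)
    = (E a \<otimes>\<^sub>M 1 \<otimes>\<^sub>M 1) * Y * (1 \<otimes>\<^sub>M 1 \<otimes>\<^sub>M E c)"
  shows "X = (Y :: ('a \<otimes> 'a \<otimes> 'a) multiplier)"
proof (rule multiplier_eqI_left)
  fix z
  have *: "mleft X (mleft (1 \<otimes>\<^sub>M 1 \<otimes>\<^sub>M E c) w) = mleft Y (mleft (1 \<otimes>\<^sub>M 1 \<otimes>\<^sub>M E c) w)" for c w
    by (rule cancel3_left) (use assms in \<open>simp flip: mleft_times mult.assoc\<close>)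
  show "mleft X z = mleft Y z"
  proof (induction z rule: tensor_induct)
    case (tensor x d)
    show ?case
    proof (induction d rule: times_induct)
      case (gen a b)
      show ?case using *[of a "x \<otimes> b"] by (simp add: mtensor_one)
    qed (simp_all add: tensor_lin)
  qed simp_all
qed

lemma coassoc: "D12 (\<Delta> b) = D23 (\<Delta> b)"
proof (rule cancel3)
  fix a c
  have "(E a \<otimes>\<^sub>M 1 \<otimes>\<^sub>M 1) * hom_tensor \<Delta> E (c1 b c) = ra (hom_tensor E \<Delta> (c2 a b)) * (1 \<otimes>\<^sub>M 1 \<otimes>\<^sub>M E c)"
    using mha E_c1 E_c2 unfolding multiplier_hopf_algebra_def by blast
  then show "(E a \<otimes>\<^sub>M 1 \<otimes>\<^sub>M 1) * D12 (\<Delta> b) * (1 \<otimes>\<^sub>M 1 \<otimes>\<^sub>M E c)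
      = (E a \<otimes>\<^sub>M 1 \<otimes>\<^sub>M 1) * D23 (\<Delta> b) * (1 \<otimes>\<^sub>M 1 \<otimes>\<^sub>M E c)"
    by (simp add: E_c1 E_c2 D12_times D23_times D12_right D23_left mult.assoc mtensor_one
        flip: D12_embed D23_embed)
qed

lemmas embed_lin = embed_add embed_scaleC

text \<open>Applying a covered coproduct to one leg is read as a product of multipliers. Identities
  between elements of the triple tensor product can then be checked on \<open>D12\<close> and
  \<open>D23\<close>, where coassociativity is the equation \<open>coassoc\<close>.\<close>

lemma E_map_c3: "E (tensor_map (\<lambda>z. c3 z b) (\<lambda>x. x) y) = D12 (E y) * (E b \<otimes>\<^sub>M 1 \<otimes>\<^sub>M 1)"
  and E_map_c1: "E (tensor_map (\<lambda>z. c1 z b) (\<lambda>x. x) y) = D12 (E y) * (1 \<otimes>\<^sub>M E b \<otimes>\<^sub>M 1)"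
  by (induction y rule: tensor_induct; simp add: clinear_add[OF clinear_tensor_map]
      clinear_scaleC[OF clinear_tensor_map] clinear_c clinear_id embed_lin D_lin tensor_lin
      tensor_map_tensor; simp add: embed_tensor E_c1 E_c3 D12_mtensor m\<Delta>_embed mtensor_times)+

lemma E_map_c4': "E (reassoc (tensor_map (\<lambda>x. x) (c4 b) y)) = (1 \<otimes>\<^sub>M 1 \<otimes>\<^sub>M E b) * D23 (E y)"
  and E_map_c1': "E (reassoc (tensor_map (\<lambda>x. x) (\<lambda>z. c1 z b) y)) = D23 (E y) * (1 \<otimes>\<^sub>M 1 \<otimes>\<^sub>M E b)"
  by (induction y rule: tensor_induct; simp add: clinear_add[OF clinear_tensor_map]
      clinear_scaleC[OF clinear_tensor_map] clinear_c clinear_id reassoc_lin embed_lin D_lin tensor_lin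
      tensor_map_tensor; simp add: embed_tensor E_c1 E_c4 D23_mtensor m\<Delta>_embed
      mtensor_times flip: ra_embed ra_mtensor ra_times)+

lemma E_map_\<Delta>: "E (reassoc (tensor_map (\<lambda>x. x) (\<lambda>q. mleft (\<Delta> q) w) y)) = D23 (E y) * ra (1 \<otimes>\<^sub>M E w)"
proof -
  have "clinear (\<lambda>q. mleft (\<Delta> q) w)" by (simp add: clinear_iff \<Delta>_lin)
  then show ?thesis
    by (induction y rule: tensor_induct; simp add: clinear_add[OF clinear_tensor_map]
      clinear_scaleC[OF clinear_tensor_map] clinear_id reassoc_lin embed_lin D_lin tensor_lin
      tensor_map_tensor; simp add: embed_tensor D23_mtensor m\<Delta>_embed
      mtensor_times ra_times times_embed flip: ra_embed ra_times)
qed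

text \<open>Both sides represent the twofold coproduct of x, multiplied by 1 \<otimes> 1 \<otimes> c
  on the left and by b \<otimes> 1 \<otimes> 1 on the right.\<close>

lemma coassoc_c3_c4:
  "tensor_map (\<lambda>z. c3 z b) (\<lambda>x. x) (c4 c x) = reassoc (tensor_map (\<lambda>x. x) (c4 c) (c3 x b))"
  by (rule embed_inject[THEN iffD1]) (simp only: E_map_c3 E_map_c4' E_c3 E_c4 D12_times D23_times
      D12_right D23_left coassoc mult.assoc mtensor_one)

text \<open>Both sides represent the twofold coproduct of y multiplied by b \<otimes> 1 \<otimes> c
  on the right.\<close>

lemma coassoc_c1_c3:
  "tensor_map (\<lambda>p. c3 p b) (\<lambda>x. x) (c1 y c) = reassoc (tensor_map (\<lambda>x. x) (\<lambda>l. c1 l c) (c3 y b))"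
  by (rule embed_inject[THEN iffD1]) (simp add: E_map_c3 E_map_c1' E_c3 E_c1 D12_times D23_times
      D12_right D23_left coassoc mult.assoc mtensor_times flip: mtensor_one)


section \<open>Bijectivity of the antipode\<close>

text \<open>Once S is known to be bijective this is a \<otimes> q \<mapsto> S^-1(q) a, because
  S^-1(x2) x1 = \<epsilon>(x). Inverting the canonical map \<open>T3\<close> provides it before S^-1
  is available.\<close>

definition "\<theta> y = \<epsilon>1 (inv T3 y)"

lemma \<theta>_c3: "\<theta> (c3 x b) = \<epsilon> x *\<^sub>C b"
  using bij_T3 unfolding \<theta>_def T3_tensor[symmetric] by (simp add: bij_def)

lemma clinear_\<theta>: "clinear \<theta>"
proof -
  have "inj T3" "\<And>x. T3 (inv T3 x) = x"
    using bij_T3 by (simp_all add: bij_def surj_f_inv_f)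
  then have "clinear (inv T3)"
    unfolding clinear_iff
    by (intro conjI allI inv_f_eq; simp add: clinear_add[OF clinear_T3] clinear_scaleC[OF clinear_T3])
  then show ?thesis unfolding \<theta>_def by (simp add: clinear_iff)
qed

lemmas \<theta>_lin = clinear_add[OF clinear_\<theta>] clinear_scaleC[OF clinear_\<theta>]

lemma mleft_\<Delta>_c3': "mleft (\<Delta> a) (c3 x b) = c3 (a * x) b"
  by (rule embed_inject[THEN iffD1]) (simp add: E_c3 \<Delta>_times mult.assoc flip: times_embed)

lemma \<theta>_\<Delta>: "\<theta> (mleft (\<Delta> x) y) = \<epsilon> x *\<^sub>C \<theta> y"
  by (induction y rule: c3_induct) (simp_all add: mleft_\<Delta>_c3' \<theta>_c3 \<epsilon>_times \<theta>_lin tensor_lin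
      mult.commute)

text \<open>With \<theta>(a \<otimes> q) read as S^-1(q) a, this is S^-1(S(p) q) = S^-1(q) p. When p
  \<otimes> q is replaced by \<Delta>(x)(1 \<otimes> b), both sides become \<epsilon>(x) \<theta>(a
  \<otimes> b).\<close>

lemma \<theta>_S: "\<theta> (a \<otimes> (S p * q)) = \<theta> ((p * a) \<otimes> q)"
proof -
  have "\<theta> (a \<otimes> S1 y) = \<theta> (mright (E a \<otimes>\<^sub>M 1) y)" for y
    by (induction y rule: c1_induct)
      (simp_all add: \<theta>_lin tensor_lin slice_cover \<theta>_\<Delta> flip: mleft_\<Delta>_c1)
  from this[of "p \<otimes> q"] show ?thesis by simp
qed

lemma bilin_\<Omega>: "bilin (\<lambda>a q. tensor_lift (\<lambda>q1 q2. q2 \<otimes> \<theta> (a \<otimes> q1)) (c4 c q))"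
proof -
  have "bilin (\<lambda>q1 q2. q2 \<otimes> \<theta> (a \<otimes> q1))" for a
    by (simp add: bilin_def clinear_iff tensor_lin \<theta>_lin)
  then show ?thesis
    by (simp add: bilin_def clinear_add[OF clinear_c(5)] clinear_scaleC[OF clinear_c(5)]
        clinear_iff tensor_lin \<theta>_lin tensor_lift_add tensor_lift_scaleC tensor_lift_fun_add
        tensor_lift_fun_scaleC)
qed

text \<open>The inverse of \<open>T3\<close> should be a \<otimes> q \<mapsto> q2 \<otimes> S^-1(q1)
  a. The map here is this formula covered by c, with \<theta> in place of S^-1. By coassociativity
  \<theta> meets x1 b \<otimes> x2 and collapses it.\<close>

lemma \<Omega>_c3: "tensor_lift (\<lambda>a q. tensor_lift (\<lambda>q1 q2. q2 \<otimes> \<theta> (a \<otimes> q1)) (c4 c q)) (c3 x b) = (c * x) \<otimes> b"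
    (is "?\<Omega> (c3 x b) = _")
proof -
  define K where "K = tensor_lift (\<lambda>y q2::'a. q2 \<otimes> \<theta> y)"
  have bl: "bilin (\<lambda>y q2::'a. q2 \<otimes> \<theta> y)" "bilin (\<lambda>q1 q2. q2 \<otimes> \<theta> (a \<otimes> q1))" for a
    by (simp_all add: bilin_def clinear_iff tensor_lin \<theta>_lin)
  have K: "clinear K" unfolding K_def by (rule clinear_tensor_lift[OF bl(1)])
  have eq: "tensor_lift (\<lambda>q1 q2. q2 \<otimes> \<theta> (a \<otimes> q1)) z = K (reassoc (a \<otimes> z))" for a z
    by (induction z rule: tensor_induct) (simp_all add: tensor_lift_tensor bl K_def tensor_lift_add
        tensor_lift_scaleC tensor_lin reassoc_lin)
  have bl': "bilin (\<lambda>a q. K (reassoc (a \<otimes> c4 c q)))"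
    using bilin_\<Omega>[of c] by (simp add: eq)
  have "?\<Omega> y = K (reassoc (tensor_map (\<lambda>x. x) (c4 c) y))" for y
    unfolding eq
    by (induction y rule: tensor_induct) (simp_all add: tensor_lift_tensor[OF bl'] tensor_lift_add[OF bl']
        tensor_lift_scaleC[OF bl'] tensor_map_tensor clinear_id clinear_c clinear_add[OF clinear_tensor_map]
      clinear_scaleC[OF clinear_tensor_map] reassoc_lin clinear_add[OF K] clinear_scaleC[OF K])
  then have "?\<Omega> (c3 x b) = K (tensor_map (\<lambda>z. c3 z b) (\<lambda>x. x) (c4 c x))"
    by (simp add: coassoc_c3_c4)
  also have "K (tensor_map (\<lambda>z. c3 z b) (\<lambda>x. x) y) = \<epsilon>1 y \<otimes> b" for y
    by (induction y rule: tensor_induct) (simp_all add: K_def tensor_lift_tensor bl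
        tensor_map_tensor clinear_id clinear_c clinear_add[OF clinear_tensor_map]
      clinear_scaleC[OF clinear_tensor_map] tensor_lift_add tensor_lift_scaleC \<theta>_c3 tensor_lin)
  finally show ?thesis by (simp add: \<epsilon>1_c4)
qed

text \<open>If S(p) = 0, then by \<open>\<theta>_S\<close> the map \<theta> vanishes on p a
  \<otimes> q for all a and q. By \<open>\<Omega>_c3\<close> the preimage of p a \<otimes> q under
  \<open>T3\<close> is then annihilated by every cover c, so p a \<otimes> q = 0.\<close>

lemma inj_S: "inj S"
proof -
  have "p = 0" if p: "S p = 0" for p
  proof (rule trivial_or_counit)
    fix e assume "\<epsilon> e = 1"
    then have "e \<noteq> 0" by auto
    have "\<theta> ((p * a) \<otimes> q) = 0" for a q
      using \<theta>_S[of a p q] by (simp add: p clinear_zero[OF clinear_\<theta>])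
    then have *: "tensor_lift (\<lambda>a q. tensor_lift (\<lambda>q1 q2. q2 \<otimes> \<theta> (a \<otimes> q1)) (c4 c q)) ((p * a) \<otimes> q) = 0"
      for c a q
      by (simp add: tensor_lift_tensor bilin_\<Omega>)
        (simp add: tensor_lift_def free_lift_def case_prod_unfold)
    have \<Omega>: "tensor_lift (\<lambda>a q. tensor_lift (\<lambda>q1 q2. q2 \<otimes> \<theta> (a \<otimes> q1)) (c4 c q)) (T3 z)
        = mleft (E c \<otimes>\<^sub>M 1) z" for c z
      by (induction z rule: tensor_induct) (simp_all add: T3_tensor \<Omega>_c3 clinear_add[OF clinear_T3]
          clinear_scaleC[OF clinear_T3] tensor_lift_add tensor_lift_scaleC bilin_\<Omega>)
    have "(p * a) \<otimes> q = 0" for a q :: 'a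
    proof -
      obtain z where z: "(p * a) \<otimes> q = T3 z" using bij_T3 by (metis bij_pointE)
      have "y * z = y * 0" for y
      proof (induction y rule: tensor_induct)
        case (tensor c d)
        have "E (c \<otimes> d) = (1 \<otimes>\<^sub>M E d) * (E c \<otimes>\<^sub>M 1)"
          by (simp add: mtensor_times embed_tensor)
        then have "(c \<otimes> d) * z = mleft (1 \<otimes>\<^sub>M E d) (mleft (E c \<otimes>\<^sub>M 1) z)"
          by (metis mleft_embed mleft_times)
        moreover have "mleft (E c \<otimes>\<^sub>M 1) z = 0"
          using \<Omega>[of c z] unfolding z[symmetric] * by simp
        ultimately show ?case by simp
      qed (simp_all add: tensor_lin)
      then have "z = 0" by (rule nondegenerate_eqI_right)
      then show ?thesis by (simp add: z clinear_zero[OF clinear_T3])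
    qed
    then have "\<epsilon>2 ((p * a) \<otimes> e) = \<epsilon>2 0" for a by simp
    then have "p * a = 0" for a using \<open>\<epsilon> e = 1\<close> slice_lin(4)[of 0 0] by simp
    then show ?thesis by (rule nondegenerate_left)
  qed blast
  then show ?thesis by (rule clinear_injI[OF clinear_S])
qed

text \<open>The map p \<otimes> q \<mapsto> S(p) q takes the value b at \<Delta>(e)(1 \<otimes> b)
  when \<epsilon>(e) = 1. The same tensor is a sum of terms \<Delta>(a)(c \<otimes> 1), where the
  value is \<epsilon>(a) S(c).\<close>

lemma surj_S: "surj S"
proof -
  have range: "S1 y \<in> range S" for y
  proof (induction y rule: c3_induct)
    case (gen a b)
    show ?case by (simp add: S1_c3 flip: S_lin(2))
  next
    case (add x y)
    then obtain p q where "S1 x = S p" "S1 y = S q" by blast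
    then show ?case by (simp flip: S_lin(1))
  next
    case (scaleC c x)
    then obtain p where "S1 x = S p" by blast
    then show ?case by (simp flip: S_lin(2))
  qed
  have "b \<in> range S" for b
  proof (rule trivial_or_counit)
    assume "\<And>a b. a = (b::'a)"
    then have "b = S b" by blast
    then show ?thesis by (rule range_eqI)
  next
      fix e assume e: "\<epsilon> e = 1"
    show ?thesis using range[of "c1 e b"] by (simp add: slice_cover e)
  qed
  then show ?thesis by blast
qed

sublocale S: anti_aut S
  by (rule anti_aut.intro) (simp_all add: clinear_S S_times bij_def inj_S surj_S)


section \<open>The antipode and the comultiplication\<close>

text \<open>The flip is built in so that this anti-automorphism carries \<Delta>(p) to
  \<Delta>(S(p)).\<close>

definition "SS = tensor_lift (\<lambda>a b. S b \<otimes> S a)"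

lemma bilin_SS: "bilin (\<lambda>a b. S b \<otimes> S a)"
  by (simp add: bilin_def clinear_iff S_lin tensor_lin)

lemma clinear_SS: "clinear SS" and SS_tensor [simp]: "SS (a \<otimes> b) = S b \<otimes> S a"
  unfolding SS_def by (simp_all add: clinear_tensor_lift tensor_lift_tensor bilin_SS)

lemmas SS_lin = clinear_add[OF clinear_SS] clinear_scaleC[OF clinear_SS]

lemma SS_times: "SS (x * y) = SS y * SS x"
proof -
  have "SS ((a \<otimes> b) * y) = SS y * SS (a \<otimes> b)" for a b
    by (induction y rule: tensor_induct) (simp_all add: times_tensor_tensor S_times tensor_lin SS_lin)
  then show ?thesis
    by (induction x rule: tensor_induct) (simp_all add: tensor_lin SS_lin)
qed

lemma bij_SS: "bij SS"
proof (rule o_bij)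
  let ?I = "tensor_lift (\<lambda>a b. inv S b \<otimes> inv S a)"
  have bl: "bilin (\<lambda>a b. inv S b \<otimes> inv S a)"
    by (simp add: bilin_def clinear_iff tensor_lin clinear_add[OF S.clinear_inv]
        clinear_scaleC[OF S.clinear_inv])
  have "SS (?I x) = x" "?I (SS x) = x" for x
    by (induction x rule: tensor_induct; simp add: tensor_lift_tensor bl tensor_lift_add
        tensor_lift_scaleC SS_lin)+
  then show "?I \<circ> SS = id" "SS \<circ> ?I = id" by (simp_all add: fun_eq_iff)
qed

sublocale SS: anti_aut SS
  by (rule anti_aut.intro) (simp_all add: clinear_SS SS_times bij_SS)

abbreviation mS :: "'a multiplier \<Rightarrow> 'a multiplier" where "mS \<equiv> mext_anti S"
abbreviation mSS :: "('a \<otimes> 'a) multiplier \<Rightarrow> ('a \<otimes> 'a) multiplier" where "mSS \<equiv> mext_anti SS"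

lemma mSS_eqI: "(\<And>x. mleft X (SS x) = SS (mright m x)) \<Longrightarrow> mSS m = X"
  by (rule multiplier_eqI_left) (metis SS.S_inv SS.mleft_mS)

lemma mSS_mtensor: "mSS (m \<otimes>\<^sub>M n) = mS n \<otimes>\<^sub>M mS m"
proof (rule mSS_eqI)
  fix x show "mleft (mS n \<otimes>\<^sub>M mS m) (SS x) = SS (mright (m \<otimes>\<^sub>M n) x)"
    by (induction x rule: tensor_induct) (simp_all add: S.mleft_mS SS_lin)
qed

lemma mSS_\<Delta>_c3: "mleft (1 \<otimes>\<^sub>M E (S c)) (mleft (mSS (\<Delta> p)) y) = SS (c3 p c) * y"
proof -
  have "(1 \<otimes>\<^sub>M E (S c)) * mSS (\<Delta> p) = mSS (\<Delta> p * (E c \<otimes>\<^sub>M 1))"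
    by (simp add: SS.mS_times mSS_mtensor S.mS_one S.mS_embed)
  also have "\<dots> = E (SS (c3 p c))" by (simp add: SS.mS_embed flip: E_c3)
  finally show ?thesis by (metis mleft_times mleft_embed)
qed

lemma cancel2_right:
  assumes "\<And>c. mleft (1 \<otimes>\<^sub>M E (S c)) w = mleft (1 \<otimes>\<^sub>M E (S c)) (w' :: 'a \<otimes> 'a)"
  shows "w = w'"
proof (rule nondegenerate_eqI_right)
  fix y show "y * w = y * w'"
  proof (induction y rule: tensor_induct)
    case (tensor a b)
    have "E (a \<otimes> b) = (E a \<otimes>\<^sub>M 1) * (1 \<otimes>\<^sub>M E (S (inv S b)))"
      by (simp add: embed_tensor mtensor_times)
    then have "mleft (E (a \<otimes> b)) w = mleft (E (a \<otimes> b)) w'"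
      by (simp only: mleft_times assms)
    then show ?case by simp
  qed (simp_all add: tensor_lin)
qed

text \<open>In Sweedler notation (S(y2) \<otimes> S(y1))(y3 c \<otimes> h) = S(y2) y3 c \<otimes>
  S(y1) h, where S(y2) y3 collapses. The cover S(c') replaces \<open>mSS (\<Delta> p)\<close> by an
  element of A \<otimes> A, so that \<open>coassoc_c1_c3\<close> applies.\<close>

lemma mSS_\<Delta>_inner:
  "tensor_lift (\<lambda>p q. mleft (mSS (\<Delta> p)) (q \<otimes> h)) (c1 y c) = c \<otimes> (S y * h)"
proof (rule cancel2_right)
  fix c'
  define K where "K = tensor_lift (\<lambda>w q. SS w * (q \<otimes> h))"
  have bl: "bilin (\<lambda>w q. SS w * (q \<otimes> h))" "bilin (\<lambda>p q. SS (c3 p c') * (q \<otimes> h))"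
    by (simp_all add: bilin_def clinear_iff SS_lin tensor_lin clinear_add[OF clinear_c(4)]
        clinear_scaleC[OF clinear_c(4)])
  have K: "clinear K" unfolding K_def by (rule clinear_tensor_lift[OF bl(1)])
  note lin = clinear_add[OF K] clinear_scaleC[OF K] clinear_add[OF clinear_tensor_map]
    clinear_scaleC[OF clinear_tensor_map] reassoc_lin tensor_lin
  have "mleft (1 \<otimes>\<^sub>M E (S c')) (tensor_lift (\<lambda>p q. mleft (mSS (\<Delta> p)) (q \<otimes> h)) (c1 y c))
      = tensor_lift (\<lambda>p q. SS (c3 p c') * (q \<otimes> h)) (c1 y c)"
    by (simp add: clinear_lift[OF clinear_mleft] mSS_\<Delta>_c3)
  also have "\<dots> = K (tensor_map (\<lambda>p. c3 p c') (\<lambda>x. x) (c1 y c))"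
  proof -
    have "tensor_lift (\<lambda>p q. SS (c3 p c') * (q \<otimes> h)) x = K (tensor_map (\<lambda>p. c3 p c') (\<lambda>x. x) x)" for x
      by (induction x rule: tensor_induct) (simp_all add: K_def tensor_lift_tensor bl tensor_map_tensor
          clinear_c clinear_id tensor_lift_add tensor_lift_scaleC clinear_add[OF clinear_tensor_map]
          clinear_scaleC[OF clinear_tensor_map])
    then show ?thesis .
  qed
  also have "\<dots> = K (reassoc (tensor_map (\<lambda>x. x) (\<lambda>l. c1 l c) (c3 y c')))"
    by (simp add: coassoc_c1_c3)
  also have "\<dots> = c \<otimes> (S (\<epsilon>2 (c3 y c')) * h)"
  proof -
    have "K (reassoc (k \<otimes> w)) = S1 w \<otimes> (S k * h)" for k w
      by (induction w rule: tensor_induct)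
        (simp_all add: lin, simp add: K_def tensor_lift_tensor bl times_tensor_tensor)
    then have "K (reassoc (tensor_map (\<lambda>x. x) (\<lambda>l. c1 l c) x)) = c \<otimes> (S (\<epsilon>2 x) * h)" for x
      by (induction x rule: tensor_induct)
        (simp_all add: lin S_lin tensor_map_tensor clinear_id clinear_c slice_cover)
    then show ?thesis .
  qed
  finally show "mleft (1 \<otimes>\<^sub>M E (S c')) (tensor_lift (\<lambda>p q. mleft (mSS (\<Delta> p)) (q \<otimes> h)) (c1 y c))
      = mleft (1 \<otimes>\<^sub>M E (S c')) (c \<otimes> (S y * h))"
    by (simp add: \<epsilon>2_c3 S_times mult.assoc)
qed

text \<open>The twofold coproduct of x multiplied by 1 \<otimes> w on the right. It is extended
  linearly from w = c \<otimes> d so that w may be of the form \<Delta>(b) v.\<close>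

definition "N x = tensor_lift (\<lambda>c d. tensor_map (\<lambda>y. c1 y c) (\<lambda>h. h) (c1 x d))"

lemma bilin_N: "bilin (\<lambda>c d. tensor_map (\<lambda>y. c1 y c) (\<lambda>h. h) (c1 x d))"
proof -
  have "tensor_map (\<lambda>y. c1 y (c + c')) (\<lambda>h. h) z
      = tensor_map (\<lambda>y. c1 y c) (\<lambda>h. h) z + tensor_map (\<lambda>y. c1 y c') (\<lambda>h. h) z"
    "tensor_map (\<lambda>y. c1 y (k *\<^sub>C c)) (\<lambda>h. h) z = k *\<^sub>C tensor_map (\<lambda>y. c1 y c) (\<lambda>h. h) z"
    for c c' k and z :: "'a \<otimes> 'a"
    by (simp_all add: tensor_map_def clinear_add[OF clinear_c(1)] clinear_scaleC[OF clinear_c(1)]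
       tensor_fun_lin tensor_lin tensor_lift_fun_add tensor_lift_fun_scaleC)
  then show ?thesis
    by (simp add: bilin_def clinear_iff clinear_add[OF clinear_c(1)] clinear_scaleC[OF clinear_c(1)]
        clinear_add[OF clinear_tensor_map[OF clinear_c(2) clinear_id]]
        clinear_scaleC[OF clinear_tensor_map[OF clinear_c(2) clinear_id]])
qed

lemma N_lin: "N x (v + w) = N x v + N x w" "N x (k *\<^sub>C v) = k *\<^sub>C N x v"
  by (simp_all add: N_def tensor_lift_add tensor_lift_scaleC bilin_N)

lemma E_N: "E (N x w) = D23 (\<Delta> x) * ra (1 \<otimes>\<^sub>M E w)"
proof (induction w rule: tensor_induct)
  case (tensor c d)
  have "E (N x (c \<otimes> d)) = D12 (\<Delta> x) * ((1 \<otimes>\<^sub>M E d) * (1 \<otimes>\<^sub>M E c \<otimes>\<^sub>M 1))"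
    by (simp add: N_def tensor_lift_tensor bilin_N E_map_c1 E_c1 D12_times D12_right mult.assoc)
  then show ?case by (simp add: coassoc mtensor_times embed_tensor ra_mtensor)
qed (simp_all add: N_lin embed_lin mtensor_lin clinear_add[OF clinear_ra] clinear_scaleC[OF clinear_ra])

lemma N_\<Delta>: "N x (mleft (\<Delta> b) w) = reassoc (tensor_map (\<lambda>x. x) (\<lambda>q. mleft (\<Delta> q) w) (c1 x b))"
  by (rule embed_inject[THEN iffD1]) (simp add: E_N E_map_\<Delta> E_c1 D23_times D23_mtensor m\<Delta>_embed
      mtensor_times mult.assoc flip: ra_times times_embed)

text \<open>The convolution identity saying that \<open>mSS\<close> after \<Delta> is a left inverse
  of \<Delta>, covered by b. Both sides come from contracting
  \<open>N x (mleft (\<Delta> b) w)\<close> with \<open>J\<close>: the antipode identity reduces it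
  to \<epsilon>(x) \<Delta>(b) w, and coassociativity rewrites it as the sum on the left.\<close>

lemma mSS_\<Delta>_times_\<Delta>:
  "tensor_lift (\<lambda>p q. mleft (mSS (\<Delta> p)) (mleft (\<Delta> q) w)) (c1 x b) = \<epsilon> x *\<^sub>C mleft (\<Delta> b) w"
proof -
  define J where "J = tensor_lift (\<lambda>pc d. tensor_lift (\<lambda>p c. mleft (mSS (\<Delta> p)) (c \<otimes> d)) pc)"
  have bl1: "bilin (\<lambda>p c. mleft (mSS (\<Delta> p)) (c \<otimes> d))" for d
    by (simp add: bilin_def clinear_iff \<Delta>_lin SS.mS_lin tensor_lin)
  have bl2: "bilin (\<lambda>pc d. tensor_lift (\<lambda>p c. mleft (mSS (\<Delta> p)) (c \<otimes> d)) pc)"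
    by (simp add: bilin_def clinear_iff tensor_lin tensor_lift_fun_add tensor_lift_fun_scaleC
        tensor_lift_add[OF bl1] tensor_lift_scaleC[OF bl1])
  have bl3: "bilin (\<lambda>p q. mleft (mSS (\<Delta> p)) (mleft (\<Delta> q) w))"
    by (simp add: bilin_def clinear_iff \<Delta>_lin SS.mS_lin tensor_lin)
  have J: "clinear J" unfolding J_def by (rule clinear_tensor_lift[OF bl2])
  have lin\<Delta>: "clinear (\<lambda>q. mleft (\<Delta> q) w)" by (simp add: clinear_iff \<Delta>_lin)
  note lin = clinear_add[OF J] clinear_scaleC[OF J] clinear_add[OF clinear_tensor_map]
    clinear_scaleC[OF clinear_tensor_map] reassoc_lin tensor_lin N_lin
  have "J (tensor_map (\<lambda>y. c1 y c) (\<lambda>h. h) z) = c \<otimes> S1 z" for c z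
    by (induction z rule: tensor_induct)
      (simp_all add: lin tensor_map_tensor clinear_c clinear_id,
       simp add: J_def tensor_lift_tensor bl2 mSS_\<Delta>_inner)
  then have JN: "J (N x v) = \<epsilon> x *\<^sub>C v" for v
    by (induction v rule: tensor_induct)
      (simp_all add: lin, simp add: N_def tensor_lift_tensor bilin_N slice_cover tensor_lin)
  have "J (reassoc (p \<otimes> v)) = mleft (mSS (\<Delta> p)) v" for p v
    by (induction v rule: tensor_induct)
      (simp_all add: lin, simp add: J_def tensor_lift_tensor bl1 bl2)
  then have "tensor_lift (\<lambda>p q. mleft (mSS (\<Delta> p)) (mleft (\<Delta> q) w)) z
      = J (reassoc (tensor_map (\<lambda>x. x) (\<lambda>q. mleft (\<Delta> q) w) z))" for z
    by (induction z rule: tensor_induct) (simp_all add: lin tensor_map_tensor clinear_id lin\<Delta>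
      tensor_lift_tensor bl3 tensor_lift_add tensor_lift_scaleC)
  then show ?thesis by (simp add: JN flip: N_\<Delta>)
qed

text \<open>Two left convolution inverses of \<Delta> are compared: on p \<otimes> q = \<Delta>(x)(1
  \<otimes> b) both products sum to \<epsilon>(x) \<Delta>(b), and such tensors span A \<otimes> A.
  The factor \<Delta>(q) is then cancelled by non-degeneracy.\<close>

lemma mSS_\<Delta>: "mSS (\<Delta> p) = \<Delta> (S p)"
proof (rule nondeg_hom_times_cancel[OF nondeg_\<Delta>])
  fix q
  have bl: "bilin (\<lambda>p q. mleft (mSS (\<Delta> p)) (mleft (\<Delta> q) w))" for w
    by (simp add: bilin_def clinear_iff \<Delta>_lin SS.mS_lin tensor_lin)
  have "tensor_lift (\<lambda>p q. mleft (mSS (\<Delta> p)) (mleft (\<Delta> q) w)) x = mleft (\<Delta> (S1 x)) w" for x w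
    by (induction x rule: c1_induct)
      (simp_all add: mSS_\<Delta>_times_\<Delta> slice_cover \<Delta>_lin tensor_lift_add tensor_lift_scaleC bl)
  from this[of _ "p \<otimes> q"] have "mleft (mSS (\<Delta> p) * \<Delta> q) w = mleft (\<Delta> (S p) * \<Delta> q) w" for w
    by (simp add: tensor_lift_tensor bl \<Delta>_times)
  then show "mSS (\<Delta> p) * \<Delta> q = \<Delta> (S p) * \<Delta> q" by (rule multiplier_eqI_left)
qed

lemma mext_\<Delta>_mS: "mext \<Delta> (mS m) = mSS (mext \<Delta> m)"
proof (rule nondeg_hom_times_cancel[OF nondeg_\<Delta>])
  fix a
  have "mext \<Delta> (mS m) * \<Delta> (S (inv S a)) = \<Delta> (S (mright m (inv S a)))"
    by (subst mext_times_gen[OF nondeg_\<Delta>]) (simp add: S.mleft_mS)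
  also have "\<dots> = mSS (mext \<Delta> m) * \<Delta> (S (inv S a))"
    unfolding mSS_\<Delta>[symmetric] SS.mS_times[symmetric] gen_times_mext[OF nondeg_\<Delta>] ..
  finally show "mext \<Delta> (mS m) * \<Delta> a = mSS (mext \<Delta> m) * \<Delta> a" by simp
qed

end

section \<open>The embedding of \<open>A \<otimes> M(A)\<close>\<close>

lemma tensor_lift_map: "bilin F \<Longrightarrow> tensor_lift F (tensor_map f g t) = tensor_lift (\<lambda>a b. F (f a) (g b)) t"
  unfolding tensor_map_def by (simp add: clinear_lift clinear_tensor_lift tensor_lift_tensor)

lemma bilin_half: "bilin (\<lambda>a m. mult_embed a \<otimes>\<^sub>M m)"
  by (simp add: bilin_def clinear_iff embed_add embed_scaleC mtensor_lin)

lemma clinear_half: "clinear half_embed"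
  unfolding half_embed_def by (rule clinear_tensor_lift[OF bilin_half])

lemma half_tensor [simp]: "half_embed (a \<otimes> m) = mult_embed a \<otimes>\<^sub>M m"
  unfolding half_embed_def by (rule tensor_lift_tensor[OF bilin_half])

lemmas half_lin = clinear_add[OF clinear_half] clinear_scaleC[OF clinear_half]
  clinear_diff[OF clinear_half]

lemma clinear_eval: "clinear (\<lambda>m. mleft m x)" "clinear (\<lambda>m. mright m x)"
  by (simp_all add: clinear_iff)

lemma mleft_half: "mleft (half_embed t) (a \<otimes> b) = tensor_lift (\<lambda>p m. (p * a) \<otimes> mleft m b) t"
proof -
  have bl: "bilin (\<lambda>p m. (p * a) \<otimes> mleft m b)"
    by (simp add: bilin_def clinear_iff tensor_lin)
  show ?thesis
    by (induction t rule: tensor_induct)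
      (simp_all add: half_lin tensor_lift_tensor tensor_lift_add tensor_lift_scaleC bl)
qed

lemma half_inject [simp]: "half_embed s = half_embed t \<longleftrightarrow> s = (t :: 'a::nondegenerate_algebra \<otimes> 'a multiplier)"
proof
  assume st: "half_embed s = half_embed t"
  have "s - t = 0"
  proof (rule tensor_joint_inj[where \<phi>="\<lambda>a p. p * a" and \<psi>="\<lambda>b m. mleft m b"])
    show "m = 0" if "\<And>b. mleft m b = 0" for m :: "'a multiplier"
      by (rule multiplier_eqI_left) (simp add: that)
    show "tensor_map (\<lambda>p. p * a) (\<lambda>m. mleft m b) (s - t) = 0" for a b
      unfolding tensor_map_def mleft_half[symmetric] half_lin st by simp
  qed (auto intro: nondegenerate_left simp: clinear_mult_right clinear_eval)
  then show "s = t" by simp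
qed simp

lemma unassoc:
  assumes "reassoc x = reassoc y"
  shows "x = (y :: 'a::complex_vector \<otimes> ('b::complex_vector \<otimes> 'c::complex_vector))"
proof -
  let ?U = "tensor_lift (\<lambda>x (c::'c). tensor_lift (\<lambda>(a::'a) (b::'b). a \<otimes> (b \<otimes> c)) x)"
  have bl1: "bilin (\<lambda>(a::'a) (b::'b). a \<otimes> (b \<otimes> c))" for c :: 'c
    by (simp add: bilin_def clinear_iff tensor_lin)
  have bl2: "bilin (\<lambda>x (c::'c). tensor_lift (\<lambda>(a::'a) (b::'b). a \<otimes> (b \<otimes> c)) x)"
    by (simp add: bilin_def clinear_iff tensor_lin tensor_lift_fun_add tensor_lift_fun_scaleC
        tensor_lift_add[OF bl1] tensor_lift_scaleC[OF bl1])
  have "?U (reassoc (a \<otimes> z)) = a \<otimes> z" for a z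
    by (induction z rule: tensor_induct) (simp_all add: tensor_lin reassoc_lin
        tensor_lift_add[OF bl2] tensor_lift_scaleC[OF bl2] tensor_lift_tensor bl1 bl2)
  then have "?U (reassoc x) = x" for x
    by (induction x rule: tensor_induct) (simp_all add: reassoc_lin
        tensor_lift_add[OF bl2] tensor_lift_scaleC[OF bl2])
  then show ?thesis by (metis assms)
qed

section \<open>Inverses of multipliers\<close>

lemma minverse_eq:
  assumes "x * y = 1" "y * x = 1"
  shows "minverse x = y"
  unfolding minverse_def
proof (rule the_equality)
  fix z assume "x * z = 1 \<and> z * x = 1"
  then show "z = y" using assms by (metis mult.assoc mult_1_left mult_1_right)
qed (simp add: assms)

lemma minverse: "minvertible x \<Longrightarrow> x * minverse x = 1" "minvertible x \<Longrightarrow> minverse x * x = 1"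
  unfolding minvertible_def using minverse_eq by blast+


text \<open>The inverses of the two actions are compatible: put the preimages of a and b into (x m)
  y = x (m y).\<close>

lemma minvertibleI:
  fixes m :: "'a::nondegenerate_algebra multiplier"
  assumes l: "bij (mleft m)" and r: "bij (mright m)"
  shows "minvertible m"
proof -
  let ?l = "inv (mleft m)" and ?r = "inv (mright m)"
  have l1: "mleft m (?l x) = x" "?l (mleft m x) = x" for x
    using l by (simp_all add: bij_def surj_f_inv_f)
  have r1: "mright m (?r x) = x" "?r (mright m x) = x" for x
    using r by (simp_all add: bij_def surj_f_inv_f)
  have li: "?l x = y" if "x = mleft m y" for x y using that l1 by simp
  have ri: "?r x = y" if "x = mright m y" for x y using that r1 by simp
  have "clinear ?l" "clinear ?r"
    unfolding clinear_iff by (intro conjI allI li; simp add: l1) (intro conjI allI ri; simp add: r1)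
  moreover have "?l (a * b) = ?l a * b" "?r (a * b) = a * ?r b" for a b
    by (rule li, simp add: mleft_mult l1) (rule ri, simp add: mright_mult r1)
  moreover have "?r a * b = a * ?l b" for a b
    using mright_mleft[of m "?r a" "?l b"] by (simp add: l1 r1)
  ultimately have im: "is_multiplier (?l, ?r)" by (simp add: is_multiplier_def)
  define n where "n = Abs_multiplier (?l, ?r)"
  have "mleft n = ?l" by (simp add: n_def mleft.rep_eq[of "Abs_multiplier _"] Abs_multiplier_inverse im)
  then have "m * n = 1" "n * m = 1"
    by (intro multiplier_eqI_left; simp add: l1)+
  then show ?thesis by (auto simp: minvertible_def)
qed


section \<open>The counit on multipliers\<close>

context regular_mha
begin

text \<open>The extension of \<epsilon> to M(A), independent of the chosen e. For A = 0 there is no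
  such e, and the value is 0 because \<epsilon> vanishes.\<close>

definition "\<epsilon>m m = \<epsilon> (mleft m (SOME e. \<epsilon> e = 1))"

lemma \<epsilon>_mleft: "\<epsilon> (mleft m a) = \<epsilon>m m * \<epsilon> a" and \<epsilon>_mright: "\<epsilon> (mright m a) = \<epsilon>m m * \<epsilon> a"
proof -
  have "\<epsilon> (mleft m a) = \<epsilon>m m * \<epsilon> a \<and> \<epsilon> (mright m a) = \<epsilon>m m * \<epsilon> a"
  proof (rule trivial_or_counit)
    assume *: "\<And>a b. a = (b::'a)"
    have "\<epsilon> b = 0" for b by (subst *[of b 0]) simp
    then show ?thesis by simp
  next
    fix e' assume "\<epsilon> e' = 1"
    define e where "e = (SOME e. \<epsilon> e = 1)"
    have e: "\<epsilon> e = 1" unfolding e_def by (rule someI[of _ e']) fact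
    have 1: "\<epsilon> (mleft m b) = \<epsilon> (mright m e) * \<epsilon> b" for b
      using arg_cong[OF mright_mleft[of m e b], of \<epsilon>] by (simp add: \<epsilon>_times e)
    have 2: "\<epsilon> (mright m b) = \<epsilon> b * \<epsilon> (mleft m e)" for b
      using arg_cong[OF mright_mleft[of m b e], of \<epsilon>] by (simp add: \<epsilon>_times e)
    show ?thesis using 1[of a] 1[of e] 2[of a] by (simp add: \<epsilon>m_def e flip: e_def)
  qed
  then show "\<epsilon> (mleft m a) = \<epsilon>m m * \<epsilon> a" "\<epsilon> (mright m a) = \<epsilon>m m * \<epsilon> a" by auto
qed

text \<open>The covered form of m1 S(m2) = \<epsilon>(m) for a multiplier m. On tensors b
  \<Delta>(a) it follows from \<Delta>(a) \<Delta>(m) = \<Delta>(a m) and the identity in A.\<close>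

lemma S2_m\<Delta>: "S2 (mright (mext \<Delta> m) x) = \<epsilon>m m *\<^sub>C S2 x"
proof (induction x rule: \<Delta>_right_induct)
  case (gen a b)
  have "mright (mext \<Delta> m) (mright (\<Delta> a) b) = mright (\<Delta> (mright m a)) b"
    by (simp flip: mright_times gen_times_mext[OF nondeg_\<Delta>])
  then show ?case by (simp add: S2_\<Delta> \<epsilon>_mright)
qed (simp_all add: scaleC_add_right mult.commute)

lemma \<epsilon>1_m\<Delta>: "\<epsilon>1 (mleft (mext \<Delta> m) x) = mleft m (\<epsilon>1 x)"
proof (induction x rule: \<Delta>_left_induct)
  case (gen a b)
  have "mleft (mext \<Delta> m) (mleft (\<Delta> a) b) = mleft (\<Delta> (mleft m a)) b"
    by (simp flip: mleft_times mext_times_gen[OF nondeg_\<Delta>])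
  then show ?case by (simp add: \<epsilon>1_\<Delta> mleft_mult)
qed simp_all

end

locale quasitriangular = regular_mha +
  fixes R :: "('a \<otimes> 'a) multiplier"
  assumes R: "generalized_R_matrix \<Delta> R"
begin

section \<open>Coordinates of the R-matrix\<close>

definition "Ri = minverse R"

lemma R_Ri [simp]: "R * Ri = 1" and Ri_R [simp]: "Ri * R = 1"
  using R minverse[of R] by (auto simp: Ri_def generalized_R_matrix_def)

lemma R_Ri' [simp]: "R * (Ri * x) = x" and Ri_R' [simp]: "Ri * (R * x) = x"
  by (simp_all flip: mult.assoc)

lemma mleft_R_Ri [simp]: "mleft R (mleft Ri x) = x" "mleft Ri (mleft R x) = x"
  by (simp_all flip: mleft_times)

lemma R_\<Delta>: "R * \<Delta> a = cop \<Delta> a * R"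
  and D12_R: "D12 R = leg13 R * leg23 R" and D23_R: "D23 R = leg13 R * leg12 R"
  using R by (auto simp: generalized_R_matrix_def D12_def D23_def)

text \<open>The membership condition on \<open>R\<close> provides these tensors in A \<otimes> M(A),
  and injectivity of \<open>half_embed\<close> makes them unique. They hold the first leg of
  \<open>R\<close> covered on the right, respectively on the left.\<close>

definition "lam a = inv half_embed (R * (E a \<otimes>\<^sub>M 1))"
definition "rho a = inv half_embed ((E a \<otimes>\<^sub>M 1) * R)"

lemma half_lam: "half_embed (lam a) = R * (E a \<otimes>\<^sub>M 1)"
  and half_rho: "half_embed (rho a) = (E a \<otimes>\<^sub>M 1) * R"
  using R by (auto simp: generalized_R_matrix_def lam_def rho_def f_inv_into_f)

lemma clinear_lam: "clinear lam"
  unfolding clinear_iff by (intro conjI allI; rule half_inject[THEN iffD1];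
    simp only: half_lam half_lin embed_lin mtensor_lin)

lemmas lam_lin = clinear_add[OF clinear_lam] clinear_scaleC[OF clinear_lam]

lemma half_map_left: "half_embed (tensor_map (\<lambda>p. c * p) (\<lambda>m. m) t) = (E c \<otimes>\<^sub>M 1) * half_embed t"
  and half_map_right: "half_embed (tensor_map (\<lambda>p. p * c) (\<lambda>m. m) t) = half_embed t * (E c \<otimes>\<^sub>M 1)"
  by (induction t rule: tensor_induct; simp add: half_lin clinear_add[OF clinear_tensor_map]
      clinear_scaleC[OF clinear_tensor_map] clinear_id clinear_mult_left clinear_mult_right tensor_lin
      tensor_map_tensor embed_times mtensor_times)+

lemma lam_times: "lam (a * c) = tensor_map (\<lambda>p. p * c) (\<lambda>m. m) (lam a)"
  by (rule half_inject[THEN iffD1])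
    (simp add: half_lam half_map_right embed_times mtensor_times mult.assoc)

text \<open>Both sides are (c \<otimes> 1) R (a \<otimes> 1). This links the two ways of covering
  the first leg.\<close>

lemma lam_rho: "tensor_map (\<lambda>p. c * p) (\<lambda>m. m) (lam a) = tensor_map (\<lambda>p. p * a) (\<lambda>m. m) (rho c)"
  by (rule half_inject[THEN iffD1])
    (simp add: half_lam half_rho half_map_right half_map_left mult.assoc)

lemma E_half: "E (tensor_lift (\<lambda>p m. p \<otimes> mleft m b) t) = half_embed t * (1 \<otimes>\<^sub>M E b)"
  and E_half': "E (tensor_lift (\<lambda>p m. p \<otimes> mright m b) t) = (1 \<otimes>\<^sub>M E b) * half_embed t"
proof -
  have "bilin (\<lambda>p m. p \<otimes> mleft m b)" "bilin (\<lambda>p m. p \<otimes> mright m b)"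
    by (simp_all add: bilin_def clinear_iff tensor_lin)
  note bl = this
  show "E (tensor_lift (\<lambda>p m. p \<otimes> mleft m b) t) = half_embed t * (1 \<otimes>\<^sub>M E b)"
    "E (tensor_lift (\<lambda>p m. p \<otimes> mright m b) t) = (1 \<otimes>\<^sub>M E b) * half_embed t"
    by (induction t rule: tensor_induct; simp add: half_lin tensor_lift_tensor tensor_lift_add
      tensor_lift_scaleC bl embed_lin tensor_lin embed_tensor mtensor_times times_embed embed_times_mult)+
qed

lemma R_tensor: "mleft R (a \<otimes> b) = tensor_lift (\<lambda>p m. p \<otimes> mleft m b) (lam a)"
  by (rule embed_inject[THEN iffD1])
    (simp add: E_half half_lam mult.assoc mtensor_times embed_tensor flip: times_embed)

lemma R_tensor_right: "mright R (a \<otimes> b) = tensor_lift (\<lambda>p m. p \<otimes> mright m b) (rho a)"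
  by (rule embed_inject[THEN iffD1])
    (simp add: E_half' half_rho mtensor_times embed_tensor flip: embed_times_mult mult.assoc)

lemma leg12_tensor: "mleft (leg12 R) (x \<otimes> c) = mleft R x \<otimes> c"
  by (simp add: leg12_def)

lemma leg13_tensor: "mleft (leg13 R) (a \<otimes> b \<otimes> c) = tensor_lift (\<lambda>p m. p \<otimes> b \<otimes> mleft m c) (lam a)"
proof -
  have cl: "clinear (\<lambda>x. swap23 (x \<otimes> b))" by (simp add: clinear_iff tensor_lin swap23_lin)
  have "mleft (leg13 R) (swap23 (a \<otimes> c \<otimes> b)) = swap23 (mleft R (a \<otimes> c) \<otimes> b)"
    unfolding leg13_def mleft_mext_iso[OF nondeg_E3 clinear_swap23 swap23_times surj_swap23] by simp
  then show ?thesis by (simp add: R_tensor clinear_lift[OF cl])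
qed

lemma leg23_tensor: "mleft (leg23 R) (a \<otimes> b \<otimes> c) = tensor_lift (\<lambda>q n. a \<otimes> q \<otimes> mleft n c) (lam b)"
proof -
  have cl: "clinear (\<lambda>x. reassoc (a \<otimes> x))" by (simp add: clinear_iff tensor_lin reassoc_lin)
  have "mleft (leg23 R) (reassoc (a \<otimes> (b \<otimes> c))) = reassoc (a \<otimes> mleft R (b \<otimes> c))"
    unfolding leg23_def mext_reassoc by simp
  then show ?thesis by (simp add: R_tensor clinear_lift[OF cl])
qed

text \<open>\<open>Lam v\<close> is \<open>R\<^sup>1\<^sup>3 R\<^sup>2\<^sup>3 (v \<otimes> 1)\<close> as an element of \<open>(A \<otimes> A) \<otimes> M(A)\<close>.\<close>

definition "lam2 a b = tensor_lift (\<lambda>p m. tensor_lift (\<lambda>q n. p \<otimes> q \<otimes> (m * n)) (lam b)) (lam a)"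
definition "Lam = tensor_lift lam2"

lemma bilin_lam2: "bilin lam2"
proof -
  have 1: "bilin (\<lambda>q n. p \<otimes> q \<otimes> (m * n))" for p q :: 'a and m :: "'a multiplier"
    by (simp add: bilin_def clinear_iff tensor_lin)
  have 2: "bilin (\<lambda>p m. tensor_lift (\<lambda>q n. p \<otimes> q \<otimes> (m * n)) y)" for y :: "'a \<otimes> 'a multiplier"
    by (simp add: bilin_def clinear_iff tensor_lin tensor_lift_fun_add tensor_lift_fun_scaleC)
  show ?thesis
    unfolding lam2_def[abs_def]
    by (simp add: bilin_def clinear_iff lam_lin tensor_lift_add[OF 1] tensor_lift_scaleC[OF 1]
        tensor_lift_add[OF 2] tensor_lift_scaleC[OF 2] tensor_lift_fun_add tensor_lift_fun_scaleC)
qed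

lemma Lam_tensor: "Lam (a \<otimes> b) = lam2 a b"
  by (simp add: Lam_def tensor_lift_tensor bilin_lam2)

lemma clinear_Lam: "clinear Lam"
  unfolding Lam_def by (rule clinear_tensor_lift[OF bilin_lam2])

lemmas Lam_lin = clinear_add[OF clinear_Lam] clinear_scaleC[OF clinear_Lam]

definition ev :: "'a \<Rightarrow> 'b::complex_vector \<otimes> 'a multiplier \<Rightarrow> 'b \<otimes> 'a"
  where "ev y = tensor_map (\<lambda>x. x) (\<lambda>m. mleft m y)"

lemma clinear_ev: "clinear (ev y)" and ev_tensor [simp]: "ev y (x \<otimes> m) = x \<otimes> mleft m y"
  by (simp_all add: ev_def clinear_tensor_map tensor_map_tensor clinear_id clinear_eval)

lemmas ev_lin = clinear_add[OF clinear_ev] clinear_scaleC[OF clinear_ev]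

lemma ev_eqI: "(\<And>y. ev y s = ev y t) \<Longrightarrow> s = t"
  unfolding ev_def
  by (rule tensor_eqI_right[where \<psi>="\<lambda>y m. mleft m y"])
    (auto simp: clinear_eval intro: multiplier_eqI_left)

lemma legs_Lam: "mleft (leg13 R * leg23 R) (v \<otimes> y) = ev y (Lam v)"
proof (induction v rule: tensor_induct)
  case (tensor a b)
  show ?case
    by (simp add: leg23_tensor clinear_lift[OF clinear_mleft] leg13_tensor Lam_tensor lam2_def
        clinear_lift[OF clinear_ev]) (rule tensor_lift_swap)
qed (simp_all add: Lam_lin ev_lin tensor_lin)

lemma D12_half: "D12 (half_embed t) = tensor_lift (\<lambda>p m. \<Delta> p \<otimes>\<^sub>M m) t"
proof -
  have bl: "bilin (\<lambda>p m. \<Delta> p \<otimes>\<^sub>M m)" by (simp add: bilin_def clinear_iff \<Delta>_lin mtensor_lin)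
  show ?thesis
    by (induction t rule: tensor_induct)
      (simp_all add: half_lin D_lin tensor_lift_add tensor_lift_scaleC tensor_lift_tensor bl
        D12_mtensor m\<Delta>_embed)
qed

text \<open>The formula for (\<Delta> \<otimes> \<iota>)(R) multiplied on the right by \<Delta>(z)
  \<otimes> 1, so that the first two legs are elements of A \<otimes> A and the third stays a
  multiplier.\<close>

lemma Lam_\<Delta>: "Lam (mleft (\<Delta> z) w) = tensor_lift (\<lambda>p m. mleft (\<Delta> p) w \<otimes> m) (lam z)"
proof (rule ev_eqI)
  fix y
  have "ev y (Lam (mleft (\<Delta> z) w)) = mleft (D12 R * (\<Delta> z \<otimes>\<^sub>M 1)) (w \<otimes> y)"
    by (simp add: D12_R flip: legs_Lam)
  also have "D12 R * (\<Delta> z \<otimes>\<^sub>M 1) = D12 (R * (E z \<otimes>\<^sub>M 1))"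
    by (simp add: D12_times D12_mtensor m\<Delta>_embed)
  also have "mleft \<dots> (w \<otimes> y) = ev y (tensor_lift (\<lambda>p m. mleft (\<Delta> p) w \<otimes> m) (lam z))"
    by (simp add: clinear_lift[OF clinear_eval(1)] clinear_lift[OF clinear_ev] D12_half flip: half_lam)
  finally show "ev y (Lam (mleft (\<Delta> z) w)) = ev y (tensor_lift (\<lambda>p m. mleft (\<Delta> p) w \<otimes> m) (lam z))" .
qed

lemma D23_half: "D23 (half_embed t) * ra (1 \<otimes>\<^sub>M E w)
  = E (reassoc (tensor_lift (\<lambda>p m. p \<otimes> mleft (mext \<Delta> m) w) t))"
proof -
  note m\<Delta>_lin = clinear_add[OF clinear_m\<Delta>] clinear_scaleC[OF clinear_m\<Delta>]
  have bl: "bilin (\<lambda>p m. p \<otimes> mleft (mext \<Delta> m) w)"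
    by (simp add: bilin_def clinear_iff m\<Delta>_lin mtensor_lin)
  show ?thesis
    by (induction t rule: tensor_induct)
      (simp_all add: half_lin D_lin tensor_lift_add tensor_lift_scaleC tensor_lift_tensor bl
        D23_mtensor tensor_lin reassoc_lin embed_lin,
       simp add: mtensor_times times_embed embed_tensor flip: ra_embed ra_times)
qed

text \<open>The formula for (\<iota> \<otimes> \<Delta>)(R) multiplied by a \<otimes> 1 \<otimes> 1;
  in R13 R12 the factor R12 acts first, hence is the outer sum. The coproduct of a second leg is
  thereby replaced by terms m \<otimes> m', which is what allows Sweedler computations with
  it.\<close>

lemma lam_m\<Delta>: "tensor_lift (\<lambda>p m. p \<otimes> mext \<Delta> m) (lam a)
  = tensor_lift (\<lambda>p m. tensor_lift (\<lambda>p' m'. p' \<otimes> (m \<otimes>\<^sub>M m')) (lam p)) (lam a)" (is "?l = ?r")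
proof (rule tensor_eqI_right[where \<psi>="\<lambda>(b, c) z. mleft z (b \<otimes> c)"])
  show "clinear ((\<lambda>(b, c) z. mleft z (b \<otimes> c)) j)" for j :: "'a \<times> 'a"
    by (simp add: case_prod_unfold clinear_eval)
  show "z = 0" if "\<And>j. (\<lambda>(b, c) z. mleft z (b \<otimes> c)) j z = 0" for z :: "('a \<otimes> 'a) multiplier"
  proof (rule multiplier_eqI_left)
    have "mleft z (b \<otimes> c) = 0" for b c using that[of "(b, c)"] by simp
    then show "mleft z x = mleft 0 x" for x
      by (induction x rule: tensor_induct) simp_all
  qed
  fix j :: "'a \<times> 'a"
  obtain b c where j: "j = (b, c)" by fastforce
  let ?t = "tensor_map (\<lambda>x. x) (\<lambda>z. mleft z (b \<otimes> c))"
  have t: "clinear ?t" by (simp add: clinear_tensor_map clinear_id clinear_eval)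
  have "E (reassoc (?t ?l)) = D23 (R * (E a \<otimes>\<^sub>M 1)) * ra (1 \<otimes>\<^sub>M E (b \<otimes> c))"
    by (simp add: clinear_lift[OF t] tensor_map_tensor clinear_id clinear_eval D23_half flip: half_lam)
  also have "\<dots> = D23 R * E (a \<otimes> b \<otimes> c)"
    by (simp add: D23_times D23_left mult.assoc embed_tensor ra_mtensor mtensor_times)
  also have "\<dots> = E (mleft (leg13 R) (mleft (leg12 R) (a \<otimes> b \<otimes> c)))"
    by (simp add: D23_R times_embed)
  also have "mleft (leg13 R) (mleft (leg12 R) (a \<otimes> b \<otimes> c)) =
      tensor_lift (\<lambda>p m. tensor_lift (\<lambda>p' m'. p' \<otimes> mleft m b \<otimes> mleft m' c) (lam p)) (lam a)"
  proof -
    have cl: "clinear (\<lambda>x. mleft (leg13 R) (x \<otimes> c))" by (simp add: clinear_iff tensor_lin)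
    show ?thesis by (simp add: leg12_tensor R_tensor clinear_lift[OF cl] leg13_tensor)
  qed
  also have "\<dots> = reassoc (?t ?r)"
    by (simp add: clinear_lift[OF t] clinear_lift[OF clinear_reassoc] tensor_map_tensor
        clinear_id clinear_eval)
  finally have "?t ?l = ?t ?r" by (intro unassoc) simp
  then show "tensor_map (\<lambda>x. x) ((\<lambda>(b, c) z. mleft z (b \<otimes> c)) j) ?l
      = tensor_map (\<lambda>x. x) ((\<lambda>(b, c) z. mleft z (b \<otimes> c)) j) ?r"
    by (simp add: j)
qed


section \<open>Counit and antipode on the legs of the R-matrix\<close>

lemma \<epsilon>m_lin [simp]: "\<epsilon>m (m + n) = \<epsilon>m m + \<epsilon>m n" "\<epsilon>m (c *\<^sub>C m) = c * \<epsilon>m m"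
  by (simp_all add: \<epsilon>m_def)

lemma trivial_multiplier: "(\<And>a b. a = (b::'a)) \<Longrightarrow> m = (n::'a multiplier)"
  by (rule multiplier_eqI_left)

text \<open>Applying \<epsilon> to the first leg of (\<Delta> \<otimes> \<iota>)(R) = R13 R23 gives
  R = (1 \<otimes> e0) R with e0 = (\<epsilon> \<otimes> \<iota>)(R), and R is invertible.\<close>

lemma counit_lam: "tensor_lift (\<lambda>p m. \<epsilon> p *\<^sub>C m) (lam z) = \<epsilon> z *\<^sub>C 1"
proof (rule trivial_or_counit)
  fix u assume u: "\<epsilon> u = 1"
  let ?F = "\<lambda>p (m::'a multiplier). \<epsilon> p *\<^sub>C m"
  define e where "e b = tensor_lift ?F (lam b)" for b
  \<comment> \<open>Covering by an element of counit 1 leaves the slice unchanged; comparison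
    through \<open>lam_rho\<close> then gives e(b) = \<epsilon>(b) e0 for all b.\<close>
  define e0 where "e0 = tensor_lift ?F (rho u)"
  have blF: "bilin ?F"
    by (simp add: bilin_def clinear_iff scaleC_add_left scaleC_add_right mult.commute)
  have fold: "(\<lambda>p m. \<epsilon> (c * p) *\<^sub>C m) = (\<lambda>p (m::'a multiplier). \<epsilon> c *\<^sub>C (\<epsilon> p *\<^sub>C m))"
    "(\<lambda>p m. \<epsilon> (p * c) *\<^sub>C m) = (\<lambda>p (m::'a multiplier). \<epsilon> c *\<^sub>C (\<epsilon> p *\<^sub>C m))" for c
    by (simp_all add: \<epsilon>_times fun_eq_iff mult.commute)
  have e: "e b = \<epsilon> b *\<^sub>C e0" for b
    using arg_cong[OF lam_rho[of u b], of "tensor_lift ?F"]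
    unfolding tensor_lift_map[OF blF] fold tensor_lift_fun_scaleC e_def e0_def by (simp add: u)
  define K where "K = tensor_map \<epsilon>1 (\<lambda>x::'a. x)"
  have cl: "clinear \<epsilon>1" by (simp add: clinear_iff)
  have K: "clinear K" and K_tensor: "K (x \<otimes> y) = \<epsilon>1 x \<otimes> y" for x y
    by (simp_all add: K_def clinear_tensor_map tensor_map_tensor cl clinear_id)
  note KL = clinear_add[OF K] clinear_scaleC[OF K]
  have "K (ev y (Lam v)) = mleft (1 \<otimes>\<^sub>M e0) (mleft R (\<epsilon>1 v \<otimes> y))" for v y
  proof (induction v rule: tensor_induct)
    case (tensor a b)
    have "K (ev y (Lam (a \<otimes> b)))
        = tensor_lift (\<lambda>q n. tensor_lift (\<lambda>p m. (\<epsilon> p *\<^sub>C q) \<otimes> mleft m (mleft n y)) (lam a)) (lam b)"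
      by (subst tensor_lift_swap)
        (simp add: Lam_tensor lam2_def clinear_lift[OF clinear_ev] clinear_lift[OF K] K_tensor)
    also have "\<dots> = tensor_lift (\<lambda>q n. q \<otimes> mleft (e a) (mleft n y)) (lam b)"
    proof -
      have cl: "clinear (\<lambda>z. q \<otimes> mleft z (mleft n y))" for q :: 'a and n
        by (simp add: clinear_iff tensor_lin)
      show ?thesis by (simp add: e_def clinear_lift[OF cl] tensor_lin)
    qed
    also have "\<dots> = mleft (1 \<otimes>\<^sub>M e0) (mleft R (\<epsilon>1 (a \<otimes> b) \<otimes> y))"
      by (simp add: e tensor_lin R_tensor clinear_lift[OF clinear_mleft] tensor_lift_fun_scaleC)
    finally show ?case .
  qed (simp_all add: Lam_lin ev_lin KL tensor_lin)
  moreover have "K (ev y (Lam (mleft (\<Delta> z) w))) = mleft R ((z * \<epsilon>1 w) \<otimes> y)" for y z w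
  proof -
    have bl: "bilin (\<lambda>p m. p \<otimes> mleft m y)" by (simp add: bilin_def clinear_iff tensor_lin)
    show ?thesis
      by (simp add: Lam_\<Delta> clinear_lift[OF clinear_ev] clinear_lift[OF K] K_tensor \<epsilon>1_\<Delta> R_tensor
          lam_times tensor_lift_map bl)
  qed
  ultimately have *: "mleft R ((z * \<epsilon>1 w) \<otimes> y) = mleft (1 \<otimes>\<^sub>M e0) (mleft R ((z * \<epsilon>1 w) \<otimes> y))" for z w y
    by (metis \<epsilon>1_\<Delta>)
  have "mleft R (a \<otimes> y) = mleft (1 \<otimes>\<^sub>M e0) (mleft R (a \<otimes> y))" for a y
  proof (induction a rule: times_induct)
    case (gen a b)
    show ?case using *[of a "u \<otimes> b" y] by (simp add: u)
  qed (simp_all add: tensor_lin)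
  then have "mleft R x = mleft (1 \<otimes>\<^sub>M e0) (mleft R x)" for x
    by (rule tensor_linear_eqI[of "mleft R" "\<lambda>x. mleft (1 \<otimes>\<^sub>M e0) (mleft R x)", rotated 2])
      (simp_all add: clinear_iff)
  from this[of "mleft Ri (u \<otimes> b)" for b] have "u \<otimes> b = u \<otimes> mleft e0 b" for b by simp
  then have "\<epsilon>1 (u \<otimes> b) = \<epsilon>1 (u \<otimes> mleft e0 b)" for b by metis
  then have "e0 = 1" by (intro multiplier_eqI_left) (simp add: u)
  then show ?thesis using e[of z] by (simp add: e_def)
qed (rule trivial_multiplier)

text \<open>Applying \<epsilon> to the first of the two legs in \<open>lam_m\<Delta>\<close> gives
  R(a \<otimes> u) = R(a' \<otimes> u), where a' is the sum in question. Invertibility of R yields a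
  = a'.\<close>

lemma counit_lam_right: "tensor_lift (\<lambda>p m. \<epsilon>m m *\<^sub>C p) (lam a) = a"
proof (rule trivial_or_counit)
  fix u assume u: "\<epsilon> u = 1"
  let ?a = "tensor_lift (\<lambda>p m. \<epsilon>m m *\<^sub>C p) (lam a)"
  have "mleft R (a \<otimes> u) = mleft R (?a \<otimes> u)"
  proof -
    let ?K = "tensor_map (\<lambda>x::'a. x) (\<lambda>z. \<epsilon>1 (mleft z (u \<otimes> u)))"
    have cl: "clinear (\<lambda>z. \<epsilon>1 (mleft z (u \<otimes> u)))" by (simp add: clinear_iff)
    then have K: "clinear ?K" and Kt: "?K (p \<otimes> z) = p \<otimes> \<epsilon>1 (mleft z (u \<otimes> u))" for p z
      by (simp_all add: clinear_tensor_map tensor_map_tensor clinear_id)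
    have cl2: "clinear (\<lambda>x. mleft R (x \<otimes> u))" by (simp add: clinear_iff tensor_lin)
    have "mleft R (?a \<otimes> u) = tensor_lift (\<lambda>p m. \<epsilon>m m *\<^sub>C mleft R (p \<otimes> u)) (lam a)"
      by (simp only: clinear_lift[OF cl2] tensor_scaleC_left mleft_lin)
    then show ?thesis
      using arg_cong[OF lam_m\<Delta>[of a], of ?K]
      by (simp add: clinear_lift[OF K] Kt \<epsilon>1_m\<Delta> u tensor_lin
          \<epsilon>_mleft R_tensor[of _ u] tensor_lift_fun_scaleC)
  qed
  then have "mleft Ri (mleft R (a \<otimes> u)) = mleft Ri (mleft R (?a \<otimes> u))" by (rule arg_cong)
  then have "\<epsilon>2 (a \<otimes> u) = \<epsilon>2 (?a \<otimes> u)" unfolding mleft_R_Ri by (rule arg_cong)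
  then show ?thesis by (simp add: u)
qed

text \<open>The cancellation \<open>\<Sum> m\<^sub>(\<^sub>1\<^sub>) S(m\<^sub>(\<^sub>2\<^sub>)) = \<epsilon>(m)\<close> for the second legs \<open>m\<close> of \<open>R\<close>.\<close>

lemma lam_cancel:
  "tensor_lift (\<lambda>p m. tensor_lift (\<lambda>p' m'. p' \<otimes> (m * mS m')) (lam p)) (lam a) = a \<otimes> 1"
proof (rule tensor_eqI_right[where \<psi>="\<lambda>(b, c) k. b * mleft k (S c)"])
  show "clinear ((\<lambda>(b, c) k. b * mleft k (S c)) j)" for j :: "'a \<times> 'a"
    by (simp add: case_prod_unfold clinear_iff tensor_lin)
  show "k = 0" if "\<And>j. (\<lambda>(b, c) k. b * mleft k (S c)) j k = 0" for k :: "'a multiplier"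
  proof (rule multiplier_eqI_left)
    fix c
    have "b * mleft k (S (inv S c)) = 0" for b using that[of "(b, inv S c)"] by simp
    then have *: "b * mleft k c = 0" for b by simp
    have "mleft k c = 0" by (rule nondegenerate_right) (rule *)
    then show "mleft k c = mleft 0 c" by simp
  qed
  fix j :: "'a \<times> 'a"
  obtain b c where j: "j = (b, c)" by fastforce
  let ?T = "tensor_map (\<lambda>x::'a. x) (\<lambda>k. b * mleft k (S c))"
  \<comment> \<open>\<open>S2\<close> sends (b \<otimes> c)(m \<otimes> m') to b m S(c m') = b m
    S(m') S(c), which explains the factor S(c) in the test maps.\<close>
  let ?K = "tensor_map (\<lambda>x::'a. x) (\<lambda>z. S2 (mright z (b \<otimes> c)))"
  have "clinear (\<lambda>k. b * mleft k (S c))" by (simp add: clinear_iff tensor_lin)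
  then have T: "clinear ?T" and Tt: "?T (p \<otimes> k) = p \<otimes> (b * mleft k (S c))" for p k
    by (simp_all add: clinear_tensor_map tensor_map_tensor clinear_id)
  have "clinear (\<lambda>z. S2 (mright z (b \<otimes> c)))" by (simp add: clinear_iff)
  then have K: "clinear ?K" and Kt: "?K (p \<otimes> z) = p \<otimes> S2 (mright z (b \<otimes> c))" for p z
    by (simp_all add: clinear_tensor_map tensor_map_tensor clinear_id)
  have cl: "clinear (\<lambda>x::'a. x \<otimes> (b * S c))" by (simp add: clinear_iff tensor_lin)
  have "a \<otimes> (b * S c) = tensor_lift (\<lambda>p m. \<epsilon>m m *\<^sub>C p) (lam a) \<otimes> (b * S c)"
    by (simp add: counit_lam_right)
  also have "\<dots> = ?K (tensor_lift (\<lambda>p m. p \<otimes> mext \<Delta> m) (lam a))"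
    by (simp add: clinear_lift[OF K] clinear_lift[OF cl] Kt S2_m\<Delta> tensor_lin)
  also have "\<dots> = ?T (tensor_lift (\<lambda>p m. tensor_lift (\<lambda>p' m'. p' \<otimes> (m * mS m')) (lam p)) (lam a))"
    unfolding lam_m\<Delta> by (simp add: clinear_lift[OF K] clinear_lift[OF T] Kt Tt S.mleft_mS mright_mleft)
  finally show "tensor_map (\<lambda>x. x) ((\<lambda>(b, c) k. b * mleft k (S c)) j)
      (tensor_lift (\<lambda>p m. tensor_lift (\<lambda>p' m'. p' \<otimes> (m * mS m')) (lam p)) (lam a))
    = tensor_map (\<lambda>x. x) ((\<lambda>(b, c) k. b * mleft k (S c)) j) (a \<otimes> 1)"
    by (simp add: j Tt)
qed

abbreviation mS' :: "'a multiplier \<Rightarrow> 'a multiplier" where "mS' \<equiv> mext_anti (inv S)"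

lemmas mS'_times = anti_aut.mS_times[OF S.anti_aut_inv]
  and clinear_mS' = anti_aut.clinear_mS[OF S.anti_aut_inv]
  and mS'_one = anti_aut.mS_one[OF S.anti_aut_inv]

text \<open>Multiplying (\<iota> \<otimes> S^-1)(R) by R on the left produces second legs m' S^-1(m)
  = S^-1(m S(m')), which \<open>lam_cancel\<close> reduces to 1. A right inverse of the invertible R
  is its inverse.\<close>

lemma half_Ri: "half_embed (tensor_map (\<lambda>p. p) mS' (lam a)) = Ri * (E a \<otimes>\<^sub>M 1)"
proof -
  have "R * half_embed (tensor_map (\<lambda>p. p) mS' (lam a)) = E a \<otimes>\<^sub>M 1" (is "R * half_embed ?t = _")
  proof (rule multiplier_eqI_left)
    fix z
    have "mleft R (mleft (half_embed ?t) (x \<otimes> y)) = (a * x) \<otimes> y" for x y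
    proof -
      have bl: "bilin (\<lambda>p m. (p * x) \<otimes> mleft m y)" by (simp add: bilin_def clinear_iff tensor_lin)
      let ?K = "tensor_lift (\<lambda>p k. (p * x) \<otimes> mleft (mS' k) y)"
      have blK: "bilin (\<lambda>p k. (p * x) \<otimes> mleft (mS' k) y)"
        by (simp add: bilin_def clinear_iff tensor_lin clinear_add[OF clinear_mS']
            clinear_scaleC[OF clinear_mS'])
      note K = clinear_tensor_lift[OF blK]
      have bl2: "bilin (\<lambda>p m. p \<otimes> mleft m y)" for y :: 'a by (simp add: bilin_def clinear_iff tensor_lin)
      have "mleft R (mleft (half_embed ?t) (x \<otimes> y))
          = tensor_lift (\<lambda>p m. tensor_lift (\<lambda>p' m'. (p' * x) \<otimes> mleft m' (mleft (mS' m) y)) (lam p)) (lam a)"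
        by (simp add: mleft_half tensor_lift_map bl clinear_lift[OF clinear_mleft] R_tensor lam_times bl2)
      also have "\<dots> = ?K (tensor_lift (\<lambda>p m. tensor_lift (\<lambda>p' m'. p' \<otimes> (m * mS m')) (lam p)) (lam a))"
        by (simp add: clinear_lift[OF K] tensor_lift_tensor blK mS'_times)
      finally show ?thesis by (simp add: lam_cancel tensor_lift_tensor blK mS'_one)
    qed
    then show "mleft (R * half_embed ?t) z = mleft (E a \<otimes>\<^sub>M 1) z"
      by (induction z rule: tensor_induct) simp_all
  qed
  then have "Ri * (R * half_embed (tensor_map (\<lambda>p. p) mS' (lam a))) = Ri * (E a \<otimes>\<^sub>M 1)" by simp
  then show ?thesis by simp
qed

lemma Ri_tensor: "mleft Ri (a \<otimes> b) = tensor_lift (\<lambda>p m. p \<otimes> mleft (mS' m) b) (lam a)"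
proof (rule embed_inject[THEN iffD1])
  have bl: "bilin (\<lambda>p m. p \<otimes> mleft m b)" by (simp add: bilin_def clinear_iff tensor_lin)
  have "E (mleft Ri (a \<otimes> b)) = half_embed (tensor_map (\<lambda>p. p) mS' (lam a)) * (1 \<otimes>\<^sub>M E b)"
    by (simp add: half_Ri mult.assoc mtensor_times embed_tensor flip: times_embed)
  then show "E (mleft Ri (a \<otimes> b)) = E (tensor_lift (\<lambda>p m. p \<otimes> mleft (mS' m) b) (lam a))"
    by (simp add: tensor_lift_map bl flip: E_half)
qed

text \<open>Applying S(x1) x2 = \<epsilon>(x) to the first two legs of (\<Delta> \<otimes>
  \<iota>)(R) = R13 R23 gives (S \<otimes> \<iota>)(R) R = 1. The cover b on the right becomes S(b)
  on the left.\<close>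

lemma half_S_lam: "half_embed (tensor_map S (\<lambda>m. m) (lam b)) = (E (S b) \<otimes>\<^sub>M 1) * Ri"
proof -
  define K where "K = tensor_map S1 (\<lambda>x::'a. x)"
  have cl: "clinear S1" by (simp add: clinear_iff)
  have K: "clinear K" and K_tensor: "K (x \<otimes> y) = S1 x \<otimes> y" for x y
    by (simp_all add: K_def clinear_tensor_map tensor_map_tensor cl clinear_id)
  note KL = clinear_add[OF K] clinear_scaleC[OF K]
  have KLam: "K (ev y (Lam v)) = S1 v \<otimes> y" for v y
  proof (induction v rule: \<Delta>_left_induct)
    case (gen z w)
    have cl: "clinear (\<lambda>m. S1 w \<otimes> mleft m y)" by (simp add: clinear_iff tensor_lin)
    have "K (ev y (Lam (mleft (\<Delta> z) w))) = S1 w \<otimes> mleft (tensor_lift (\<lambda>p m. \<epsilon> p *\<^sub>C m) (lam z)) y"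
      by (simp add: Lam_\<Delta> clinear_lift[OF clinear_ev] clinear_lift[OF K] K_tensor S1_\<Delta>
          clinear_lift[OF cl] tensor_lin)
    then show ?case by (simp add: counit_lam S1_\<Delta> tensor_lin)
  qed (simp_all add: Lam_lin ev_lin KL tensor_lin)
  have "half_embed (tensor_map S (\<lambda>m. m) (lam b)) * R = E (S b) \<otimes>\<^sub>M 1" (is "half_embed ?t * R = _")
  proof (rule multiplier_eqI_left)
    fix z
    have "mleft (half_embed ?t) (mleft R (x \<otimes> y)) = (S b * x) \<otimes> y" for x y
    proof -
      have bl: "bilin (\<lambda>p m. (p * a) \<otimes> mleft m c)" for a c :: 'a
        by (simp add: bilin_def clinear_iff tensor_lin)
      have "mleft (half_embed ?t) (mleft R (x \<otimes> y)) = K (ev y (Lam (b \<otimes> x)))"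
        by (simp add: R_tensor clinear_lift[OF clinear_mleft] mleft_half tensor_lift_map bl
            Lam_tensor lam2_def clinear_lift[OF clinear_ev] clinear_lift[OF K] K_tensor)
          (rule tensor_lift_swap)
      then show ?thesis by (simp add: KLam)
    qed
    then show "mleft (half_embed ?t * R) z = mleft (E (S b) \<otimes>\<^sub>M 1) z"
      by (induction z rule: tensor_induct) simp_all
  qed
  then have "half_embed (tensor_map S (\<lambda>m. m) (lam b)) * R * Ri = (E (S b) \<otimes>\<^sub>M 1) * Ri" by simp
  then show ?thesis by (simp add: mult.assoc)
qed

lemma cancel_left_leg:
  assumes "\<And>a. X * (E a \<otimes>\<^sub>M 1) = Y * (E a \<otimes>\<^sub>M 1)"
  shows "X = (Y :: ('a \<otimes> 'a) multiplier)"
proof (rule multiplier_eqI_left)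
  have *: "mleft X (mleft (E a \<otimes>\<^sub>M 1) z) = mleft Y (mleft (E a \<otimes>\<^sub>M 1) z)" for a z
    using assms by (metis mleft_times)
  have "mleft X (a \<otimes> b) = mleft Y (a \<otimes> b)" for a b
  proof (induction a rule: times_induct)
    case (gen a c)
    show ?case using *[of a "c \<otimes> b"] by simp
  qed (simp_all add: tensor_lin)
  then show "mleft X z = mleft Y z" for z
    by (induction z rule: tensor_induct) simp_all
qed

text \<open>The left-covered companion of \<open>half_Ri\<close>: after a second cover a on the
  other side, \<open>lam_rho\<close> reduces one to the other.\<close>

lemma half_Ri_rho: "half_embed (tensor_map (\<lambda>p. p) mS' (rho c)) = (E c \<otimes>\<^sub>M 1) * Ri"
proof (rule cancel_left_leg)
  fix a
  have comp: "tensor_map f (\<lambda>m. m) (tensor_map (\<lambda>p. p) mS' t)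
      = tensor_map (\<lambda>p. p) mS' (tensor_map f (\<lambda>m. m) t)" if "clinear f" for f :: "'a \<Rightarrow> 'a" and t
    by (induction t rule: tensor_induct) (simp_all add: that tensor_map_tensor clinear_id clinear_mS'
        clinear_add[OF clinear_tensor_map] clinear_scaleC[OF clinear_tensor_map])
  show "half_embed (tensor_map (\<lambda>p. p) mS' (rho c)) * (E a \<otimes>\<^sub>M 1) = (E c \<otimes>\<^sub>M 1) * Ri * (E a \<otimes>\<^sub>M 1)"
    by (simp add: half_map_right[symmetric] comp clinear_mult_right lam_rho[symmetric])
      (simp add: comp[symmetric] clinear_mult_left half_map_left half_Ri mult.assoc)
qed

text \<open>By \<open>half_S_lam\<close> and \<open>half_Ri_rho\<close>, the multiplier (S(b)
  \<otimes> 1) R^-1 has two descriptions. Applying S to their second legs gives (S \<otimes> S)(R) =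
  R in covered form.\<close>

lemma rho_S: "rho (S b) = tensor_map S mS (lam b)"
proof -
  have comp: "tensor_map (\<lambda>p. p) mS (tensor_map (\<lambda>p. p) mS' t) = t"
    "tensor_map (\<lambda>p. p) mS (tensor_map S (\<lambda>m. m) t) = tensor_map S mS t" for t
    by (induction t rule: tensor_induct; simp add: tensor_map_tensor clinear_id clinear_mS'
        S.clinear_mS clinear_S clinear_add[OF clinear_tensor_map] clinear_scaleC[OF clinear_tensor_map])+
  have "tensor_map S (\<lambda>m. m) (lam b) = tensor_map (\<lambda>p. p) mS' (rho (S b))"
    by (rule half_inject[THEN iffD1]) (simp add: half_S_lam half_Ri_rho)
  then show ?thesis by (metis comp)
qed

lemma mSS_R: "mSS R = mext_iso flip R"
proof (rule multiplier_eqI_right)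
  fix x
  have "mright (mSS R) (SS y) = mright (mext_iso flip R) (SS y)" for y
  proof (induction y rule: tensor_induct)
    case (tensor a b)
    have bl: "bilin (\<lambda>p m. p \<otimes> mright m (S b))" by (simp add: bilin_def clinear_iff tensor_lin)
    show ?case
      by (simp add: SS.mright_mS mright_mext_flip R_tensor R_tensor_right rho_S tensor_lift_map bl
          clinear_lift[OF clinear_SS] clinear_lift[OF clinear_flip] S.mright_mS del: SS_tensor)
        (simp add: R_tensor R_tensor_right rho_S tensor_lift_map bl
          clinear_lift[OF clinear_SS] clinear_lift[OF clinear_flip] S.mright_mS)
  qed (simp_all add: SS_lin)
  from this[of "inv SS x"] show "mright (mSS R) x = mright (mext_iso flip R) x" by simp
qed


section \<open>The Drinfeld multiplier\<close>

text \<open>The left action of u. The matching right action is only available after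
  \<open>L_times\<close>.\<close>

definition "L a = tensor_lift (\<lambda>p m. mleft (mS m) p) (lam a)"

lemma bilin_L: "bilin (\<lambda>p m. mleft (mS m) p)"
  by (simp add: bilin_def clinear_iff S.mS_lin)

lemma clinear_L: "clinear L"
  unfolding L_def by (rule clinear_comp[OF clinear_tensor_lift[OF bilin_L] clinear_lam])

lemmas L_lin = clinear_add[OF clinear_L] clinear_scaleC[OF clinear_L]

lemma L_times_right: "L (a * c) = L a * c"
  by (simp add: L_def lam_times tensor_lift_map bilin_L mleft_mult clinear_lift[OF clinear_mult_right])

lemma mleft_cop: "mleft (cop \<Delta> a) x = flip (mleft (\<Delta> a) (flip x))"
  by (simp add: cop_def mleft_mext_flip)

text \<open>The relation \<open>R \<Delta>(x) = \<Delta>\<^sup>c\<^sup>o\<^sup>p(x) R\<close> yields \<open>\<Sum> S(x\<^sub>(\<^sub>2\<^sub>)) u x\<^sub>(\<^sub>1\<^sub>) = \<epsilon>(x) u\<close>; now write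
  \<open>p \<otimes> q\<close> as a combination of elements \<open>\<Delta>(x)(1 \<otimes> b)\<close>.\<close>

lemma L_times: "L (p * a) = S (S p) * L a"
proof -
  define G where "G y = S1 (flip (mleft R y))" for y
  have G_lin: "G (x + y) = G x + G y" "G (c *\<^sub>C x) = c *\<^sub>C G x" for x y c
    by (simp_all add: G_def flip_add flip_scaleC)
  have cl: "clinear S1" by (simp add: clinear_iff)
  have G_tensor: "G (a \<otimes> b) = S b * L a" for a b
    by (simp add: G_def R_tensor clinear_lift[OF clinear_flip] clinear_lift[OF cl] L_def
        clinear_lift[OF clinear_mult_left] S.mright_mS flip: mright_mleft)
  have G_\<Delta>: "G (mleft (\<Delta> x) y) = \<epsilon> x *\<^sub>C G y" for x y
  proof -
    have "mleft R (mleft (\<Delta> x) y) = mleft (cop \<Delta> x) (mleft R y)"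
      by (simp add: R_\<Delta> flip: mleft_times)
    then show ?thesis by (simp add: G_def mleft_cop S1_\<Delta>)
  qed
  have "G (mright (E a \<otimes>\<^sub>M 1) x) = S (S1 x) * L a" for x
    by (induction x rule: c1_induct)
      (simp_all add: G_lin S_lin tensor_lin slice_cover G_\<Delta> G_tensor flip: mleft_\<Delta>_c1)
  from this[of "p \<otimes> inv S q" for q] have "q * L (p * a) = q * (S (S p) * L a)" for q
    by (simp add: G_tensor S_times mult.assoc)
  then show ?thesis by (rule nondegenerate_eqI_right)
qed

text \<open>Because A = A A, the relation u x = S^2(x) u passes from elements to
  multipliers.\<close>

lemma L_mleft: "L (mleft m a) = mleft (mS (mS m)) (L a)"
proof (induction a rule: times_induct)
  case (gen a b)
  have "S (S (mleft m a)) = mleft (mS (mS m)) (S (S a))"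
    by (simp add: S.mleft_mS S.mright_mS)
  then show ?case by (simp add: L_times mleft_mult)
qed (simp_all add: L_lin)

lemma mS_L: "mleft (mS m) (L a) = L (mleft (mS' m) a)"
  by (simp add: L_mleft)

text \<open>Since u S^-2(m) p = m u p, the sum of the S^-2(m) p is mapped to the sum of the m S(m')
  p', which is a by \<open>lam_cancel\<close>.\<close>

lemma surj_L: "surj L"
proof (rule surjI)
  fix a
  have bl: "bilin (\<lambda>p k. mleft k p)" by (simp add: bilin_def clinear_iff)
  have "L (tensor_lift (\<lambda>p m. mleft (mS' (mS' m)) p) (lam a))
      = tensor_lift (\<lambda>p m. tensor_lift (\<lambda>p' m'. mleft m (mleft (mS m') p')) (lam p)) (lam a)"
    by (simp add: clinear_lift[OF clinear_L] L_mleft) (simp add: L_def clinear_lift[OF clinear_mleft])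
  also have "\<dots> = a"
    using arg_cong[OF lam_cancel[of a], of "tensor_lift (\<lambda>p k. mleft k p)"]
    by (simp add: clinear_lift[OF clinear_tensor_lift[OF bl]] tensor_lift_tensor bl)
  finally show "L (tensor_lift (\<lambda>p m. mleft (mS' (mS' m)) p) (lam a)) = a" .
qed

lemma L_inverse_S2: "L (inv S (inv S c)) * a = c * L a"
  using L_times[of "inv S (inv S c)" a] by (simp add: L_times_right)

text \<open>If u a = 0, then S^2(a) u b = (u a) b = 0 for all b. As u is onto, S^2(a) annihilates
  A.\<close>

lemma bij_L: "bij L"
proof -
  have "a = 0" if "L a = 0" for a
  proof -
    have "S (S a) * L b = 0" for b
      using L_inverse_S2[of "S (S a)" b] that by simp
    from this[of "inv L b" for b] have *: "S (S a) * b = 0" for b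
      by (simp add: surj_f_inv_f[OF surj_L])
    have "S (S a) = 0" by (rule nondegenerate_left) (rule *)
    then have "S (S a) = S (S 0)" by (simp add: S_lin)
    then show ?thesis by simp
  qed
  then have "inj L" by (rule clinear_injI[OF clinear_L])
  then show ?thesis using surj_L by (rule bijI)
qed

text \<open>The right action is dictated by c u = u S^-2(c).\<close>

lemma is_multiplier_L: "is_multiplier (L, \<lambda>c. L (inv S (inv S c)))"
proof -
  have "L (inv S (inv S (a * b))) = a * L (inv S (inv S b))" for a b
    by (simp add: S.inv_times L_times)
  then show ?thesis
    by (simp add: is_multiplier_def clinear_L L_times_right L_inverse_S2
        clinear_comp[OF clinear_L clinear_comp[OF S.clinear_inv S.clinear_inv]])
qed

definition "u = Abs_multiplier (L, \<lambda>c. L (inv S (inv S c)))"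

lemma mleft_u [simp]: "mleft u a = L a" and mright_u: "mright u c = L (inv S (inv S c))"
  by (simp_all add: u_def mleft.rep_eq mright.rep_eq Abs_multiplier_inverse is_multiplier_L)

lemma drinfeld_iff: "drinfeld_multiplier R S v \<longleftrightarrow> v = u"
proof -
  have "half_embed t = R * (E a \<otimes>\<^sub>M 1) \<longleftrightarrow> t = lam a" for t a
    by (simp flip: half_lam)
  then show ?thesis
    unfolding drinfeld_multiplier_def by (auto simp: L_def intro: multiplier_eqI_left)
qed

lemma minvertible_u: "minvertible u"
proof (rule minvertibleI)
  show "bij (mleft u)" using bij_L by (simp add: mleft_u[abs_def])
  have "mright u = L \<circ> (inv S \<circ> inv S)" by (simp add: fun_eq_iff mright_u)
  then show "bij (mright u)"
    using bij_L S.bij_S by (simp add: bij_comp bij_imp_bij_inv)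
qed

lemma u_commute: "u * E a = E (S (S a)) * u"
  by (rule multiplier_eqI_left) (simp add: L_times)


section \<open>Comultiplication of the Drinfeld multiplier\<close>

abbreviation Rf :: "('a \<otimes> 'a) multiplier" where "Rf \<equiv> mext_iso flip R"
abbreviation Rif :: "('a \<otimes> 'a) multiplier" where "Rif \<equiv> mext_iso flip Ri"

lemma Rf_Rif [simp]: "Rf * Rif = 1" "Rif * Rf = 1"
  by (simp_all flip: mext_flip_times add: mext_flip_one)

text \<open>Flipping and inverting R \<Delta> = \<Delta>^cop R shows that (R21)^-1 intertwines
  \<Delta> and \<Delta>^cop in the same direction as R. This is why R^-1 (R21)^-1 commutes with
  \<Delta>(A).\<close>

lemma Rif_\<Delta>: "Rif * \<Delta> a = cop \<Delta> a * Rif"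
proof -
  have "Rf * cop \<Delta> a = \<Delta> a * Rf"
    using arg_cong[OF R_\<Delta>[of a], of "mext_iso flip"] by (simp add: mext_flip_times cop_def)
  then have "Rif * (Rf * cop \<Delta> a) * Rif = Rif * (\<Delta> a * Rf) * Rif" by simp
  moreover have "Rif * (Rf * cop \<Delta> a) * Rif = (Rif * Rf) * cop \<Delta> a * Rif"
    "Rif * (\<Delta> a * Rf) * Rif = Rif * \<Delta> a * (Rf * Rif)" by (simp_all only: mult.assoc)
  ultimately show ?thesis by simp
qed

lemma Ri_cop: "Ri * cop \<Delta> a = \<Delta> a * Ri"
proof -
  have "Ri * (R * \<Delta> a) * Ri = Ri * (cop \<Delta> a * R) * Ri" by (simp add: R_\<Delta>)
  then show ?thesis by (simp add: mult.assoc)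
qed

lemma bilin_\<Delta>_S: "bilin (\<lambda>x m. mleft (mext \<Delta> (mS m)) x)"
  by (simp add: bilin_def clinear_iff S.mS_lin clinear_add[OF clinear_m\<Delta>] clinear_scaleC[OF clinear_m\<Delta>])

text \<open>\<Delta>(u) \<Delta>(a) w = \<Delta>(u a) w is the sum of the \<Delta>(S(m)) \<Delta>(p)
  w, and \<open>Lam_\<Delta>\<close> supplies the sum of the \<Delta>(p) w \<otimes> m.\<close>

lemma mext_\<Delta>_u_Lam: "mleft (mext \<Delta> u) v = tensor_lift (\<lambda>x m. mleft (mext \<Delta> (mS m)) x) (Lam v)"
proof (induction v rule: \<Delta>_left_induct)
  case (gen a w)
  have cl: "clinear (\<lambda>a. mleft (\<Delta> a) w)" by (simp add: clinear_iff \<Delta>_lin)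
  have *: "\<Delta> (mleft n p) = mext \<Delta> n * \<Delta> p" for n p
    by (simp add: mext_times_gen[OF nondeg_\<Delta>])
  have "mleft (mext \<Delta> u) (mleft (\<Delta> a) w) = mleft (\<Delta> (L a)) w"
    using *[of u a] by (simp flip: mleft_times)
  also have "\<dots> = tensor_lift (\<lambda>p m. mleft (mext \<Delta> (mS m)) (mleft (\<Delta> p) w)) (lam a)"
    by (simp add: L_def clinear_lift[OF cl] *)
  also have "\<dots> = tensor_lift (\<lambda>x m. mleft (mext \<Delta> (mS m)) x) (Lam (mleft (\<Delta> a) w))"
    by (simp add: Lam_\<Delta> clinear_lift[OF clinear_tensor_lift[OF bilin_\<Delta>_S]] tensor_lift_tensor bilin_\<Delta>_S)
  finally show ?case .
qed (simp_all add: Lam_lin tensor_lift_add[OF bilin_\<Delta>_S] tensor_lift_scaleC[OF bilin_\<Delta>_S])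

text \<open>Passing \<Delta> through S flips the two legs given by \<open>lam_m\<Delta>\<close>,
  hence the order S(m') \<otimes> S(m). The arbitrary \<open>F\<close> is the context in which the
  sum is to be rewritten.\<close>

lemma lam_\<Delta>_S:
  assumes F: "bilin F"
  shows "tensor_lift (\<lambda>p m. F p (mext \<Delta> (mS m))) (lam a)
    = tensor_lift (\<lambda>p m. tensor_lift (\<lambda>p' m'. F p' (mS m' \<otimes>\<^sub>M mS m)) (lam p)) (lam a)"
proof -
  let ?K = "tensor_lift (\<lambda>p z. F p (mSS z))"
  have bl: "bilin (\<lambda>p z. F p (mSS z))"
    using F by (simp add: bilin_def clinear_comp[OF _ SS.clinear_mS])
  have "?K (tensor_lift (\<lambda>p m. p \<otimes> mext \<Delta> m) (lam a))
      = tensor_lift (\<lambda>p m. F p (mext \<Delta> (mS m))) (lam a)"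
    by (simp add: clinear_lift[OF clinear_tensor_lift[OF bl]] tensor_lift_tensor bl mext_\<Delta>_mS)
  then show ?thesis
    by (simp add: lam_m\<Delta> clinear_lift[OF clinear_tensor_lift[OF bl]] tensor_lift_tensor bl mSS_mtensor)
qed

text \<open>\<open>Lam' x\<close> is \<open>R\<^sup>2\<^sup>3 R\<^sup>1\<^sup>3 (x \<otimes> 1)\<close>.\<close>

definition "Lam' x = tensor_map flip (\<lambda>m. m) (Lam (flip x))"

text \<open>The Yang-Baxter relation (R21)^-1 R13 R23 = R23 R13 (R21)^-1: the product R13 R23 is
  (\<Delta> \<otimes> \<iota>)(R), R23 R13 is its co-opposite version, and (R21)^-1 intertwines the
  two.\<close>

lemma Rif_Lam: "tensor_map (mleft Rif) (\<lambda>m. m) (Lam v) = Lam' (mleft Rif v)"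
proof -
  note cl = clinear_tensor_map[OF clinear_mleft[of Rif] clinear_id]
    clinear_tensor_map[OF clinear_flip clinear_id]
  note lin = clinear_add[OF cl(1)] clinear_add[OF cl(2)] clinear_scaleC[OF cl(1)] clinear_scaleC[OF cl(2)]
  show ?thesis
  proof (induction v rule: \<Delta>_left_induct)
    case (gen a w)
    have *: "mleft Rif (mleft (\<Delta> p) w) = flip (mleft (\<Delta> p) (flip (mleft Rif w)))" for p
      unfolding mleft_times[symmetric] Rif_\<Delta> by (simp add: mleft_cop)
    show ?case
      by (simp add: * Lam'_def Lam_\<Delta> clinear_lift[OF cl(1)] clinear_lift[OF cl(2)]
        tensor_map_tensor clinear_mleft clinear_flip clinear_id)
  qed (simp_all add: Lam'_def lin Lam_lin flip_add flip_scaleC)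
qed

lemma bilin_W: "bilin (\<lambda>x k. mleft (u \<otimes>\<^sub>M mS k) x)"
  by (simp add: bilin_def clinear_iff S.mS_lin mtensor_lin)

definition "W = tensor_lift (\<lambda>x k. mleft (u \<otimes>\<^sub>M mS k) x)"

lemma clinear_W: "clinear W" and W_tensor: "W (x \<otimes> k) = mleft (u \<otimes>\<^sub>M mS k) x"
  by (simp_all add: W_def clinear_tensor_lift tensor_lift_tensor bilin_W)

text \<open>The multiplier leg of R23 meets its own first leg as S(n) q, which sums to u b. The
  remaining S(m) passes through u as S^-1(m), leaving (\<iota> \<otimes> S^-1)(R) = R^-1.\<close>

lemma W_Lam': "W (Lam' x) = mleft (u \<otimes>\<^sub>M u) (mleft Ri x)"
proof (induction x rule: tensor_induct)
  case (tensor a b)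
  note cl = clinear_tensor_map[OF clinear_flip clinear_id]
  have "W (Lam' (a \<otimes> b)) = tensor_lift (\<lambda>q n. tensor_lift (\<lambda>p m. L p \<otimes> mleft (mS m) (mleft (mS n) q)) (lam a)) (lam b)"
    by (simp add: Lam'_def Lam_tensor lam2_def clinear_lift[OF cl] tensor_map_tensor clinear_flip
      clinear_id clinear_lift[OF clinear_W] W_tensor S.mS_times)
  also have "\<dots> = tensor_lift (\<lambda>p m. L p \<otimes> mleft (mS m) (L b)) (lam a)"
  proof (subst tensor_lift_swap)
    have cl: "clinear (\<lambda>x. L p \<otimes> mleft (mS m) x)" for p m by (simp add: clinear_iff tensor_lin)
    show "tensor_lift (\<lambda>p m. tensor_lift (\<lambda>q n. L p \<otimes> mleft (mS m) (mleft (mS n) q)) (lam b)) (lam a)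
        = tensor_lift (\<lambda>p m. L p \<otimes> mleft (mS m) (L b)) (lam a)"
      by (simp add: L_def[of b] clinear_lift[OF cl])
  qed
  also have "\<dots> = mleft (u \<otimes>\<^sub>M u) (mleft Ri (a \<otimes> b))"
    by (simp add: Ri_tensor clinear_lift[OF clinear_mleft] mS_L)
  finally show ?case .
next
  case (add x y)
  then show ?case by (simp add: Lam'_def flip_add Lam_lin clinear_add[OF clinear_W]
      clinear_add[OF clinear_tensor_map[OF clinear_flip clinear_id]])
next
  case (scaleC c x)
  then show ?case by (simp add: Lam'_def flip_scaleC Lam_lin clinear_scaleC[OF clinear_W]
      clinear_scaleC[OF clinear_tensor_map[OF clinear_flip clinear_id]])
qed

lemma mext_\<Delta>_u_W: "mleft (mext \<Delta> u) v = W (tensor_map (mleft Rif) (\<lambda>m. m) (Lam v))"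
proof (induction v rule: tensor_induct)
  case (tensor a b)
  have bl1: "bilin (\<lambda>p z. mleft Z (mleft z (p \<otimes> q)))" for Z and q :: 'a
    by (simp add: bilin_def clinear_iff tensor_lin)
  have bl2: "bilin (\<lambda>q z. mleft z (x \<otimes> mleft k q))" for x :: 'a and k :: "'a multiplier"
    by (simp add: bilin_def clinear_iff tensor_lin)
  note cl = clinear_tensor_map[OF clinear_mleft[of Rif] clinear_id]
  have Rif: "mleft Rif (p \<otimes> q) = tensor_lift (\<lambda>q' n'. mleft (mS' n') p \<otimes> q') (lam q)" for p q
    by (simp add: mleft_mext_flip Ri_tensor clinear_lift[OF clinear_flip])
  have "mleft (mext \<Delta> u) (a \<otimes> b) = tensor_lift (\<lambda>q n. tensor_lift (\<lambda>p m.
      mleft (mext \<Delta> (mS n)) (mleft (mext \<Delta> (mS m)) (p \<otimes> q))) (lam a)) (lam b)"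
    by (subst tensor_lift_swap) (simp add: mext_\<Delta>_u_Lam Lam_tensor lam2_def
        clinear_lift[OF clinear_tensor_lift[OF bilin_\<Delta>_S]] tensor_lift_tensor bilin_\<Delta>_S S.mS_times m\<Delta>_times)
  \<comment> \<open>Splitting \<Delta>(S(m)) into S(m') \<otimes> S(m), the products S(m') p' sum to
    u p.\<close>
  also have "\<dots> = tensor_lift (\<lambda>q n. tensor_lift (\<lambda>p m.
      mleft (mext \<Delta> (mS n)) (L p \<otimes> mleft (mS m) q)) (lam a)) (lam b)"
  proof -
    have cl: "clinear (\<lambda>x. mleft Z (x \<otimes> y))" for Z :: "('a \<otimes> 'a) multiplier" and y
      by (simp add: clinear_iff tensor_lin)
    show ?thesis by (simp add: lam_\<Delta>_S[OF bl1] L_def clinear_lift[OF cl])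
  qed
  also have "\<dots> = tensor_lift (\<lambda>p m. tensor_lift (\<lambda>q n. mleft (mext \<Delta> (mS n)) (L p \<otimes> mleft (mS m) q)) (lam b)) (lam a)"
    by (rule tensor_lift_swap)
  \<comment> \<open>Splitting \<Delta>(S(n)) likewise, S(n') u = u S^-1(n'), and the sum of the
    S^-1(n') p \<otimes> q' is (R21)^-1 applied to p \<otimes> q.\<close>
  also have "\<dots> = tensor_lift (\<lambda>p m. tensor_lift (\<lambda>q n. mleft (u \<otimes>\<^sub>M mS (m * n)) (mleft Rif (p \<otimes> q))) (lam b)) (lam a)"
  proof -
    have "tensor_lift (\<lambda>q n. mleft (mext \<Delta> (mS n)) (x \<otimes> mleft k q)) (lam b)
      = tensor_lift (\<lambda>q n. tensor_lift (\<lambda>q' n'. mleft (mS n') x \<otimes> mleft (mS n) (mleft k q')) (lam q)) (lam b)" for x k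
      by (simp add: lam_\<Delta>_S[OF bl2])
    then show ?thesis by (simp add: Rif clinear_lift[OF clinear_mleft] S.mS_times mS_L)
  qed
  also have "\<dots> = W (tensor_map (mleft Rif) (\<lambda>m. m) (Lam (a \<otimes> b)))"
    by (simp add: Lam_tensor lam2_def clinear_lift[OF cl] tensor_map_tensor clinear_mleft clinear_id
      clinear_lift[OF clinear_W] W_tensor)
  finally show ?case .
next
  case (add x y)
  then show ?case by (simp add: Lam_lin clinear_add[OF clinear_W]
      clinear_add[OF clinear_tensor_map[OF clinear_mleft clinear_id]])
next
  case (scaleC c x)
  then show ?case by (simp add: Lam_lin clinear_scaleC[OF clinear_W]
      clinear_scaleC[OF clinear_tensor_map[OF clinear_mleft clinear_id]])
qed

lemma mext_\<Delta>_u: "mext \<Delta> u = (u \<otimes>\<^sub>M u) * (Ri * Rif)"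
  by (rule multiplier_eqI_left) (simp add: mext_\<Delta>_u_W Rif_Lam W_Lam')

lemma mSS_flip: "mSS (mext_iso flip m) = mext_iso flip (mSS m)"
proof (rule mSS_eqI)
  have fl: "flip (SS y) = SS (flip y)" for y
    by (induction y rule: tensor_induct) (simp_all add: SS_lin flip_add flip_scaleC)
  show "mleft (mext_iso flip (mSS m)) (SS x) = SS (mright (mext_iso flip m) x)" for x
    by (simp add: mleft_mext_flip mright_mext_flip fl SS.mleft_mS)
qed

lemma mSS_Ri: "mSS Ri = Rif" and mSS_Rif: "mSS Rif = Ri"
proof -
  have "mSS Ri * Rf = 1"
    by (simp flip: mSS_R SS.mS_times add: SS.mS_one)
  then have "mSS Ri * Rf * Rif = Rif" by simp
  then show "mSS Ri = Rif" by (simp add: mult.assoc)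
  then show "mSS Rif = Ri" by (simp add: mSS_flip)
qed

lemma mext_\<Delta>_mS_u: "mext \<Delta> (mS u) = (Ri * Rif) * (mS u \<otimes>\<^sub>M mS u)"
  by (simp add: mext_\<Delta>_mS mext_\<Delta>_u SS.mS_times mSS_Ri mSS_Rif mSS_mtensor)

lemma Ri_Rif_commute: "(Ri * Rif) * mext \<Delta> m = mext \<Delta> m * (Ri * Rif)"
proof (rule nondeg_hom_times_cancel[OF nondeg_\<Delta>])
  have *: "(Ri * Rif) * \<Delta> a = \<Delta> a * (Ri * Rif)" for a
    by (simp add: mult.assoc Rif_\<Delta>) (simp add: Ri_cop flip: mult.assoc)
  fix a
  have "(Ri * Rif) * mext \<Delta> m * \<Delta> a = (Ri * Rif) * \<Delta> (mleft m a)"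
    by (simp only: mult.assoc mext_times_gen[OF nondeg_\<Delta>])
  also have "\<dots> = mext \<Delta> m * \<Delta> a * (Ri * Rif)"
    by (simp only: * mext_times_gen[OF nondeg_\<Delta>])
  also have "\<dots> = mext \<Delta> m * (Ri * Rif) * \<Delta> a"
    by (simp only: mult.assoc * [unfolded mult.assoc])
  finally show "(Ri * Rif) * mext \<Delta> m * \<Delta> a = mext \<Delta> m * (Ri * Rif) * \<Delta> a" .
qed

lemma mext_\<Delta>_mS_u': "mext \<Delta> (mS u) = (mS u \<otimes>\<^sub>M mS u) * (Ri * Rif)" (is "?D = ?w * ?q")
proof -
  have inv: "(Rf * R) * ?q = 1"
    by (simp add: mult.assoc)
  \<comment> \<open>Commutation gives q \<Delta>(S(u)) = \<Delta>(S(u)) q = q (S(u) \<otimes> S(u))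
    q; the left factor q is then cancelled by its inverse R21 R.\<close>
  have "?q * (?w * ?q) = ?q * ?D"
    using Ri_Rif_commute[of "mS u"] by (simp add: mext_\<Delta>_mS_u mult.assoc)
  then have "((Rf * R) * ?q) * (?w * ?q) = ((Rf * R) * ?q) * ?D" by (simp only: mult.assoc)
  then show ?thesis by (simp only: inv mult_1_left)
qed

section \<open>The grouplike multiplier and the fourth power of the antipode\<close>

lemma minverse_mS_u: "mS u * mS (minverse u) = 1" "mS (minverse u) * mS u = 1"
  using minverse[OF minvertible_u] by (simp_all flip: S.mS_times add: S.mS_one)

lemma minverse_mS_eq: "minverse (mS u) = mS (minverse u)"
  by (rule minverse_eq) (rule minverse_mS_u)+

lemma grouplike_u: "grouplike \<Delta> (u * minverse (mS u))"
proof -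
  let ?w = "mS u" and ?wi = "mS (minverse u)" and ?q = "Ri * Rif"
  let ?g = "u * ?wi"
  have gw: "?g * ?w = u" by (simp add: mult.assoc minverse_mS_u)
  have D: "mext \<Delta> ?w * mext \<Delta> ?wi = 1"
    by (simp flip: m\<Delta>_times add: minverse_mS_u m\<Delta>_one)
  have "mext \<Delta> ?g * mext \<Delta> ?w = mext \<Delta> u"
    by (simp only: m\<Delta>_times[symmetric] gw)
  \<comment> \<open>In each leg u = g S(u), while the factor q stands on the right in both
    coproducts and is carried along.\<close>
  also have "\<dots> = (?g \<otimes>\<^sub>M ?g) * mext \<Delta> ?w"
    unfolding mext_\<Delta>_mS_u' mext_\<Delta>_u mult.assoc[symmetric, of "?g \<otimes>\<^sub>M ?g"] mtensor_times gw ..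
  finally have "mext \<Delta> ?g * (mext \<Delta> ?w * mext \<Delta> ?wi) = (?g \<otimes>\<^sub>M ?g) * (mext \<Delta> ?w * mext \<Delta> ?wi)"
    by (simp only: mult.assoc[symmetric])
  then show ?thesis by (simp add: D grouplike_def minverse_mS_eq)
qed

lemma S4_u: "E ((S ^^ 4) a) = (u * minverse (mS u)) * E a * minverse (u * minverse (mS u))"
proof -
  let ?w = "mS u" and ?ui = "minverse u" and ?wi = "mS (minverse u)"
  note inv = minverse[OF minvertible_u]
  have gi: "minverse (u * ?wi) = ?w * ?ui"
  proof (rule minverse_eq)
    have "(u * ?wi) * (?w * ?ui) = u * ((?wi * ?w) * ?ui)" by (simp only: mult.assoc)
    then show "(u * ?wi) * (?w * ?ui) = 1" by (simp add: inv minverse_mS_u)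
    have "(?w * ?ui) * (u * ?wi) = ?w * ((?ui * u) * ?wi)" by (simp only: mult.assoc)
    then show "(?w * ?ui) * (u * ?wi) = 1" by (simp add: inv minverse_mS_u)
  qed
  \<comment> \<open>Applying the anti-automorphism S to u S^-1(a) = S(a) u gives a S(u) = S(u)
    S^2(a).\<close>
  have "E a * ?w = ?w * E (S (S a))"
    using arg_cong[OF u_commute[of "inv S a"], of mS] by (simp add: S.mS_times S.mS_embed)
  then have "(u * ?wi) * E a * (?w * ?ui) = u * ((?wi * ?w) * E (S (S a))) * ?ui"
    by (simp only: mult.assoc)(simp flip: mult.assoc[of "E a"] add: mult.assoc)
  also have "\<dots> = E (S (S (S (S a)))) * (u * ?ui)"
    by (simp add: minverse_mS_u u_commute mult.assoc)
  finally show ?thesis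
    by (simp add: gi inv minverse_mS_eq numeral_eq_Suc)
qed

end

theorem proposition2p6:
  fixes \<Delta> :: "'a::nondegenerate_algebra \<Rightarrow> ('a \<otimes> 'a) multiplier"
    and \<epsilon> :: "'a \<Rightarrow> complex" and S :: "'a \<Rightarrow> 'a" and R :: "('a \<otimes> 'a) multiplier"
  assumes "regular_multiplier_hopf_algebra \<Delta>"
    and "is_counit \<Delta> \<epsilon>" and "is_antipode \<Delta> \<epsilon> S"
    and "generalized_R_matrix \<Delta> R"
  shows "(\<exists>!u. drinfeld_multiplier R S u) \<and>
    (\<forall>u g. drinfeld_multiplier R S u \<longrightarrow> g = u * minverse (mext_anti S u) \<longrightarrow>
      minvertible u \<and> grouplike \<Delta> g \<and>
      (\<forall>a. mult_embed ((S ^^ 4) a) = g * mult_embed a * minverse g))"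
proof -
  interpret quasitriangular \<Delta> \<epsilon> S R
    by (intro quasitriangular.intro regular_mha.intro quasitriangular_axioms.intro assms)
  show ?thesis
    by (simp add: drinfeld_iff minvertible_u grouplike_u S4_u)
qed

end
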